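(* Let $\Gamma=\mathrm{PSL}(2,\mathbb Z)$ and let $H$ be a finite index subgroup of $\Gamma$. Then for each $\alpha\in(0,1]$ and for (Lebesgue) almost every real $x$, the $\alpha$-continued fraction approximants $p_n/q_n$ of $x$ are distributed in the cusps of $H$ according to the relative cusp widths; that is, for every cusp $\kappa$ of $H$, $$\lim_{N\to\infty}\frac{\#\{1\le n\le N\mid p_n/q_n\in\kappa\}}{N}=\frac{w(\kappa)}{[\Gamma:H]}.$$
   Context: A cusp $\kappa$ of $H$ is an $H$-orbit in $\mathbb Q\cup\{\infty\}$ (Möbius action). Its width $w(\kappa)$ is the index of the $H$-stabilizer of a point of $\kappa$ inside the $\Gamma$-stabilizer of that point. $\alpha$-continued fractions (Nakada): for $\alpha\in(0,1]$ let $\mathbb I_\alpha=[\alpha-1,\alpha)$ and define $T_\alpha:\mathbb I_\alpha\to\mathbb I_\alpha$ by $T_\alpha(x)=\left|\frac1x\right|-\left\lfloor\left|\frac1x\right|+1-\alpha\right\rfloor$ for $x\neq0$, $T_\alpha(0)=0$. For $x\in\mathbb I_\alpha$ put $\varepsilon(x)=1$ if $x\ge0$, $\varepsilon(x)=-1$ if $x<0$, and $d_\alpha(x)=\left\lfloor\left|\frac1x\right|+1-\alpha\right\rfloor$ (with $d_\alpha(0)=\infty$). For $x\in\mathbb I_\alpha$ and $n\ge1$ put $\varepsilon_n=\varepsilon(T_\alpha^{n-1}(x))$, $d_n=d_\alpha(T_\alpha^{n-1}(x))$. The approximants $p_n/q_n$ of $x\in\mathbb I_\alpha$ are given by $$p_{-1}=1,\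 p_0=0,\ p_n=d_np_{n-1}+\varepsilon_np_{n-2};\qquad q_{-1}=0,\ q_0=1,\ q_n=d_nq_{n-1}+\varepsilon_nq_{n-2}\quad(n\ge1).$$ For general real $x$, let $d_0\in\mathbb Z$ be the integer with $x-d_0\in\mathbb I_\alpha$; the $n$-th approximant of $x$ is $d_0$ plus the $n$-th approximant of $x-d_0$. For irrational $x$ all approximants are defined. *)

theory Defs
  imports "HOL-Analysis.Analysis" "HOL-Algebra.Group_Action"
begin

subsection \<open>The modular group and its action on the projective line over the rationals\<close>

definition SL2Z :: "(int^2^2) monoid" where
  "SL2Z = \<lparr>carrier = {A. det A = 1}, mult = (**), one = mat 1\<rparr>"

definition PSL2Z :: "(int^2^2) set monoid" where
  "PSL2Z = SL2Z Mod {mat 1, - mat 1}"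

text \<open>
  Points of the rational projective line are elements of \<^typ>\<open>rat option\<close>, with
  \<^term>\<open>None\<close> standing for the point at infinity.
\<close>

fun moebius :: "int^2^2 \<Rightarrow> rat option \<Rightarrow> rat option" where
  "moebius A None =
     (if A$2$1 = 0 then None else Some (of_int (A$1$1) / of_int (A$2$1)))"
| "moebius A (Some r) =
     (if of_int (A$2$1) * r + of_int (A$2$2) = 0 then None
      else Some ((of_int (A$1$1) * r + of_int (A$1$2)) / (of_int (A$2$1) * r + of_int (A$2$2))))"

text \<open>
  An element of \<^const>\<open>PSL2Z\<close> is a coset consisting of a matrix and its negative, which act
  in the same way (see \<open>psl_act_rcos\<close> below).
\<close>

definition psl_act :: "(int^2^2) set \<Rightarrow> rat option \<Rightarrow> rat option" where
  "psl_act g x = the_elem ((\<lambda>A. moebius A x) ` g)"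


subsection \<open>Cusps and their widths\<close>

definition group_index :: "('a, 'b) monoid_scheme \<Rightarrow> 'a set \<Rightarrow> nat" where
  "group_index G K = card (rcosets\<^bsub>G\<^esub> K)"

definition cusps :: "(int^2^2) set set \<Rightarrow> rat option set set" where
  "cusps H = orbits (PSL2Z\<lparr>carrier := H\<rparr>) UNIV psl_act"

definition point_width :: "(int^2^2) set set \<Rightarrow> rat option \<Rightarrow> nat" where
  "point_width H x =
     group_index (PSL2Z\<lparr>carrier := stabilizer PSL2Z psl_act x\<rparr>)
       (stabilizer (PSL2Z\<lparr>carrier := H\<rparr>) psl_act x)"

definition cusp_width :: "(int^2^2) set set \<Rightarrow> rat option set \<Rightarrow> nat" where
  "cusp_width H \<kappa> = point_width H (SOME x. x \<in> \<kappa>)"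


subsection \<open>Nakada's continued fractions\<close>

definition I_alpha :: "real \<Rightarrow> real set" where
  "I_alpha \<alpha> = {\<alpha> - 1..<\<alpha>}"

text \<open>
  The digit of 0 is conventionally infinite; the value of \<open>d_alpha\<close> at 0 is therefore
  meaningless, but it is never used in the expansion of an irrational number.
\<close>

definition d_alpha :: "real \<Rightarrow> real \<Rightarrow> int" where
  "d_alpha \<alpha> x = \<lfloor>\<bar>1 / x\<bar> + 1 - \<alpha>\<rfloor>"

definition T_alpha :: "real \<Rightarrow> real \<Rightarrow> real" where
  "T_alpha \<alpha> x = (if x = 0 then 0 else \<bar>1 / x\<bar> - of_int \<lfloor>\<bar>1 / x\<bar> + 1 - \<alpha>\<rfloor>)"

definition eps :: "real \<Rightarrow> int" where
  "eps x = (if x \<ge> 0 then 1 else - 1)"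

definition eps_n :: "real \<Rightarrow> real \<Rightarrow> nat \<Rightarrow> int" where
  "eps_n \<alpha> x n = eps ((T_alpha \<alpha> ^^ (n - 1)) x)"

definition d_n :: "real \<Rightarrow> real \<Rightarrow> nat \<Rightarrow> int" where
  "d_n \<alpha> x n = d_alpha \<alpha> ((T_alpha \<alpha> ^^ (n - 1)) x)"

text \<open>
  In the equations for \<^term>\<open>Suc 0\<close>, the last factors 1 and 0 are the initial values of the
  recurrences at index -1.
\<close>

fun p_n :: "real \<Rightarrow> real \<Rightarrow> nat \<Rightarrow> int" where
  "p_n \<alpha> x 0 = 0"
| "p_n \<alpha> x (Suc 0) = d_n \<alpha> x 1 * p_n \<alpha> x 0 + eps_n \<alpha> x 1 * 1"
| "p_n \<alpha> x (Suc (Suc n)) =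
     d_n \<alpha> x (n + 2) * p_n \<alpha> x (Suc n) + eps_n \<alpha> x (n + 2) * p_n \<alpha> x n"

fun q_n :: "real \<Rightarrow> real \<Rightarrow> nat \<Rightarrow> int" where
  "q_n \<alpha> x 0 = 1"
| "q_n \<alpha> x (Suc 0) = d_n \<alpha> x 1 * q_n \<alpha> x 0 + eps_n \<alpha> x 1 * 0"
| "q_n \<alpha> x (Suc (Suc n)) =
     d_n \<alpha> x (n + 2) * q_n \<alpha> x (Suc n) + eps_n \<alpha> x (n + 2) * q_n \<alpha> x n"

definition d_0 :: "real \<Rightarrow> real \<Rightarrow> int" where
  "d_0 \<alpha> x = (THE d. x - of_int d \<in> I_alpha \<alpha>)"

text \<open>
  For irrational \<^term>\<open>x\<close> the denominators below are positive (see \<open>q_n_pos\<close>), so the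
  approximants are finite points.
\<close>

definition approximant :: "real \<Rightarrow> real \<Rightarrow> nat \<Rightarrow> rat option" where
  "approximant \<alpha> x n =
     (let y = x - of_int (d_0 \<alpha> x)
      in Some (of_int (d_0 \<alpha> x) + of_int (p_n \<alpha> y n) / of_int (q_n \<alpha> y n)))"


subsection \<open>The definitions make sense\<close>

lemma d_0_eq: "d_0 \<alpha> x = \<lfloor>x + 1 - \<alpha>\<rfloor>"
  unfolding d_0_def I_alpha_def by (rule the_equality) (simp; linarith)+

lemma d_0_in: "x - of_int (d_0 \<alpha> x) \<in> I_alpha \<alpha>"
  unfolding d_0_eq I_alpha_def by (simp; linarith)

lemma T_alpha_in: "x \<noteq> 0 \<Longrightarrow> T_alpha \<alpha> x \<in> I_alpha \<alpha>"
  unfolding T_alpha_def I_alpha_def by (simp; linarith)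

lemma T_alpha_irrational:
  assumes "x \<notin> \<rat>"
  shows "T_alpha \<alpha> x \<notin> \<rat>"
proof
  assume *: "T_alpha \<alpha> x \<in> \<rat>"
  have x0: "x \<noteq> 0" using assms by auto
  have "\<bar>1 / x\<bar> = T_alpha \<alpha> x + of_int \<lfloor>\<bar>1 / x\<bar> + 1 - \<alpha>\<rfloor>"
    using x0 by (simp add: T_alpha_def)
  also have "\<dots> \<in> \<rat>" using * by simp
  finally have "\<bar>1 / x\<bar> \<in> \<rat>" .
  hence "1 / x \<in> \<rat>" by (auto simp: abs_if split: if_splits)
  hence "1 / (1 / x) \<in> \<rat>" by (rule Rats_divide[OF Rats_1])
  with assms show False by simp
qed

lemma iterate_T_alpha:
  assumes "x \<notin> \<rat>" "x \<in> I_alpha \<alpha>"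
  shows "(T_alpha \<alpha> ^^ n) x \<notin> \<rat> \<and> (T_alpha \<alpha> ^^ n) x \<in> I_alpha \<alpha>"
proof (induction n)
  case (Suc n)
  hence "(T_alpha \<alpha> ^^ n) x \<noteq> 0" by auto
  with Suc show ?case by (simp add: T_alpha_irrational T_alpha_in)
qed (use assms in simp)

lemma d_alpha_ge:
  assumes "0 < \<alpha>" "\<alpha> \<le> 1" "x \<notin> \<rat>" "x \<in> I_alpha \<alpha>"
  shows "d_alpha \<alpha> x \<ge> 1" "x < 0 \<Longrightarrow> d_alpha \<alpha> x \<ge> 2"
proof -
  have x0: "x \<noteq> 0" using assms by auto
  have b: "\<alpha> - 1 \<le> x" "x < \<alpha>" using assms by (auto simp: I_alpha_def)
  show 2: "d_alpha \<alpha> x \<ge> 2" if "x < 0"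
  proof -
    define t where "t = 1 - \<alpha>"
    have t: "0 < t" "- x \<le> t" using b that by (auto simp: t_def)
    have "1 / t \<le> 1 / (- x)" using t that by (intro divide_left_mono mult_pos_pos) linarith+
    moreover have "1 / t + t \<ge> 2"
    proof -
      have "0 \<le> (1 - t)\<^sup>2 / t" using t by simp
      also have "\<dots> = 1 / t + t - 2" using t by (simp add: field_simps power2_eq_square)
      finally show ?thesis by simp
    qed
    ultimately have "2 \<le> 1 / (- x) + t" by linarith
    also have "1 / (- x) = \<bar>1 / x\<bar>" using that by simp
    finally show ?thesis by (simp add: d_alpha_def le_floor_iff t_def algebra_simps)
  qed
  show "d_alpha \<alpha> x \<ge> 1"
  proof (cases "x < 0")
    case False
    hence "x > 0" using x0 by simp
    hence "1 / \<alpha> \<le> 1 / x" using b assms by (intro divide_left_mono) auto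
    moreover have "1 / \<alpha> \<ge> 1" using assms by simp
    moreover have "\<alpha> \<le> 1 / \<alpha>" using assms calculation(2) by linarith
    moreover have "\<bar>1 / x\<bar> = 1 / x" using \<open>x > 0\<close> by simp
    ultimately show ?thesis by (simp add: d_alpha_def le_floor_iff)
  qed (use 2 in simp)
qed

lemma q_n_pos:
  assumes "0 < \<alpha>" "\<alpha> \<le> 1" "x \<notin> \<rat>" "x \<in> I_alpha \<alpha>"
  shows "q_n \<alpha> x n > 0"
proof -
  have ge: "d_n \<alpha> x k \<ge> 1" "eps_n \<alpha> x k = 1 \<or> eps_n \<alpha> x k = -1 \<and> d_n \<alpha> x k \<ge> 2" for k
    using d_alpha_ge[OF assms(1,2)] iterate_T_alpha[OF assms(3,4), of "k - 1"]
    by (auto simp: d_n_def eps_n_def eps_def)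
  have "0 < q_n \<alpha> x n \<and> q_n \<alpha> x n \<le> q_n \<alpha> x (Suc n)"
  proof (induction n)
    case 0
    show ?case using ge(1)[of 1] by simp
  next
    case (Suc n)
    let ?d = "d_n \<alpha> x (n + 2)" and ?a = "q_n \<alpha> x (Suc n)" and ?b = "q_n \<alpha> x n"
    have a: "?a > 0" using Suc by linarith
    from ge(2)[of "n + 2"] have "?a \<le> q_n \<alpha> x (Suc (Suc n))"
    proof
      assume e: "eps_n \<alpha> x (n + 2) = 1"
      have "1 * ?a \<le> ?d * ?a" using ge(1)[of "n + 2"] a by (intro mult_right_mono) auto
      moreover have "q_n \<alpha> x (Suc (Suc n)) = ?d * ?a + ?b" using e by simp
      ultimately show ?thesis using Suc by linarith
    next
      assume e: "eps_n \<alpha> x (n + 2) = -1 \<and> d_n \<alpha> x (n + 2) \<ge> 2"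
      hence "2 * ?a \<le> ?d * ?a" using a by (intro mult_right_mono) auto
      moreover have "q_n \<alpha> x (Suc (Suc n)) = ?d * ?a - ?b" using e by simp
      ultimately show ?thesis using Suc by linarith
    qed
    with a show ?case by blast
  qed
  thus ?thesis ..
qed

lemma SL2Z_group: "group SL2Z"
proof (rule groupI)
  fix A assume "A \<in> carrier SL2Z"
  hence d: "A$1$1 * A$2$2 - A$1$2 * A$2$1 = 1" by (simp add: SL2Z_def det_2)
  let ?B = "vector [vector [A$2$2, - A$1$2], vector [- A$2$1, A$1$1]] :: int^2^2"
  have "det ?B = 1" using d by (simp add: det_2 algebra_simps)
  moreover have "?B ** A = mat 1"
    using d by (simp add: vec_eq_iff matrix_matrix_mult_def mat_def forall_2 sum_2 algebra_simps)
  ultimately show "\<exists>B\<in>carrier SL2Z. B \<otimes>\<^bsub>SL2Z\<^esub> A = \<one>\<^bsub>SL2Z\<^esub>"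
    by (auto simp: SL2Z_def)
qed (auto simp: SL2Z_def det_mul matrix_mul_assoc)

lemma neg_mat_mul:
  fixes A :: "int^2^2"
  shows "(- mat 1) ** A = - A" "A ** (- mat 1) = - A"
  by (simp_all add: vec_eq_iff matrix_matrix_mult_def mat_def forall_2 sum_2)

lemma center_normal: "{mat 1, - mat 1} \<lhd> SL2Z"
proof -
  interpret group SL2Z by (rule SL2Z_group)
  have c: "- mat 1 \<in> carrier SL2Z" "mat 1 \<in> carrier SL2Z"
    by (simp_all add: SL2Z_def det_2 mat_def)
  have m: "(- mat 1) \<otimes>\<^bsub>SL2Z\<^esub> (- mat 1) = (mat 1 :: int^2^2)"
    by (simp add: SL2Z_def neg_mat_mul)
  have o: "\<one>\<^bsub>SL2Z\<^esub> = mat 1" by (simp add: SL2Z_def)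
  have "inv\<^bsub>SL2Z\<^esub> (- mat 1) = - mat 1" using m c o by (intro inv_equality) auto
  moreover have "inv\<^bsub>SL2Z\<^esub> (mat 1) = mat 1" using inv_one o by simp
  ultimately have sub: "subgroup {mat 1, - mat 1} SL2Z"
    using c m o by (intro subgroupI) (auto simp: SL2Z_def neg_mat_mul)
  have "{mat 1, - mat 1} #>\<^bsub>SL2Z\<^esub> A = A <#\<^bsub>SL2Z\<^esub> {mat 1, - mat 1}" for A
    by (auto simp: r_coset_def l_coset_def SL2Z_def neg_mat_mul)
  thus ?thesis using sub by (intro normalI) auto
qed

lemma PSL2Z_group: "group PSL2Z"
  unfolding PSL2Z_def by (rule normal.factorgroup_is_group[OF center_normal])

lemma rcos_eq: "{mat 1, - mat 1} #>\<^bsub>SL2Z\<^esub> A = {A, - A}"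
  by (auto simp: r_coset_def SL2Z_def neg_mat_mul)

definition rat_point :: "rat \<Rightarrow> rat \<Rightarrow> rat option" where
  "rat_point u v = (if v = 0 then None else Some (u / v))"

lemma rat_point_cases:
  obtains u v where "x = rat_point u v" "u \<noteq> 0 \<or> v \<noteq> 0"
proof (cases x)
  case None
  thus ?thesis using that[of 1 0] by (simp add: rat_point_def)
next
  case (Some r)
  thus ?thesis using that[of r 1] by (simp add: rat_point_def)
qed

lemma moebius_rat_point:
  assumes "u \<noteq> 0 \<or> v \<noteq> 0"
  shows "moebius A (rat_point u v) =
    rat_point (of_int (A$1$1) * u + of_int (A$1$2) * v) (of_int (A$2$1) * u + of_int (A$2$2) * v)"
proof (cases "v = 0")
  case True
  thus ?thesis using assms by (simp add: rat_point_def)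
next
  case False
  have e: "of_int m * (u / v) + of_int n = (of_int m * u + of_int n * v) / v" for m n :: int
    using False by (simp add: field_simps)
  have "moebius A (rat_point u v) = moebius A (Some (u / v))"
    using False by (simp add: rat_point_def)
  also have "\<dots> = rat_point (of_int (A$1$1) * u + of_int (A$1$2) * v) (of_int (A$2$1) * u + of_int (A$2$2) * v)"
    using False unfolding moebius.simps e by (simp add: rat_point_def)
  finally show ?thesis .
qed

lemma moebius_mult:
  assumes "det B = 1"
  shows "moebius (A ** B) x = moebius A (moebius B x)"
proof -
  obtain u v where x: "x = rat_point u v" and uv: "u \<noteq> 0 \<or> v \<noteq> 0"
    by (rule rat_point_cases)
  let ?u = "of_int (B$1$1) * u + of_int (B$1$2) * v"
  let ?v = "of_int (B$2$1) * u + of_int (B$2$2) * v"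
  have d: "of_int (B$1$1) * of_int (B$2$2) - of_int (B$1$2) * of_int (B$2$1) = (1::rat)"
    using assms unfolding det_2 of_int_mult[symmetric] of_int_diff[symmetric] by simp
  have uv': "?u \<noteq> 0 \<or> ?v \<noteq> 0"
  proof (rule ccontr)
    assume "\<not> ?thesis"
    hence z: "?u = 0" "?v = 0" by auto
    have "of_int (B$2$2) * ?u - of_int (B$1$2) * ?v =
        (of_int (B$1$1) * of_int (B$2$2) - of_int (B$1$2) * of_int (B$2$1)) * u"
      by (simp add: algebra_simps)
    moreover have "of_int (B$1$1) * ?v - of_int (B$2$1) * ?u =
        (of_int (B$1$1) * of_int (B$2$2) - of_int (B$1$2) * of_int (B$2$1)) * v"
      by (simp add: algebra_simps)
    ultimately show False using z d uv by simp
  qed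
  show ?thesis
    unfolding x moebius_rat_point[OF uv] moebius_rat_point[OF uv']
    by (simp add: matrix_matrix_mult_def sum_2 algebra_simps)
qed

lemma moebius_uminus: "moebius (- A) x = moebius A x"
proof -
  obtain u v where x: "x = rat_point u v" and uv: "u \<noteq> 0 \<or> v \<noteq> 0"
    by (rule rat_point_cases)
  have neg: "rat_point (- a) (- b) = rat_point a b" for a b
    by (simp add: rat_point_def)
  show ?thesis
    unfolding x moebius_rat_point[OF uv]
    using neg[of "of_int (A$1$1) * u + of_int (A$1$2) * v" "of_int (A$2$1) * u + of_int (A$2$2) * v"]
    by simp
qed

lemma psl_act_rcos: "psl_act ({mat 1, - mat 1} #>\<^bsub>SL2Z\<^esub> A) x = moebius A x"
  unfolding psl_act_def rcos_eq by (simp add: moebius_uminus)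

lemma psl_act_action: "group_action PSL2Z UNIV psl_act"
proof -
  interpret N: normal "{mat 1, - mat 1}" SL2Z by (rule center_normal)
  have car: "\<exists>A. det A = 1 \<and> g = {mat 1, - mat 1} #>\<^bsub>SL2Z\<^esub> A" if "g \<in> carrier PSL2Z" for g
    using that by (auto simp: PSL2Z_def FactGroup_def RCOSETS_def SL2Z_def)
  have mult: "psl_act (g \<otimes>\<^bsub>PSL2Z\<^esub> h) x = psl_act g (psl_act h x)"
    if gh: "g \<in> carrier PSL2Z" "h \<in> carrier PSL2Z" for g h x
  proof -
    obtain A B where A: "det A = 1" "g = {mat 1, - mat 1} #>\<^bsub>SL2Z\<^esub> A"
      and B: "det B = 1" "h = {mat 1, - mat 1} #>\<^bsub>SL2Z\<^esub> B"
      using car gh by meson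
    have "g \<otimes>\<^bsub>PSL2Z\<^esub> h = {mat 1, - mat 1} #>\<^bsub>SL2Z\<^esub> (A ** B)"
      using N.rcos_sum[of A B] A B by (simp add: PSL2Z_def FactGroup_def SL2Z_def)
    thus ?thesis using A B by (simp add: psl_act_rcos moebius_mult)
  qed
  interpret G: group PSL2Z by (rule PSL2Z_group)
  have one: "psl_act \<one>\<^bsub>PSL2Z\<^esub> x = x" for x
  proof -
    have "\<one>\<^bsub>PSL2Z\<^esub> = {mat 1, - mat 1} #>\<^bsub>SL2Z\<^esub> (mat 1)"
      by (simp add: PSL2Z_def FactGroup_def rcos_eq)
    hence "psl_act \<one>\<^bsub>PSL2Z\<^esub> x = moebius (mat 1) x" by (simp only: psl_act_rcos)
    also have "\<dots> = x" by (cases x) (simp_all add: mat_def)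
    finally show ?thesis .
  qed
  have "bij (psl_act g)" if "g \<in> carrier PSL2Z" for g
    using mult[of g "inv\<^bsub>PSL2Z\<^esub> g"] mult[of "inv\<^bsub>PSL2Z\<^esub> g" g] that one
    by (intro o_bij[of "psl_act (inv\<^bsub>PSL2Z\<^esub> g)"]) (auto simp: fun_eq_iff)
  hence "psl_act \<in> hom PSL2Z (BijGroup UNIV)"
    using mult by (auto simp: hom_def BijGroup_def Bij_def fun_eq_iff compose_def)
  thus ?thesis
    by (simp add: group_action_def group_hom_def group_hom_axioms_def PSL2Z_group group_BijGroup)
qed

lemma point_width_orbit:
  assumes H: "subgroup H PSL2Z" and h: "h \<in> H"
  shows "point_width H (psl_act h x) = point_width H x"
proof -
  interpret G: group PSL2Z by (rule PSL2Z_group)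
  interpret A: group_action PSL2Z UNIV psl_act by (rule psl_act_action)
  define c where "c g = h \<otimes>\<^bsub>PSL2Z\<^esub> g \<otimes>\<^bsub>PSL2Z\<^esub> inv\<^bsub>PSL2Z\<^esub> h" for g
  define c' where "c' g = inv\<^bsub>PSL2Z\<^esub> h \<otimes>\<^bsub>PSL2Z\<^esub> g \<otimes>\<^bsub>PSL2Z\<^esub> h" for g
  have hc: "h \<in> carrier PSL2Z" using subgroup.mem_carrier[OF H h] .
  have cc: "c g \<in> carrier PSL2Z" "c' g \<in> carrier PSL2Z" "c (c' g) = g" "c' (c g) = g"
    if "g \<in> carrier PSL2Z" for g
  proof -
    have *: "h \<otimes>\<^bsub>PSL2Z\<^esub> (inv\<^bsub>PSL2Z\<^esub> h \<otimes>\<^bsub>PSL2Z\<^esub> z) = z" "inv\<^bsub>PSL2Z\<^esub> h \<otimes>\<^bsub>PSL2Z\<^esub> (h \<otimes>\<^bsub>PSL2Z\<^esub> z) = z"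
      if "z \<in> carrier PSL2Z" for z
      using hc that by (simp_all add: G.m_assoc[symmetric])
    show "c g \<in> carrier PSL2Z" "c' g \<in> carrier PSL2Z" "c (c' g) = g" "c' (c g) = g"
      using that hc * by (simp_all add: c_def c'_def G.m_assoc)
  qed
  have cm: "c (a \<otimes>\<^bsub>PSL2Z\<^esub> b) = c a \<otimes>\<^bsub>PSL2Z\<^esub> c b" if "a \<in> carrier PSL2Z" "b \<in> carrier PSL2Z" for a b
  proof -
    have "inv\<^bsub>PSL2Z\<^esub> h \<otimes>\<^bsub>PSL2Z\<^esub> (h \<otimes>\<^bsub>PSL2Z\<^esub> z) = z" if "z \<in> carrier PSL2Z" for z
      using hc that by (simp add: G.m_assoc[symmetric])
    thus ?thesis using that hc by (simp add: c_def G.m_assoc)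
  qed
  have am: "psl_act (a \<otimes>\<^bsub>PSL2Z\<^esub> b) y = psl_act a (psl_act b y)"
    if "a \<in> carrier PSL2Z" "b \<in> carrier PSL2Z" for a b y
    using A.composition_rule[of y a b] that by simp
  have inv: "psl_act (inv\<^bsub>PSL2Z\<^esub> h) (psl_act h y) = y" for y
    using A.orbit_sym_aux[of h y "psl_act h y"] hc by simp
  have fix1: "psl_act (c g) (psl_act h x) = psl_act h x \<longleftrightarrow> psl_act g x = x"
    if "g \<in> carrier PSL2Z" for g
  proof -
    have "psl_act (c g) (psl_act h x) = psl_act h (psl_act g x)"
      using that hc by (simp add: c_def am inv)
    thus ?thesis using inv by metis
  qed
  have cH: "c g \<in> H \<longleftrightarrow> g \<in> H" if "g \<in> carrier PSL2Z" for g
  proof -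
    have 1: "c g \<in> H" if "g \<in> H" for g
      unfolding c_def using H h that by (meson subgroup.m_closed subgroup.m_inv_closed)
    have 2: "c' g \<in> H" if "g \<in> H" for g
      unfolding c'_def using H h that by (meson subgroup.m_closed subgroup.m_inv_closed)
    show ?thesis using 1 2[of "c g"] cc(4)[OF that] by auto
  qed
  have im: "c ` stabilizer (PSL2Z\<lparr>carrier := K\<rparr>) psl_act x
      = stabilizer (PSL2Z\<lparr>carrier := K\<rparr>) psl_act (psl_act h x)"
    if K: "K \<subseteq> carrier PSL2Z" "\<And>g. g \<in> carrier PSL2Z \<Longrightarrow> c g \<in> K \<longleftrightarrow> g \<in> K" for K
  proof (intro equalityI subsetI)
    fix y assume "y \<in> stabilizer (PSL2Z\<lparr>carrier := K\<rparr>) psl_act (psl_act h x)"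
    hence y: "y \<in> K" "psl_act y (psl_act h x) = psl_act h x" by (auto simp: stabilizer_def)
    have yc: "y \<in> carrier PSL2Z" using y K by auto
    have "c' y \<in> K" using K(2)[OF cc(2)[OF yc]] cc(3)[OF yc] y(1) by simp
    moreover have "psl_act (c' y) x = x" using fix1[OF cc(2)[OF yc]] cc(3)[OF yc] y(2) by simp
    ultimately have "c' y \<in> stabilizer (PSL2Z\<lparr>carrier := K\<rparr>) psl_act x"
      by (simp add: stabilizer_def)
    thus "y \<in> c ` stabilizer (PSL2Z\<lparr>carrier := K\<rparr>) psl_act x"
      using cc(3)[OF yc] by (metis image_eqI)
  qed (use K fix1 in \<open>auto simp: stabilizer_def\<close>)
  let ?S = "stabilizer PSL2Z psl_act" and ?T = "stabilizer (PSL2Z\<lparr>carrier := H\<rparr>) psl_act"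
  have HC: "H \<subseteq> carrier PSL2Z" using H by (rule subgroup.subset)
  have S: "c ` ?S x = ?S (psl_act h x)" using im[of "carrier PSL2Z"] cc(1) by simp
  have T: "c ` ?T x = ?T (psl_act h x)" using im[OF HC cH] by simp
  have Ssub: "?S x \<subseteq> carrier PSL2Z" by (auto simp: stabilizer_def)
  have Tsub: "?T x \<subseteq> carrier PSL2Z" using HC by (auto simp: stabilizer_def)
  have coset: "c ` (?T x #>\<^bsub>PSL2Z\<^esub> a) = c ` ?T x #>\<^bsub>PSL2Z\<^esub> c a" if "a \<in> carrier PSL2Z" for a
  proof -
    have "c ` (?T x #>\<^bsub>PSL2Z\<^esub> a) = (\<Union>t\<in>?T x. {c (t \<otimes>\<^bsub>PSL2Z\<^esub> a)})"
      by (auto simp: r_coset_def)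
    also have "\<dots> = (\<Union>t\<in>?T x. {c t \<otimes>\<^bsub>PSL2Z\<^esub> c a})"
      using Tsub that by (intro SUP_cong refl) (auto simp: cm subset_iff)
    finally show ?thesis by (simp add: r_coset_def)
  qed
  have R: "rcosets\<^bsub>PSL2Z\<lparr>carrier := S\<rparr>\<^esub> K = (\<lambda>a. K #>\<^bsub>PSL2Z\<^esub> a) ` S" for S K
    by (auto simp: RCOSETS_def r_coset_def)
  have "(\<lambda>a. ?T (psl_act h x) #>\<^bsub>PSL2Z\<^esub> a) ` ?S (psl_act h x)
      = (`) c ` ((\<lambda>a. ?T x #>\<^bsub>PSL2Z\<^esub> a) ` ?S x)"
    unfolding S[symmetric] T[symmetric] image_image using Ssub coset
    by (intro image_cong refl) auto
  moreover have "inj_on ((`) c) ((\<lambda>a. ?T x #>\<^bsub>PSL2Z\<^esub> a) ` ?S x)"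
  proof -
    have "inj_on c (carrier PSL2Z)" using cc(4) by (rule inj_on_inverseI)
    hence "inj_on ((`) c) (Pow (carrier PSL2Z))" by (rule inj_on_image_Pow)
    moreover have "(\<lambda>a. ?T x #>\<^bsub>PSL2Z\<^esub> a) ` ?S x \<subseteq> Pow (carrier PSL2Z)"
      using Ssub Tsub by (auto simp: r_coset_def)
    ultimately show ?thesis by (rule inj_on_subset)
  qed
  ultimately show ?thesis
    unfolding point_width_def group_index_def R by (simp add: card_image)
qed

lemma cusp_width_eq:
  assumes H: "subgroup H PSL2Z" and "\<kappa> \<in> cusps H" "x \<in> \<kappa>"
  shows "cusp_width H \<kappa> = point_width H x"
proof -
  obtain z where z: "\<kappa> = {psl_act h z | h. h \<in> H}"
    using assms(2) by (auto simp: cusps_def orbits_def orbit_def)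
  have "(SOME y. y \<in> \<kappa>) \<in> \<kappa>" using assms(3) by (rule someI)
  thus ?thesis using z assms(3) point_width_orbit[OF H] by (auto simp: cusp_width_def)
qed

end

theory Submission
  imports Defs "HOL-Real_Asymp.Real_Asymp"
begin

text \<open>
  The regular continued fraction (\<open>\<alpha> = 1\<close>) is a convenient reference system: the Gauss map has
  full branches and an explicit invariant density, and so has its extension by the finite set of
  right cosets of \<open>H\<close>, on which the digits act. Bounded distortion, together with the fact that
  the digit matrices act transitively on the cosets, makes this extension ergodic.

  For arbitrary \<open>\<alpha>\<close>, a Legendre theorem says that \<open>P / Q\<close> is an \<open>\<alpha>\<close>-approximant of \<open>x\<close> as soon as
  \<open>Q \<bar>Q x - P\<bar> < \<alpha> / 4\<close>. Hence a regular approximant followed by a digit larger than \<open>4 / \<alpha>\<close> is also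
  an \<open>\<alpha>\<close>-approximant, and the later \<open>\<alpha>\<close>-approximants are determined by the remainder \<open>y\<close> of the
  regular expansion: they are the images of those of \<open>y\<close> under the regular matrix. So the
  \<open>\<alpha>\<close>-expansion splits into excursions between such synchronisation times, and the number of
  visits to a cusp during an excursion is a function on the extension of the Gauss map. It is
  integrable since the excursion length is bounded by a multiple of the return time. By Birkhoff's
  theorem the frequency of a cusp is a quotient of two integrals; summing first over the cosets
  shows that it is the proportion of cosets \<open>H \<gamma>\<close> for which \<open>\<gamma> 0\<close> lies in the cusp, which is the
  relative width.
\<close>

subsection \<open>Averages and the ergodic theorem\<close>

text \<open>The direct route would need an invariant density for \<open>T_alpha \<alpha>\<close>;
  for small \<open>\<alpha>\<close> no simple formula is at hand, and the branches are in general
  not full. So no invariant measure of \<open>T_alpha \<alpha>\<close> occurs below: everything is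
  integrated against the Gauss density. The price is that the two expansions do not run in step, and
  either may be ahead by an amount that depends on the orbit; this is why a random time change is
  needed. The relative width comes from a symmetry and not from a computation: for fixed
  \<open>y\<close> and \<open>i\<close>, right multiplication by the \<open>i\<close>-th matrix
  permutes the cosets, so that, summed over all cosets, every step of an excursion visits a cusp
  equally often. The mean excursion length then cancels; it only has to be positive and finite. The
  threshold \<open>4 / \<alpha>\<close> collects a factor 2 from bounding the exact denominator
  \<open>q_{n-1} t + q_n\<close> by \<open>2 q_n\<close>, another factor 2 from comparing
  \<open>q_{k+1}\<close> with \<open>Q\<close> in Legendre's argument, and \<open>\<alpha>\<close>
  from the distance of a remainder to \<open>-1\<close>.\<close>

lemma average_shift:
  fixes g :: "nat \<Rightarrow> real"
  shows "(\<lambda>n. (\<Sum>i<n. g (i + k)) / n) \<longlonglongrightarrow> r \<longleftrightarrow> (\<lambda>n. (\<Sum>i<n. g i) / n) \<longlonglongrightarrow> r"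
proof -
  define A where "A n = (\<Sum>i<n. g i)" for n
  have ev: "(\<Sum>i<n. g (i + k)) = A (n + k) - A k" for n
  proof -
    have "A (n + k) = (\<Sum>i<k. g i) + (\<Sum>i=k..<n+k. g i)"
      unfolding A_def using sum.atLeastLessThan_concat[of 0 k "n + k" g] by (simp add: atLeast0LessThan)
    also have "(\<Sum>i=k..<n+k. g i) = (\<Sum>i<n. g (i + k))"
      using sum.shift_bounds_nat_ivl[of g 0 k n] by (simp add: atLeast0LessThan)
    finally show ?thesis by (simp add: A_def)
  qed
  have c: "(\<lambda>n. real (n + k) / real n) \<longlonglongrightarrow> 1"
    by real_asymp
  have c': "(\<lambda>n. real n / real (n + k)) \<longlonglongrightarrow> 1"
    by real_asymp
  have d: "(\<lambda>n. A k / real n) \<longlonglongrightarrow> 0"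
    by real_asymp
  have "(\<lambda>n. (A (n + k) - A k) / n) \<longlonglongrightarrow> r \<longleftrightarrow> (\<lambda>n. A (n + k) / real (n + k)) \<longlonglongrightarrow> r"
  proof
    assume "(\<lambda>n. (A (n + k) - A k) / n) \<longlonglongrightarrow> r"
    from tendsto_mult[OF tendsto_add[OF this d] c']
    have "(\<lambda>n. A (n + k) / n * (n / real (n + k))) \<longlonglongrightarrow> r" by (simp add: diff_divide_distrib)
    thus "(\<lambda>n. A (n + k) / (n + k)) \<longlonglongrightarrow> r"
      by (rule Lim_transform_eventually)
         (use eventually_gt_at_top[of 0] in \<open>eventually_elim, simp\<close>)
  next
    assume "(\<lambda>n. A (n + k) / real (n + k)) \<longlonglongrightarrow> r"
    from tendsto_diff[OF tendsto_mult[OF this c] d]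
    have "(\<lambda>n. A (n + k) / real (n + k) * (real (n + k) / n) - A k / n) \<longlonglongrightarrow> r" by simp
    thus "(\<lambda>n. (A (n + k) - A k) / n) \<longlonglongrightarrow> r"
      by (rule Lim_transform_eventually)
         (use eventually_gt_at_top[of 0] in \<open>eventually_elim, simp add: diff_divide_distrib\<close>)
  qed
  also have "\<dots> \<longleftrightarrow> (\<lambda>n. A n / n) \<longlonglongrightarrow> r"
    using LIMSEQ_ignore_initial_segment[of "\<lambda>n. A n / n" r k] LIMSEQ_offset[of "\<lambda>n. A n / n" k r] by blast
  finally show ?thesis by (simp add: ev A_def)
qed

text \<open>Each large \<open>n\<close> lies between two consecutive values of \<open>L\<close>
  whose quotient tends to 1, and the partial sums of a nonnegative \<open>g\<close> are monotone, so
  the averages are squeezed.\<close>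

lemma average_time_change:
  fixes g :: "nat \<Rightarrow> real" and L :: "nat \<Rightarrow> nat"
  assumes g: "\<And>i. 0 \<le> g i" and "mono L" and I: "I > 0"
    and L: "(\<lambda>m. L m / m) \<longlonglongrightarrow> I"
    and C: "(\<lambda>m. (\<Sum>i<L m. g i) / m) \<longlonglongrightarrow> J"
  shows "(\<lambda>n. (\<Sum>i<n. g i) / n) \<longlonglongrightarrow> J / I"
proof -
  define A where "A n = (\<Sum>i<n. g i)" for n
  have A_mono: "A a \<le> A b" if "a \<le> b" for a b
    unfolding A_def using that g by (intro sum_mono2) auto
  have A_nonneg: "0 \<le> A n" for n unfolding A_def by (intro sum_nonneg g)
  have Linf: "filterlim L at_top sequentially"
  proof -
    have "filterlim (\<lambda>m. L m / m * real m) at_top sequentially"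
      by (rule filterlim_tendsto_pos_mult_at_top[OF L I filterlim_real_sequentially])
    moreover have "eventually (\<lambda>m. L m / m * real m = real (L m)) sequentially"
      using eventually_gt_at_top[of 0] by eventually_elim simp
    ultimately have "filterlim (\<lambda>m. real (L m)) at_top sequentially"
      using filterlim_cong[OF refl refl] by fast
    thus ?thesis by (simp add: filterlim_sequentially_iff_filterlim_real)
  qed
  \<comment> \<open>For \<open>n \<ge> L 0\<close> this is the index of the block from
    \<open>L (s n)\<close> to \<open>L (Suc (s n))\<close> that contains \<open>n\<close>.\<close>
  define s where "s n = (LEAST m. n < L (Suc m))" for n
  have ex: "\<exists>m. n < L (Suc m)" for n
  proof -
    have "eventually (\<lambda>m. Suc n \<le> L m) sequentially"
      using Linf unfolding filterlim_at_top by blast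
    then obtain N where "\<And>m. m \<ge> N \<Longrightarrow> Suc n \<le> L m" unfolding eventually_sequentially by blast
    from this[of "Suc N"] show ?thesis by (auto simp: Suc_le_eq)
  qed
  have s1: "n < L (Suc (s n))" for n unfolding s_def using LeastI_ex[OF ex] .
  have s2: "L (s n) \<le> n" if "n \<ge> L 0" for n
  proof (cases "s n")
    case (Suc k)
    hence "\<not> n < L (Suc k)" unfolding s_def by (metis lessI not_less_Least)
    thus ?thesis using Suc by simp
  qed (use that in simp)
  have smono: "s n \<ge> m" if "n \<ge> L m" for n m
  proof (rule ccontr)
    assume "\<not> ?thesis"
    hence "Suc (s n) \<le> m" by simp
    hence "L (Suc (s n)) \<le> L m" using \<open>mono L\<close> by (auto dest: monoD)
    thus False using s1[of n] that by simp
  qed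
  have sinf: "filterlim s at_top sequentially"
    unfolding filterlim_at_top
  proof
    fix Z :: nat
    show "eventually (\<lambda>x. Z \<le> s x) sequentially"
      using eventually_ge_at_top[of "L Z"] by eventually_elim (rule smono)
  qed
  have r: "(\<lambda>m. real (Suc m) / m) \<longlonglongrightarrow> 1" by real_asymp
  have suc: "(\<lambda>m. h (Suc m) / real m) \<longlonglongrightarrow> l" if h: "(\<lambda>m. h m / real m) \<longlonglongrightarrow> l"
    for h :: "nat \<Rightarrow> real" and l
  proof -
    have "(\<lambda>m. h (Suc m) / real (Suc m) * (real (Suc m) / m)) \<longlonglongrightarrow> l * 1"
      by (rule tendsto_mult[OF LIMSEQ_Suc[OF h] r])
    moreover have "h (Suc m) / real (Suc m) * (real (Suc m) / m) = h (Suc m) / m" for m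
      using of_nat_neq_0[of m] by (simp del: of_nat_Suc)
    ultimately show ?thesis by simp
  qed
  have L1: "(\<lambda>m. L (Suc m) / m) \<longlonglongrightarrow> I" by (rule suc[OF L])
  have C1: "(\<lambda>m. A (L (Suc m)) / m) \<longlonglongrightarrow> J" using suc[OF C] by (simp add: A_def)
  have lo: "(\<lambda>m. (A (L m) / m) / (L (Suc m) / m)) \<longlonglongrightarrow> J / I"
    using C I by (intro tendsto_divide L1) (auto simp: A_def)
  have hi: "(\<lambda>m. (A (L (Suc m)) / m) / (L m / m)) \<longlonglongrightarrow> J / I"
    using I by (intro tendsto_divide C1 L) auto
  have ev1: "eventually (\<lambda>n. s n > 0 \<and> n \<ge> L 0 \<and> L (s n) > 0) sequentially"
  proof -
    have "eventually (\<lambda>m. m > 0 \<and> L m \<ge> 1) sequentially"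
      using Linf eventually_gt_at_top[of 0] unfolding filterlim_at_top by (simp add: eventually_conj)
    hence "eventually (\<lambda>n. s n > 0 \<and> L (s n) \<ge> 1) sequentially"
      using sinf by (rule eventually_compose_filterlim)
    thus ?thesis using eventually_ge_at_top[of "L 0"] by eventually_elim auto
  qed
  show ?thesis
    unfolding A_def[symmetric]
  proof (rule tendsto_sandwich)
    show "(\<lambda>n. (A (L (s n)) / s n) / (L (Suc (s n)) / s n)) \<longlonglongrightarrow> J / I"
      by (rule filterlim_compose[OF lo sinf])
    show "(\<lambda>n. (A (L (Suc (s n))) / s n) / (L (s n) / s n)) \<longlonglongrightarrow> J / I"
      by (rule filterlim_compose[OF hi sinf])
    show "\<forall>\<^sub>F n in sequentially. A (L (s n)) / s n / (L (Suc (s n)) / s n) \<le> A n / n"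
      using ev1
    proof eventually_elim
      case (elim n)
      have "A (L (s n)) / L (Suc (s n)) \<le> A n / n"
        using elim s1[of n] s2[of n] A_nonneg by (intro frac_le A_mono) auto
      thus ?case using elim by simp
    qed
    show "\<forall>\<^sub>F n in sequentially. A n / n \<le> A (L (Suc (s n))) / s n / (L (s n) / s n)"
      using ev1
    proof eventually_elim
      case (elim n)
      have "A n / n \<le> A (L (Suc (s n))) / L (s n)"
        using elim s1[of n] s2[of n] A_nonneg by (intro frac_le A_mono) auto
      thus ?case using elim by simp
    qed
  qed
qed

section \<open>Maximal partial sums and Birkhoff's theorem\<close>

text \<open>The maximum of 0 and the partial sums of length at most \<open>n\<close> along the
  orbit. Peeling off the first step rather than the last relates \<open>x\<close> to
  \<open>T x\<close>, which is what Garsia's argument compares.\<close>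

primrec max_sum :: "('a \<Rightarrow> 'a) \<Rightarrow> ('a \<Rightarrow> real) \<Rightarrow> nat \<Rightarrow> 'a \<Rightarrow> real" where
  "max_sum T f 0 x = 0"
| "max_sum T f (Suc n) x = max 0 (f x + max_sum T f n (T x))"

lemma max_sum_nonneg: "0 \<le> max_sum T f n x"
  by (cases n) auto

lemma max_sum_mono: "n \<le> m \<Longrightarrow> max_sum T f n x \<le> max_sum T f m x"
proof (induction m arbitrary: n x)
  case (Suc m)
  show ?case
  proof (cases n)
    case (Suc k)
    thus ?thesis using Suc.IH[of k "T x"] Suc.prems by simp
  qed simp
qed simp

lemma sum_le_max_sum: "(\<Sum>i<n. f ((T ^^ i) x)) \<le> max_sum T f n x"
proof (induction n arbitrary: x)
  case (Suc n)
  have "(\<Sum>i<Suc n. f ((T ^^ i) x)) = f x + (\<Sum>i<n. f ((T ^^ i) (T x)))"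
    by (simp add: sum.lessThan_Suc_shift funpow_swap1 del: sum.lessThan_Suc)
  also have "\<dots> \<le> f x + max_sum T f n (T x)" using Suc by simp
  finally show ?case by simp
qed simp

text \<open>Unboundedness is a property of the whole orbit; this makes the exceptional set in
  \<open>sums_bounded_above\<close> strictly invariant, as \<open>T_ergodic\<close> demands.\<close>

lemma max_sum_bdd_above_iff:
  "(\<exists>B. \<forall>n. max_sum T f n (T x) \<le> B) \<longleftrightarrow> (\<exists>B. \<forall>n. max_sum T f n x \<le> B)"
proof
  assume "\<exists>B. \<forall>n. max_sum T f n (T x) \<le> B"
  then obtain B where B: "\<And>n. max_sum T f n (T x) \<le> B" by auto
  have "max_sum T f n x \<le> max 0 (f x + B)" for n
    using B[of "n - 1"] by (cases n) (auto simp: max_def)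
  thus "\<exists>B. \<forall>n. max_sum T f n x \<le> B" by blast
next
  assume "\<exists>B. \<forall>n. max_sum T f n x \<le> B"
  then obtain B where B: "\<And>n. max_sum T f n x \<le> B" by auto
  have "max_sum T f n (T x) \<le> B - f x" for n
    using B[of "Suc n"] by simp
  thus "\<exists>B. \<forall>n. max_sum T f n (T x) \<le> B" by blast
qed

text \<open>The measure is finite but not normalised, because the intended one is a counting measure
  times the density \<open>1 / (1 + x)\<close>; means are therefore divided by the total
  mass.\<close>

locale ergodic_map = finite_measure M for M :: "'a measure" +
  fixes T :: "'a \<Rightarrow> 'a"
  assumes T_measurable: "T \<in> measurable M M"
    and T_invariant: "distr M M T = M"
    and T_ergodic: "\<And>A. A \<in> sets M \<Longrightarrow> T -` A \<inter> space M = A \<Longrightarrow>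
      A \<in> null_sets M \<or> space M - A \<in> null_sets M"
begin

lemma integrable_comp: "integrable M f \<Longrightarrow> integrable M (\<lambda>x. f (T x) :: real)"
  using integrable_distr[OF T_measurable, of f] by (simp add: T_invariant)

lemma integral_comp:
  assumes "f \<in> borel_measurable M"
  shows "integral\<^sup>L M (\<lambda>x. f (T x) :: real) = integral\<^sup>L M f"
  using integral_distr[OF T_measurable assms] by (simp add: T_invariant)

lemma integrable_max_sum: "integrable M f \<Longrightarrow> integrable M (\<lambda>x. max_sum T f n x)"
proof (induction n)
  case (Suc n)
  have "integrable M (\<lambda>x. max 0 (f x + max_sum T f n (T x)))"
    using integrable_comp[OF Suc.IH[OF Suc.prems]] Suc.prems
    by (intro Bochner_Integration.integrable_max Bochner_Integration.integrable_add) auto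
  thus ?case by simp
next
  case 0
  have "max_sum T f 0 = (\<lambda>x. 0)" by (simp add: fun_eq_iff)
  thus ?case by simp
qed

text \<open>
  Garsia's argument: were the partial sums unbounded almost everywhere, the differences
  \<open>max_sum (n + 1) - max_sum n \<circ> T\<close>, whose integrals are nonnegative, would converge to \<open>f\<close>.
\<close>

lemma sums_bounded_above:
  fixes f :: "'a \<Rightarrow> real"
  assumes f: "integrable M f" and neg: "integral\<^sup>L M f < 0"
  shows "AE x in M. \<exists>B. \<forall>n. (\<Sum>i<n. f ((T ^^ i) x)) \<le> B"
proof -
  note [measurable] = T_measurable
  have [measurable]: "f \<in> borel_measurable M" using f by simp
  have [measurable]: "max_sum T f n \<in> borel_measurable M" for n
    using integrable_max_sum[OF f] by simp
  define A where "A = {x\<in>space M. \<forall>k::nat. \<exists>n. max_sum T f n x > real k}"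
  have A_iff: "x \<in> A \<longleftrightarrow> x \<in> space M \<and> \<not> (\<exists>B. \<forall>n. max_sum T f n x \<le> B)" for x
  proof -
    have "(\<exists>B. \<forall>n. max_sum T f n x \<le> B) \<longleftrightarrow> (\<exists>k::nat. \<forall>n. max_sum T f n x \<le> real k)"
      by (meson order_trans real_arch_simple)
    thus ?thesis by (auto simp: A_def not_le)
  qed
  have Am: "A \<in> sets M" unfolding A_def by measurable
  have "T -` A \<inter> space M = A"
    using measurable_space[OF T_measurable] by (auto simp: A_iff max_sum_bdd_above_iff)
  from T_ergodic[OF Am this] show ?thesis
  proof
    assume "A \<in> null_sets M"
    hence "AE x in M. x \<notin> A" by (rule AE_not_in)
    thus ?thesis
      using AE_space
    proof eventually_elim
      case (elim x)
      then obtain B where "\<And>n. max_sum T f n x \<le> B" by (auto simp: A_iff)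
      thus ?case using sum_le_max_sum[of f T x] order_trans by blast
    qed
  next
    assume "space M - A \<in> null_sets M"
    hence ae: "AE x in M. x \<in> A" using AE_not_in AE_space by fastforce
    let ?s = "\<lambda>n x. max_sum T f (Suc n) x - max_sum T f n (T x)"
    have lim: "(\<lambda>n. integral\<^sup>L M (?s n)) \<longlonglongrightarrow> integral\<^sup>L M f"
    proof (rule integral_dominated_convergence[where w = "\<lambda>x. \<bar>f x\<bar>"])
      show "AE x in M. (\<lambda>n. ?s n x) \<longlonglongrightarrow> f x"
        using ae
      proof eventually_elim
        case (elim x)
        hence "\<not> (\<exists>B. \<forall>n. max_sum T f n (T x) \<le> B)" by (simp add: A_iff max_sum_bdd_above_iff)
        then obtain n0 where "max_sum T f n0 (T x) > - f x" by (meson not_le)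
        hence "max_sum T f n (T x) > - f x" if "n \<ge> n0" for n
          using max_sum_mono[OF that, of T f "T x"] by linarith
        \<comment> \<open>Once \<open>max_sum T f n (T x) > - f x\<close>, the maximum with 0 in the
          recursion is its second argument, so the difference equals \<open>f x\<close>
          exactly.\<close>
        hence "eventually (\<lambda>n. ?s n x = f x) sequentially"
          unfolding eventually_sequentially by (intro exI[of _ n0]) (auto simp: max_def, smt)
        thus ?case by (rule tendsto_eventually)
      qed
      show "AE x in M. norm (?s n x) \<le> \<bar>f x\<bar>" for n

      proof (intro AE_I2)
        fix x
        show "norm (?s n x) \<le> \<bar>f x\<bar>" using max_sum_nonneg[of T f n "T x"] by auto
      qed
    qed (use f in auto)
    have "integral\<^sup>L M (?s n) \<ge> 0" for n
    proof -
      have "integral\<^sup>L M (?s n) = integral\<^sup>L M (max_sum T f (Suc n)) - integral\<^sup>L M (\<lambda>x. max_sum T f n (T x))"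
        by (intro Bochner_Integration.integral_diff integrable_max_sum integrable_comp f)
      also have "integral\<^sup>L M (\<lambda>x. max_sum T f n (T x)) = integral\<^sup>L M (max_sum T f n)"
        by (rule integral_comp) simp
      finally show ?thesis
        using integral_mono[OF integrable_max_sum[OF f] integrable_max_sum[OF f] max_sum_mono, of n "Suc n"]
        by linarith
    qed
    hence "integral\<^sup>L M f \<ge> 0" using lim LIMSEQ_le_const by blast
    thus ?thesis using neg by simp
  qed
qed

text \<open>Apply \<open>sums_bounded_above\<close> to \<open>f - d\<close> with \<open>d\<close>
  strictly between the mean and \<open>c\<close>: the partial sums of \<open>f\<close> then stay
  below \<open>B + n d\<close>.\<close>

lemma limsup_average:
  fixes f :: "'a \<Rightarrow> real"
  assumes f: "integrable M f" and c: "integral\<^sup>L M f < c * measure M (space M)"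
  shows "AE x in M. eventually (\<lambda>n. (\<Sum>i<n. f ((T ^^ i) x)) / n < c) sequentially"
proof -
  have pos: "measure M (space M) > 0"
  proof (rule ccontr)
    assume "\<not> ?thesis"
    hence 0: "measure M (space M) = 0" using measure_nonneg[of M "space M"] by linarith
    hence "space M \<in> null_sets M" by (simp add: null_setsI emeasure_eq_measure)
    hence "AE x in M. f x = 0" using AE_not_in[of "space M" M] AE_space by fastforce
    hence "integral\<^sup>L M f = 0" by (rule integral_eq_zero_AE)
    thus False using c 0 by simp
  qed
  define d where "d = (integral\<^sup>L M f / measure M (space M) + c) / 2"
  have d: "integral\<^sup>L M f < d * measure M (space M)" "d < c"
    using c pos by (simp_all add: d_def field_simps)
  have "integral\<^sup>L M (\<lambda>x. f x - d) = integral\<^sup>L M f - d * measure M (space M)"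
    using f by (subst Bochner_Integration.integral_diff) auto
  hence "AE x in M. \<exists>B. \<forall>n. (\<Sum>i<n. f ((T ^^ i) x) - d) \<le> B"
    using d f by (intro sums_bounded_above) (auto simp: mult.commute)
  thus ?thesis
  proof eventually_elim
    case (elim x)
    then obtain B where "\<And>n. (\<Sum>i<n. f ((T ^^ i) x)) - n * d \<le> B"
      by (auto simp: sum_subtractf)
    hence B: "(\<Sum>i<n. f ((T ^^ i) x)) \<le> B + n * d" for n by (simp add: diff_le_eq)
    have "(\<lambda>n. B / real n + d) \<longlonglongrightarrow> 0 + d"
      by (intro tendsto_add tendsto_const) real_asymp
    hence "eventually (\<lambda>n. B / real n + d < c) sequentially"
      using d by (intro order_tendstoD) auto
    thus ?case
      using eventually_gt_at_top[of 0]
    proof eventually_elim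
      case (elim n)
      have "(\<Sum>i<n. f ((T ^^ i) x)) / n \<le> (B + n * d) / n"
        using B by (intro divide_right_mono) auto
      also have "\<dots> = B / real n + d" using elim by (simp add: add_divide_distrib)
      finally show ?case using elim by simp
    qed
  qed
qed

lemma emeasure_vimage:
  assumes "E \<in> sets M"
  shows "emeasure M ((T ^^ k) -` E \<inter> space M) = emeasure M E"
proof (induction k)
  case (Suc k)
  have m: "(T ^^ k) -` E \<inter> space M \<in> sets M"
    using assms measurable_compose_n[OF T_measurable, of k] measurable_sets by blast
  have "(T ^^ Suc k) -` E \<inter> space M = T -` ((T ^^ k) -` E \<inter> space M) \<inter> space M"
    using measurable_space[OF T_measurable] by (auto simp: funpow_swap1)
  also have "emeasure M \<dots> = emeasure (distr M M T) ((T ^^ k) -` E \<inter> space M)"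
    by (rule emeasure_distr[symmetric, OF T_measurable m])
  finally show ?case by (simp only: T_invariant Suc.IH)
qed (use assms in \<open>simp add: sets.Int_space_eq2\<close>)

text \<open>Kac: a point is counted according to the time elapsed since its last visit to \<open>A\<close>.\<close>

lemma return_time_bound:
  assumes A: "A \<in> sets M"
  shows "(\<Sum>m. emeasure M {x\<in>A. \<forall>j\<in>{1..m}. (T ^^ j) x \<notin> A}) \<le> emeasure M (space M)"
proof -
  define E where "E m = {x\<in>A. \<forall>j\<in>{1..m}. (T ^^ j) x \<notin> A}" for m :: nat
  have Tn [measurable]: "(T ^^ j) \<in> measurable M M" for j
    by (rule measurable_compose_n[OF T_measurable])
  have As: "A \<subseteq> space M" using A by (rule sets.sets_into_space)
  have Em: "E m \<in> sets M" for m
  proof -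
    have "E m = {x\<in>space M. x \<in> A \<and> (\<forall>j\<in>{1..m}. (T ^^ j) x \<notin> A)}" using As by (auto simp: E_def)
    also have "\<dots> \<in> sets M" using A by measurable
    finally show ?thesis .
  qed
  have "(\<Sum>m<N. emeasure M (E m)) \<le> emeasure M (space M)" for N
  proof -
    define D where "D m = (T ^^ (N - m)) -` E m \<inter> space M" for m
    have Dm: "D m \<in> sets M" for m unfolding D_def using Tn Em by (rule measurable_sets)
    have disj: "disjoint_family_on D {..<N}"
      unfolding disjoint_family_on_def
    proof (intro ballI impI)
      have *: "D m \<inter> D n = {}" if "m < n" "n < N" for m n
      proof (rule equals0I)
        fix x assume x: "x \<in> D m \<inter> D n"
        hence "(T ^^ (n - m)) ((T ^^ (N - n)) x) \<notin> A" using that by (auto simp: D_def E_def)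
        moreover have "(T ^^ (n - m)) ((T ^^ (N - n)) x) = (T ^^ (N - m)) x"
          using that by (simp flip: funpow_add comp_apply[of "T ^^ (n - m)"])
        ultimately show False using x by (auto simp: D_def E_def)
      qed
      fix m n assume "m \<in> {..<N}" "n \<in> {..<N}" "m \<noteq> n"
      thus "D m \<inter> D n = {}" using *[of m n] *[of n m] by (cases "m < n") auto
    qed
    have "(\<Sum>m<N. emeasure M (E m)) = (\<Sum>m<N. emeasure M (D m))"
      unfolding D_def using Em by (simp add: emeasure_vimage)
    also have "\<dots> = emeasure M (\<Union>m<N. D m)"
      using disj Dm by (intro sum_emeasure) auto
    also have "\<dots> \<le> emeasure M (space M)" by (rule emeasure_space)
    finally show ?thesis .
  qed
  thus ?thesis unfolding E_def[symmetric] suminf_eq_SUP by (intro SUP_least)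
qed

theorem birkhoff:
  fixes f :: "'a \<Rightarrow> real"
  assumes f: "integrable M f" and pos: "measure M (space M) > 0"
  shows "AE x in M. (\<lambda>n. (\<Sum>i<n. f ((T ^^ i) x)) / n) \<longlonglongrightarrow> integral\<^sup>L M f / measure M (space M)"
proof -
  let ?I = "integral\<^sup>L M f / measure M (space M)" and ?A = "\<lambda>x n. (\<Sum>i<n. f ((T ^^ i) x)) / real n"
  have up: "AE x in M. \<forall>k. eventually (\<lambda>n. ?A x n < ?I + 1 / Suc k) sequentially"
    unfolding AE_all_countable using pos f
    by (intro allI limsup_average) (auto simp: distrib_right)
  have lo: "AE x in M. \<forall>k. eventually (\<lambda>n. (\<Sum>i<n. - f ((T ^^ i) x)) / n < - ?I + 1 / Suc k) sequentially"
    unfolding AE_all_countable using pos f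
    by (intro allI limsup_average[where f = "\<lambda>x. - f x"]) (auto simp: left_diff_distrib)
  show ?thesis
    using up lo
  proof eventually_elim
    case (elim x)
    show ?case
    proof (rule LIMSEQ_I)
      fix r :: real assume "r > 0"
      then obtain k where k: "1 / Suc k < r" using nat_approx_posE by blast
      have "eventually (\<lambda>n. norm (?A x n - ?I) < r) sequentially"
        using elim(1)[rule_format, of k] elim(2)[rule_format, of k]
      proof eventually_elim
        case (elim n)
        thus ?case using k by (simp add: sum_negf abs_less_iff)
      qed
      thus "\<exists>no. \<forall>n\<ge>no. norm (?A x n - ?I) < r" by (simp add: eventually_sequentially)
    qed
  qed
qed

end

subsection \<open>Cylinders of the regular continued fraction\<close>

lemma nn_integral_inverse_branch:
  fixes f :: "real \<Rightarrow> ennreal" and a :: real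
  assumes [measurable]: "f \<in> borel_measurable borel" and a: "a \<ge> 1"
  shows "(\<integral>\<^sup>+x. f x * indicator {1 / (a + 1)..1 / a} x \<partial>lborel) =
    (\<integral>\<^sup>+t. f (1 / (a + t)) * ennreal (1 / (a + t)\<^sup>2) * indicator {0..1} t \<partial>lborel)"
proof -
  have "(\<integral>\<^sup>+x. f x * indicator {1 / (a + 1)..1 / a} x \<partial>lborel) =
      (\<integral>\<^sup>+x. f (- x) * indicator {1 / (a + 1)..1 / a} (- x) \<partial>lborel)"
    by (subst nn_integral_real_affine[where c = "-1" and t = 0]) auto
  also have "\<dots> = (\<integral>\<^sup>+x. f (- x) * indicator {- 1 / (a + 0)..- 1 / (a + 1)} x \<partial>lborel)"
    by (intro nn_integral_cong) (auto simp: indicator_def)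
  also have "\<dots> = (\<integral>\<^sup>+t. f (- (- 1 / (a + t))) * ennreal (1 / (a + t)\<^sup>2) * indicator {0..1} t \<partial>lborel)"
  \<comment> \<open>The substitution rule asks for an increasing map. This is the reason for the
    reflection: \<open>- 1 / (a + t)\<close> increases where \<open>1 / (a + t)\<close>
    decreases.\<close>
  proof (rule nn_integral_substitution_aux[where g = "\<lambda>t. - 1 / (a + t)"])
    show "((\<lambda>t. - 1 / (a + t)) has_real_derivative 1 / (a + x)\<^sup>2) (at x)" if "x \<in> {0..1}" for x
      using a that by (auto intro!: derivative_eq_intros simp: power2_eq_square)
    show "continuous_on {0..1} (\<lambda>t. 1 / (a + t)\<^sup>2)"
      using a by (intro continuous_intros) auto
  qed auto
  finally show ?thesis by simp
qed

lemma open_closed_interval_AE: "AE x in lborel. (indicator {a<..<b} x :: ennreal) = indicator {a..b::real} x"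
  using AE_lborel_singleton[of a] AE_lborel_singleton[of b]
  by eventually_elim (auto simp: indicator_def)

lemma open_half_interval_AE: "AE x in lborel. (indicator {a<..b} x :: ennreal) = indicator {a..b::real} x"
  using AE_lborel_singleton[of a] by eventually_elim (auto simp: indicator_def)

text \<open>The transfer operator of the Gauss map in integrated form. The sets \<open>?B n\<close>
  on which the first digit is \<open>n + 1\<close> partition the half-open unit interval; the rest
  is care with endpoints, which form null sets.\<close>

lemma nn_integral_gauss_branches:
  fixes f :: "real \<Rightarrow> ennreal"
  assumes [measurable]: "f \<in> borel_measurable borel"
  shows "(\<integral>\<^sup>+x. f x * indicator {0<..<1} x \<partial>lborel) =
    (\<Sum>n. \<integral>\<^sup>+t. f (1 / (real (Suc n) + t)) * ennreal (1 / (real (Suc n) + t)\<^sup>2) * indicator {0<..<1} t \<partial>lborel)"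
proof -
  let ?B = "\<lambda>n. {1 / (real (Suc n) + 1)<..1 / real (Suc n)}"
  have nf: "x \<in> ?B n \<longleftrightarrow> x > 0 \<and> \<lfloor>1 / x\<rfloor> = int n + 1" for x n
  proof
    assume "x > 0 \<and> \<lfloor>1 / x\<rfloor> = int n + 1"
    hence x: "x > 0" "real n + 1 \<le> 1 / x" "1 / x < real n + 2" by (auto simp: floor_eq_iff)
    hence "x * (real n + 1) \<le> 1" "1 < x * (real n + 2)"
      by (simp_all add: pos_le_divide_eq pos_divide_less_eq mult.commute)
    hence "x \<le> 1 / (real n + 1)" "1 / (real n + 2) < x"
      by (simp_all add: pos_le_divide_eq pos_divide_less_eq)
    thus "x \<in> ?B n" by (simp add: add.commute)
  next
    assume x: "x \<in> ?B n"
    have "0 < 1 / (real (Suc n) + 1)" by simp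
    with x have x0: "x > 0" by (simp only: greaterThanAtMost_iff) linarith
    have "x \<le> 1 / (real n + 1)" "1 / (real n + 2) < x"
      using x by (simp_all add: add.commute)
    hence "x * (real n + 1) \<le> 1" "1 < x * (real n + 2)"
      by (simp_all add: pos_le_divide_eq pos_divide_less_eq)
    hence "real n + 1 \<le> 1 / x" "1 / x < real n + 2" using x0 by (simp_all add: field_simps)
    thus "x > 0 \<and> \<lfloor>1 / x\<rfloor> = int n + 1" using x0 by (auto simp: floor_eq_iff)
  qed
  have disj: "disjoint_family ?B"
    unfolding disjoint_family_on_def
  proof (intro ballI impI)
    fix m n :: nat assume "m \<noteq> n"
    show "?B m \<inter> ?B n = {}"
    proof (rule equals0I)
      fix x assume "x \<in> ?B m \<inter> ?B n"
      hence "\<lfloor>1 / x\<rfloor> = int m + 1" "\<lfloor>1 / x\<rfloor> = int n + 1" using nf by blast+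
      thus False using \<open>m \<noteq> n\<close> by linarith
    qed
  qed
  have un: "(\<Union>n. ?B n) = {0<..1}"
  proof (intro equalityI subsetI)
    fix x assume "x \<in> (\<Union>n. ?B n)"
    then obtain n where "x \<in> ?B n" by auto
    hence "x > 0" "x \<le> 1 / real (Suc n)" using nf[of x n] by (blast, simp)
    moreover have "1 / real (Suc n) \<le> 1" by simp
    ultimately have "0 < x" "x \<le> 1" by linarith+
    thus "x \<in> {0<..1}" by simp
  next
    fix x :: real assume x: "x \<in> {0<..1}"
    hence "\<lfloor>1 / x\<rfloor> \<ge> 1" by (simp add: le_floor_iff)
    hence "\<lfloor>1 / x\<rfloor> = int (nat (\<lfloor>1 / x\<rfloor> - 1)) + 1" by simp
    hence "x \<in> ?B (nat (\<lfloor>1 / x\<rfloor> - 1))" using x nf by (metis greaterThanAtMost_iff)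
    thus "x \<in> (\<Union>n. ?B n)" by blast
  qed
  have "(\<integral>\<^sup>+x. f x * indicator {0<..<1} x \<partial>lborel) = (\<integral>\<^sup>+x. f x * indicator {0<..1} x \<partial>lborel)"
    using open_closed_interval_AE[of 0 1] open_half_interval_AE[of 0 1]
    by (intro nn_integral_cong_AE, eventually_elim) simp
  also have "\<dots> = (\<integral>\<^sup>+x. (\<Sum>n. f x * indicator (?B n) x) \<partial>lborel)"
    by (simp only: ennreal_suminf_cmult suminf_indicator[OF disj] un)
  also have "\<dots> = (\<Sum>n. \<integral>\<^sup>+x. f x * indicator (?B n) x \<partial>lborel)"
    by (intro nn_integral_suminf) simp
  also have "\<dots> = (\<Sum>n. \<integral>\<^sup>+t. f (1 / (real (Suc n) + t)) * ennreal (1 / (real (Suc n) + t)\<^sup>2) * indicator {0<..<1} t \<partial>lborel)"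
  proof (rule suminf_cong)
    fix n
    have "(\<integral>\<^sup>+x. f x * indicator (?B n) x \<partial>lborel) = (\<integral>\<^sup>+x. f x * indicator {1 / (real (Suc n) + 1)..1 / real (Suc n)} x \<partial>lborel)"
    proof (rule nn_integral_cong_AE)
      show "AE x in lborel. f x * indicator (?B n) x = f x * indicator {1 / (real (Suc n) + 1)..1 / real (Suc n)} x"
        using open_half_interval_AE[of "1 / (real (Suc n) + 1)" "1 / real (Suc n)"]
        by eventually_elim (rule arg_cong)
    qed
    also have "\<dots> = (\<integral>\<^sup>+t. f (1 / (real (Suc n) + t)) * ennreal (1 / (real (Suc n) + t)\<^sup>2) * indicator {0..1} t \<partial>lborel)"
      by (rule nn_integral_inverse_branch) auto
    also have "\<dots> = (\<integral>\<^sup>+t. f (1 / (real (Suc n) + t)) * ennreal (1 / (real (Suc n) + t)\<^sup>2) * indicator {0<..<1} t \<partial>lborel)"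
    proof (rule nn_integral_cong_AE)
      show "AE t in lborel. f (1 / (real (Suc n) + t)) * ennreal (1 / (real (Suc n) + t)\<^sup>2) * indicator {0..1} t =
          f (1 / (real (Suc n) + t)) * ennreal (1 / (real (Suc n) + t)\<^sup>2) * indicator {0<..<1} t"
        using open_closed_interval_AE[of 0 1]
        by eventually_elim (rule arg_cong, rule sym)
    qed
    finally show "(\<integral>\<^sup>+x. f x * indicator (?B n) x \<partial>lborel) = \<dots>" .
  qed
  finally show ?thesis .
qed

lemma gauss_branch:
  assumes "0 < t" "t < 1" "a \<ge> 1"
  shows "d_alpha 1 (1 / (of_int a + t)) = a" "T_alpha 1 (1 / (of_int a + t)) = t"
proof -
  have a: "1 \<le> real_of_int a" using assms by simp
  have e: "\<bar>1 / (1 / (of_int a + t))\<bar> = of_int a + t" using assms a by simp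
  have f: "\<lfloor>of_int a + t\<rfloor> = a" using assms by (simp add: floor_eq_iff)
  have n: "1 / (of_int a + t) \<noteq> 0" using assms a by simp
  show "d_alpha 1 (1 / (of_int a + t)) = a" unfolding d_alpha_def e using f by simp
  show "T_alpha 1 (1 / (of_int a + t)) = t" unfolding T_alpha_def e using f n by simp
qed

section \<open>Cylinders of digit words and their inverse branches\<close>

primrec cyl :: "int list \<Rightarrow> real set" where
  "cyl [] = {0<..<1}"
| "cyl (a # w) = {x. 0 < x \<and> 1 / x - of_int a \<in> cyl w}"

text \<open>For positive digits, the inverse branch of the iterated Gauss map that belongs to the
  word \<open>w\<close>; it parametrises \<open>cyl w\<close> by the remainder
  \<open>t\<close>.\<close>

primrec cf_eval :: "int list \<Rightarrow> real \<Rightarrow> real" where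
  "cf_eval [] t = t"
| "cf_eval (a # w) t = 1 / (of_int a + cf_eval w t)"

lemma cyl_measurable [measurable]: "cyl w \<in> sets borel"
proof (induction w)
  case (Cons a w)
  note [measurable] = Cons.IH
  show ?case by simp
qed simp

lemma cyl_subset: "\<forall>a\<in>set w. a \<ge> 1 \<Longrightarrow> cyl w \<subseteq> {0<..<1}"
proof (cases w)
  case (Cons a v)
  assume w: "\<forall>a\<in>set w. a \<ge> 1"
  have sub: "cyl v \<subseteq> {0<..}" by (cases v) auto
  show ?thesis
  proof
    fix x assume "x \<in> cyl w"
    hence x: "0 < x" "1 / x - of_int a > 0" using Cons sub by auto
    have "1 < 1 / x" using x w Cons by (smt (verit) list.set_intros(1) of_int_1_le_iff)
    thus "x \<in> {0<..<1}" using x by simp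
  qed
qed simp

lemma cyl_disjoint:
  assumes "length v = length w" "\<forall>a\<in>set v. a \<ge> 1" "\<forall>a\<in>set w. a \<ge> 1" "x \<in> cyl v" "x \<in> cyl w"
  shows "v = w"
  using assms
proof (induction v w arbitrary: x rule: list_induct2)
  case (Cons a v b w)
  have "1 / x - of_int a \<in> {0<..<1}" "1 / x - of_int b \<in> {0<..<1}"
    using Cons.prems cyl_subset[of v] cyl_subset[of w] by auto
  hence "real_of_int a < real_of_int b + 1" "real_of_int b < real_of_int a + 1" by auto
  hence "a = b" by linarith
  thus ?case using Cons.IH[of "1 / x - of_int a"] Cons.prems by simp
qed simp

text \<open>Irrationality keeps every remainder away from 0, hence off the boundary of the open
  cylinders.\<close>

lemma irrational_in_cyl:
  assumes "x \<notin> \<rat>" "0 < x" "x < 1"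
  shows "\<exists>w. length w = n \<and> (\<forall>a\<in>set w. a \<ge> 1) \<and> x \<in> cyl w"
  using assms
proof (induction n arbitrary: x)
  case (Suc n)
  define y where "y = 1 / x - of_int \<lfloor>1 / x\<rfloor>"
  have yr: "y \<notin> \<rat>"
  proof
    assume "y \<in> \<rat>"
    hence "y + of_int \<lfloor>1 / x\<rfloor> \<in> \<rat>" by simp
    hence "1 / x \<in> \<rat>" by (simp add: y_def)
    hence "1 / (1 / x) \<in> \<rat>" by (rule Rats_divide[OF Rats_1])
    thus False using Suc.prems by simp
  qed
  have "0 \<le> y" "y < 1" unfolding y_def by linarith+
  moreover have "y \<noteq> 0" using yr by auto
  ultimately obtain w where w: "length w = n" "\<forall>a\<in>set w. a \<ge> 1" "y \<in> cyl w"
    using Suc.IH[OF yr] by auto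
  have "\<lfloor>1 / x\<rfloor> \<ge> 1" using Suc.prems by (simp add: le_floor_iff)
  thus ?case using w Suc.prems by (intro exI[of _ "\<lfloor>1 / x\<rfloor> # w"]) (auto simp: y_def)
qed auto

lemma nn_integral_cyl_Cons:
  fixes h :: "real \<Rightarrow> ennreal"
  assumes [measurable]: "h \<in> borel_measurable borel" and a: "a \<ge> 1" and w: "\<forall>a\<in>set w. a \<ge> 1"
  shows "(\<integral>\<^sup>+x. h x * indicator (cyl (a # w)) x \<partial>lborel) =
    (\<integral>\<^sup>+t. h (1 / (of_int a + t)) * ennreal (1 / (of_int a + t)\<^sup>2) * indicator (cyl w) t \<partial>lborel)"
proof -
  let ?a = "real_of_int a"
  have a': "?a \<ge> 1" using a by simp
  have 1: "x \<in> {1 / (?a + 1)..1 / ?a}" if "x \<in> cyl (a # w)" for x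
  proof -
    have "1 / x - ?a \<in> {0<..<1}" "x > 0" using that cyl_subset[OF w] by auto
    thus ?thesis using a' by (auto simp: field_simps)
  qed
  have "(\<integral>\<^sup>+x. h x * indicator (cyl (a # w)) x \<partial>lborel) =
      (\<integral>\<^sup>+x. (h x * indicator (cyl (a # w)) x) * indicator {1 / (?a + 1)..1 / ?a} x \<partial>lborel)"
    using 1 by (intro nn_integral_cong) (auto simp: indicator_def simp del: cyl.simps)
  also have "\<dots> = (\<integral>\<^sup>+t. (h (1 / (?a + t)) * indicator (cyl (a # w)) (1 / (?a + t))) *
      ennreal (1 / (?a + t)\<^sup>2) * indicator {0..1} t \<partial>lborel)"
    using a' by (intro nn_integral_inverse_branch) measurable
  also have "\<dots> = (\<integral>\<^sup>+t. h (1 / (?a + t)) * ennreal (1 / (?a + t)\<^sup>2) * indicator (cyl w) t \<partial>lborel)"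
    using a' cyl_subset[OF w] by (intro nn_integral_cong) (auto simp: indicator_def)
  finally show ?thesis .
qed

text \<open>
  The matrix \<open>((P', P), (Q', Q))\<close> is the product of the matrices of the digits; the third
  inequality is what makes the first one survive the induction.
\<close>

lemma cylinder_matrix:
  assumes "\<forall>a\<in>set w. a \<ge> 1"
  obtains P P' Q Q' :: real where
    "0 \<le> P" "0 \<le> P'" "0 \<le> Q'" "1 \<le> Q" "real (length w) \<le> Q" "Q' \<le> Q" "\<bar>P * Q' - P' * Q\<bar> = 1"
    "\<And>t. 0 < t \<Longrightarrow> t < 1 \<Longrightarrow> cf_eval w t = (P + P' * t) / (Q + Q' * t)"
    "\<And>h. h \<in> borel_measurable borel \<Longrightarrow> (\<integral>\<^sup>+x. h x * indicator (cyl w) x \<partial>lborel) =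
      (\<integral>\<^sup>+t. h (cf_eval w t) * ennreal (1 / (Q + Q' * t)\<^sup>2) * indicator {0<..<1} t \<partial>lborel)"
    "\<And>x. x \<in> cyl w \<Longrightarrow> \<exists>t\<in>{0<..<1}. x = cf_eval w t"
proof -
  \<comment> \<open>The clause \<open>w \<noteq> [] \<longrightarrow> 1 \<le> P\<close> is there for
    \<open>length w \<le> Q\<close>: a new digit replaces \<open>Q\<close> by
    \<open>a Q + P\<close>, which adds at least 1 from the second digit on.\<close>
  have "\<exists>P P' Q Q' :: real.
    0 \<le> P \<and> 0 \<le> P' \<and> 0 \<le> Q' \<and> 1 \<le> Q \<and> real (length w) \<le> Q \<and> (w \<noteq> [] \<longrightarrow> 1 \<le> P) \<and> Q' \<le> Q \<and> P' + Q' \<le> P + Q \<and> \<bar>P * Q' - P' * Q\<bar> = 1 \<and>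
    (\<forall>t. 0 < t \<longrightarrow> t < 1 \<longrightarrow> cf_eval w t = (P + P' * t) / (Q + Q' * t)) \<and>
    (\<forall>h. h \<in> borel_measurable borel \<longrightarrow> (\<integral>\<^sup>+x. h x * indicator (cyl w) x \<partial>lborel) =
      (\<integral>\<^sup>+t. h (cf_eval w t) * ennreal (1 / (Q + Q' * t)\<^sup>2) * indicator {0<..<1} t \<partial>lborel)) \<and>
    (\<forall>x. x \<in> cyl w \<longrightarrow> (\<exists>t\<in>{0<..<1}. x = cf_eval w t))"
    using assms
  proof (induction w)
    case Nil
    show ?case by (intro exI[of _ "0::real"] exI[of _ "1::real"] conjI) auto
  next
    case (Cons a w)
    hence a: "a \<ge> 1" and w: "\<forall>a\<in>set w. a \<ge> 1" by auto
    from Cons.IH[OF w] obtain P P' Q Q' :: real where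
      IH: "0 \<le> P" "0 \<le> P'" "0 \<le> Q'" "1 \<le> Q" "real (length w) \<le> Q" "w \<noteq> [] \<longrightarrow> 1 \<le> P" "Q' \<le> Q" "P' + Q' \<le> P + Q" "\<bar>P * Q' - P' * Q\<bar> = 1"
      and ev: "\<And>t. 0 < t \<Longrightarrow> t < 1 \<Longrightarrow> cf_eval w t = (P + P' * t) / (Q + Q' * t)"
      and int: "\<And>h. h \<in> borel_measurable borel \<Longrightarrow> (\<integral>\<^sup>+x. h x * indicator (cyl w) x \<partial>lborel) =
      (\<integral>\<^sup>+t. h (cf_eval w t) * ennreal (1 / (Q + Q' * t)\<^sup>2) * indicator {0<..<1} t \<partial>lborel)"
      and im: "\<And>x. x \<in> cyl w \<Longrightarrow> \<exists>t\<in>{0<..<1}. x = cf_eval w t"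
      by (elim exE conjE) (rule that; assumption | blast)
    let ?a = "real_of_int a"
    have a': "?a \<ge> 1" using a by simp
    have aQ: "?a * Q \<ge> Q" "?a * Q - Q \<ge> ?a * Q' - Q'"
      using a' IH mult_left_mono[of Q' Q "?a - 1"] mult_right_mono[of 1 ?a Q] by (auto simp: algebra_simps)
    have aQ': "?a * Q' \<ge> 0" using a' IH by simp
    have len: "real (length (a # w)) \<le> ?a * Q + P"
    proof (cases "w = []")
      case True
      hence "real (length (a # w)) = 1" by simp
      thus ?thesis using IH(1,4) aQ(1) by linarith
    next
      case False
      hence "1 \<le> P" "real (length (a # w)) = real (length w) + 1" using IH by auto
      thus ?thesis using IH(5) aQ(1) by linarith
    qed
    have det: "Q * (?a * Q' + P') - Q' * (?a * Q + P) = - (P * Q' - P' * Q)"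
      by (simp add: algebra_simps)
    have den: "Q + Q' * t > 0" "?a * Q + P + (?a * Q' + P') * t > 0" if "0 < t" for t
      using IH that aQ aQ' by (auto intro!: add_pos_nonneg)
    have ev': "cf_eval (a # w) t = (Q + Q' * t) / (?a * Q + P + (?a * Q' + P') * t)" if "0 < t" "t < 1" for t
    proof -
      have "?a + (P + P' * t) / (Q + Q' * t) = (?a * Q + P + (?a * Q' + P') * t) / (Q + Q' * t)"
        using den(1)[OF that(1)] by (simp add: field_simps)
      thus ?thesis using ev[OF that] by simp
    qed
    have int': "(\<integral>\<^sup>+x. h x * indicator (cyl (a # w)) x \<partial>lborel) =
      (\<integral>\<^sup>+t. h (cf_eval (a # w) t) * ennreal (1 / (?a * Q + P + (?a * Q' + P') * t)\<^sup>2) * indicator {0<..<1} t \<partial>lborel)"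
      if [measurable]: "h \<in> borel_measurable borel" for h
    proof -
      have "(\<integral>\<^sup>+x. h x * indicator (cyl (a # w)) x \<partial>lborel) = (\<integral>\<^sup>+t. h (1 / (?a + cf_eval w t)) * ennreal (1 / (?a + cf_eval w t)\<^sup>2)
          * ennreal (1 / (Q + Q' * t)\<^sup>2) * indicator {0<..<1} t \<partial>lborel)"
        unfolding nn_integral_cyl_Cons[OF that a w] by (intro int) measurable
      also have "\<dots> = (\<integral>\<^sup>+t. h (cf_eval (a # w) t) * ennreal (1 / (?a * Q + P + (?a * Q' + P') * t)\<^sup>2) * indicator {0<..<1} t \<partial>lborel)"
      proof (intro nn_integral_cong)
        fix t :: real
        show "h (1 / (?a + cf_eval w t)) * ennreal (1 / (?a + cf_eval w t)\<^sup>2)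
          * ennreal (1 / (Q + Q' * t)\<^sup>2) * indicator {0<..<1} t =
          h (cf_eval (a # w) t) * ennreal (1 / (?a * Q + P + (?a * Q' + P') * t)\<^sup>2) * indicator {0<..<1} t"
        proof (cases "t \<in> {0<..<1}")
          case True
          hence t: "0 < t" "t < 1" by auto
          have "(?a + cf_eval w t) * (Q + Q' * t) = ?a * Q + P + (?a * Q' + P') * t"
            using den(1)[OF t(1)] ev[OF t] by (simp add: field_simps)
          hence "1 / (?a + cf_eval w t)\<^sup>2 * (1 / (Q + Q' * t)\<^sup>2) = 1 / (?a * Q + P + (?a * Q' + P') * t)\<^sup>2"
            by (metis mult_1 power_mult_distrib times_divide_times_eq)
          hence "ennreal (1 / (?a + cf_eval w t)\<^sup>2) * ennreal (1 / (Q + Q' * t)\<^sup>2) = ennreal (1 / (?a * Q + P + (?a * Q' + P') * t)\<^sup>2)"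
            by (metis ennreal_mult zero_le_divide_1_iff zero_le_power2)
          thus ?thesis by (simp add: mult.assoc)
        qed simp
      qed
      finally show ?thesis .
    qed
    have im': "\<exists>t\<in>{0<..<1}. x = cf_eval (a # w) t" if "x \<in> cyl (a # w)" for x
    proof -
      have x: "x > 0" "1 / x - ?a \<in> cyl w" using that by auto
      from im[OF x(2)] obtain t where "t\<in>{0<..<1}" "1 / x - ?a = cf_eval w t" by auto
      moreover from this have "1 / x = ?a + cf_eval w t" by linarith
      hence "x = 1 / (?a + cf_eval w t)" by (metis div_by_1 divide_divide_eq_right mult_1)
      ultimately show ?thesis by auto
    qed
    show ?case
    proof (intro exI conjI)
      show "0 \<le> Q" "0 \<le> Q'" "0 \<le> ?a * Q' + P'" "1 \<le> ?a * Q + P" "a # w \<noteq> [] \<longrightarrow> 1 \<le> Q"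
        "?a * Q' + P' \<le> ?a * Q + P" "Q' + (?a * Q' + P') \<le> Q + (?a * Q + P)"
        using IH aQ aQ' by linarith+
      show "real (length (a # w)) \<le> ?a * Q + P" by (rule len)
      show "\<bar>Q * (?a * Q' + P') - Q' * (?a * Q + P)\<bar> = 1" unfolding det using IH by simp
    qed (use ev' int' im' in blast)+
  qed
  then obtain P P' Q Q' :: real where
    "0 \<le> P" "0 \<le> P'" "0 \<le> Q'" "1 \<le> Q" "real (length w) \<le> Q" "Q' \<le> Q" "\<bar>P * Q' - P' * Q\<bar> = 1"
    and ev: "\<forall>t. 0 < t \<longrightarrow> t < 1 \<longrightarrow> cf_eval w t = (P + P' * t) / (Q + Q' * t)"
    and int: "\<forall>h. h \<in> borel_measurable borel \<longrightarrow> (\<integral>\<^sup>+x. h x * indicator (cyl w) x \<partial>lborel) =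
      (\<integral>\<^sup>+t. h (cf_eval w t) * ennreal (1 / (Q + Q' * t)\<^sup>2) * indicator {0<..<1} t \<partial>lborel)"
    and im: "\<forall>x. x \<in> cyl w \<longrightarrow> (\<exists>t\<in>{0<..<1}. x = cf_eval w t)"
    by (elim exE conjE) (rule that)
  thus ?thesis
    using ev[rule_format] int[rule_format] im[rule_format] by (intro that)
qed

text \<open>As the determinant is \<plusminus>1, two values of the branch differ by
  \<open>t - s\<close> up to sign, divided by a product of two denominators that are at least
  \<open>Q\<close>; and \<open>length w \<le> Q\<close>.\<close>

lemma cyl_small:
  assumes "\<forall>a\<in>set w. a \<ge> 1" "x \<in> cyl w" "y \<in> cyl w" "w \<noteq> []"
  shows "\<bar>x - y\<bar> \<le> 1 / real (length w)"
proof -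
  obtain P P' Q Q' :: real where m: "0 \<le> P" "0 \<le> P'" "0 \<le> Q'" "1 \<le> Q" "real (length w) \<le> Q" "Q' \<le> Q" "\<bar>P * Q' - P' * Q\<bar> = 1"
    and ev: "\<And>t. 0 < t \<Longrightarrow> t < 1 \<Longrightarrow> cf_eval w t = (P + P' * t) / (Q + Q' * t)"
    and im: "\<And>x. x \<in> cyl w \<Longrightarrow> \<exists>t\<in>{0<..<1}. x = cf_eval w t"
    by (rule cylinder_matrix[OF assms(1)]) (rule that; blast)
  from im[OF assms(2)] obtain s where s: "0 < s" "s < 1" "x = cf_eval w s" by auto
  from im[OF assms(3)] obtain t where t: "0 < t" "t < 1" "y = cf_eval w t" by auto
  define D where "D = (Q + Q' * s) * (Q + Q' * t)"
  have d: "Q + Q' * s \<ge> Q" "Q + Q' * t \<ge> Q" using m s t by auto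
  hence dpos: "Q + Q' * s > 0" "Q + Q' * t > 0" using m by linarith+
  have D: "D \<ge> Q * Q" unfolding D_def using d m by (intro mult_mono) auto
  moreover have "Q * Q \<ge> Q * 1" using m by (intro mult_left_mono) auto
  ultimately have DQ: "D \<ge> Q" by simp
  have "x - y = (P * Q' - P' * Q) * (t - s) / D"
    unfolding D_def s t ev[OF s(1,2)] ev[OF t(1,2)] using dpos by (simp add: field_simps)
  hence "\<bar>x - y\<bar> = \<bar>t - s\<bar> / D" using m DQ by (simp add: abs_mult abs_divide)
  also have "\<dots> \<le> 1 / real (length w)"
    using s t m DQ assms(4) by (intro frac_le) auto
  finally show ?thesis .
qed

definition good_cyls :: "real set \<Rightarrow> nat \<Rightarrow> int list set" where
  "good_cyls U n = {w. length w = n \<and> (\<forall>a\<in>set w. a \<ge> 1) \<and> cyl w \<subseteq> U}"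

text \<open>
  Approximate the complement from outside by an open set, which is exhausted, up to the
  rationals, by the cylinders of increasing rank contained in it.
\<close>

lemma conull_if_dense_in_cylinders:
  assumes A [measurable]: "A \<in> sets borel" and c: "c > 0"
    and dens: "\<And>w. \<forall>a\<in>set w. a \<ge> 1 \<Longrightarrow>
      ennreal c * emeasure lborel (cyl w) \<le> emeasure lborel (A \<inter> cyl w)"
  shows "emeasure lborel ({0<..<1} - A) = 0"
proof -
  define B where "B = {0<..<1} - A"
  have [measurable]: "B \<in> sets borel" unfolding B_def by measurable
  have bound: "emeasure lborel B \<le> ennreal (e / c)" if e: "e > 0" for e :: real
  proof -
    obtain U where U: "open U" "B \<subseteq> U" "emeasure lborel (U - B) < ennreal e"
      using outer_regular_lborel[of B e] e by auto
    have [measurable]: "U \<in> sets borel" using U by simp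
    have UAe: "emeasure lborel (A \<inter> (U \<inter> {0<..<1})) \<le> ennreal e"
    proof -
      have "emeasure lborel (A \<inter> (U \<inter> {0<..<1})) \<le> emeasure lborel (U - B)"
        by (intro emeasure_mono) (auto simp: B_def)
      thus ?thesis using U(3) by simp
    qed
    define V where "V n = (\<Union>w\<in>good_cyls U n. cyl w)" for n
    have cnt: "countable (good_cyls U n)" for n by (rule countableI_type)
    have Vm [measurable]: "V n \<in> sets borel" for n
      unfolding V_def using cnt by (intro sets.countable_UN') auto
    have Vsub: "V n \<subseteq> U \<inter> {0<..<1}" for n
      unfolding V_def good_cyls_def using cyl_subset by auto
    have disj: "disjoint_family_on cyl (good_cyls U n)" for n
      unfolding disjoint_family_on_def good_cyls_def using cyl_disjoint by fastforce
    \<comment> \<open>\<open>A\<close> fills at least the share \<open>c\<close> of every cylinder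
      in \<open>V n\<close>, yet its part in \<open>U\<close> has measure at most \<open>e\<close>.
      So \<open>V n\<close>, and in the limit \<open>B\<close>, has measure at most
      \<open>e / c\<close>.\<close>
    have Ve: "ennreal c * emeasure lborel (V n) \<le> ennreal e" for n
    proof -
      have "ennreal c * emeasure lborel (V n)
          = ennreal c * (\<integral>\<^sup>+w. emeasure lborel (cyl w) \<partial>count_space (good_cyls U n))"
        unfolding V_def using cnt disj by (subst emeasure_UN_countable) auto
      also have "\<dots> = (\<integral>\<^sup>+w. ennreal c * emeasure lborel (cyl w) \<partial>count_space (good_cyls U n))"
        by (rule nn_integral_cmult[symmetric]) simp
      also have "\<dots> \<le> (\<integral>\<^sup>+w. emeasure lborel (A \<inter> cyl w) \<partial>count_space (good_cyls U n))"
        using dens by (intro nn_integral_mono) (auto simp: good_cyls_def)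
      also have "\<dots> = emeasure lborel (\<Union>w\<in>good_cyls U n. A \<inter> cyl w)"
        using cnt disj by (subst emeasure_UN_countable) (auto simp: disjoint_family_on_def)
      also have "\<dots> \<le> emeasure lborel (A \<inter> (U \<inter> {0<..<1}))"
        using Vsub[of n] by (intro emeasure_mono) (auto simp: V_def)
      finally show ?thesis using UAe by simp
    qed
    have ae: "AE x in lborel. x \<in> B \<longrightarrow> (\<exists>N. \<forall>n\<ge>N. x \<in> V n)"
    proof -
      have "AE x in lborel. x \<notin> (\<rat> :: real set)"
        using countable_rat by (intro AE_not_in countable_imp_null_set_lborel)
      thus ?thesis
      proof eventually_elim
        case (elim x)
        show ?case
        proof
          assume x: "x \<in> B"
          hence x01: "0 < x" "x < 1" by (auto simp: B_def)
          from x U obtain r where r: "r > 0" "ball x r \<subseteq> U" by (meson openE subsetD)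
          obtain N where N: "1 / real (Suc N) < r" using r nat_approx_posE by blast
          have "x \<in> V n" if n: "n \<ge> Suc N" for n
          proof -
            obtain w where w: "length w = n" "\<forall>a\<in>set w. a \<ge> 1" "x \<in> cyl w"
              using irrational_in_cyl[OF elim x01] by blast
            have "cyl w \<subseteq> ball x r"
            proof
              fix y assume "y \<in> cyl w"
              hence "\<bar>x - y\<bar> \<le> 1 / real n" using cyl_small[of w x y] w n by fastforce
              also have "\<dots> \<le> 1 / real (Suc N)" using n by (intro divide_left_mono) auto
              finally show "y \<in> ball x r" using N by (simp add: dist_real_def)
            qed
            thus ?thesis using w r unfolding V_def good_cyls_def by blast
          qed
          thus "\<exists>N. \<forall>n\<ge>N. x \<in> V n" by blast
        qed
      qed
    qed
    \<comment> \<open>The sets \<open>V n\<close> increase only up to the rational endpoints of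
      cylinders; intersecting the tails makes the sequence truly monotone.\<close>
    define W where "W N = (\<Inter>n\<in>{N..}. V n)" for N
    have [measurable]: "W N \<in> sets borel" for N unfolding W_def by measurable
    have inc: "incseq W" unfolding W_def incseq_def by (auto; meson order_trans)
    have We: "ennreal c * emeasure lborel (W N) \<le> ennreal e" for N
    proof -
      have "emeasure lborel (W N) \<le> emeasure lborel (V N)"
        by (intro emeasure_mono) (auto simp: W_def)
      thus ?thesis using Ve[of N] by (meson mult_left_mono order_trans zero_le)
    qed
    have "ennreal c * emeasure lborel B \<le> ennreal c * emeasure lborel (\<Union>N. W N)"
      using ae by (intro mult_left_mono emeasure_mono_AE) (auto simp: W_def elim!: eventually_mono)
    also have "emeasure lborel (\<Union>N. W N) = (SUP N. emeasure lborel (W N))"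
      by (rule SUP_emeasure_incseq[symmetric]) (use inc in auto)
    also have "ennreal c * (SUP N. emeasure lborel (W N)) = (SUP N. ennreal c * emeasure lborel (W N))"
      by (rule SUP_mult_left_ennreal)
    also have "\<dots> \<le> ennreal e" by (intro SUP_least We)
    finally have *: "ennreal c * emeasure lborel B \<le> ennreal e" .
    have "ennreal (1 / c) * (ennreal c * emeasure lborel B) \<le> ennreal (1 / c) * ennreal e"
      by (rule mult_left_mono[OF *]) simp
    moreover have "ennreal (1 / c) * ennreal c = 1" using c by (simp flip: ennreal_mult')
    moreover have "ennreal (1 / c) * ennreal e = ennreal (e / c)" using c by (simp flip: ennreal_mult')
    ultimately show ?thesis by (simp flip: mult.assoc)
  qed
  have "emeasure lborel B \<le> 0"
  proof (rule ennreal_le_epsilon)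
    fix e :: real assume "0 < e"
    thus "emeasure lborel B \<le> 0 + ennreal e" using bound[of "e * c"] c by simp
  qed
  thus ?thesis by (simp add: B_def)
qed

subsection \<open>Finite extensions of the Gauss map\<close>

text \<open>Without the factor \<open>1 / ln 2\<close>, so the total mass is \<open>ln 2\<close>.
  Keeping the whole line as space, with the interval in the density, makes measurability plain Borel
  measurability.\<close>

definition gauss_measure :: "real measure" where
  "gauss_measure = density lborel (\<lambda>x. ennreal (1 / (1 + x)) * indicator {0<..<1} x)"

lemma sets_gauss_measure [measurable_cong, simp]: "sets gauss_measure = sets borel"
  by (simp add: gauss_measure_def)

lemma space_gauss_measure [simp]: "space gauss_measure = UNIV"
  by (simp add: gauss_measure_def)

lemma nn_integral_gauss_measure:
  assumes [measurable]: "f \<in> borel_measurable borel"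
  shows "(\<integral>\<^sup>+x. f x \<partial>gauss_measure) = (\<integral>\<^sup>+x. f x * ennreal (1 / (1 + x)) * indicator {0<..<1} x \<partial>lborel)"
  unfolding gauss_measure_def by (subst nn_integral_density) (auto intro!: nn_integral_cong simp: mult_ac)

lemma AE_gauss_measure: "(AE x in gauss_measure. P x) \<longleftrightarrow> (AE x in lborel. 0 < x \<longrightarrow> x < 1 \<longrightarrow> P x)"
  unfolding gauss_measure_def by (subst AE_density) (auto simp: indicator_def intro!: AE_cong)

lemma emeasure_gauss_measure_UNIV: "emeasure gauss_measure UNIV \<le> 1"
proof -
  have "emeasure gauss_measure UNIV = (\<integral>\<^sup>+x. 1 \<partial>gauss_measure)" by simp
  also have "\<dots> = (\<integral>\<^sup>+x. 1 * ennreal (1 / (1 + x)) * indicator {0<..<1} x \<partial>lborel)"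
    by (rule nn_integral_gauss_measure) simp
  also have "\<dots> \<le> (\<integral>\<^sup>+x. indicator {0<..<1::real} x \<partial>lborel)"
    by (rule nn_integral_mono) (auto simp: indicator_def)
  also have "\<dots> = 1" by simp
  finally show ?thesis .
qed

lemma finite_gauss_measure: "finite_measure gauss_measure"
  using emeasure_gauss_measure_UNIV by (intro finite_measureI) (auto simp: top_unique)

lemma T_alpha_measurable [measurable]: "T_alpha \<alpha> \<in> borel_measurable borel"
  unfolding T_alpha_def by measurable

lemma d_alpha_measurable [measurable]: "d_alpha \<alpha> \<in> measurable borel (count_space UNIV)"
  unfolding d_alpha_def by measurable

text \<open>A skew product with finite fibre \<open>F\<close>. That digits permute the fibre gives
  invariance of the measure; that words of digits act transitively gives ergodicity.\<close>

locale gauss_extension =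
  fixes F :: "'s set" and act :: "'s \<Rightarrow> int \<Rightarrow> 's"
  assumes finite_F: "finite F" and F_nonempty: "F \<noteq> {}"
    and act_bij: "\<And>a. bij_betw (\<lambda>f. act f a) F F"
    and act_transitive: "\<And>f g. f \<in> F \<Longrightarrow> g \<in> F \<Longrightarrow> \<exists>w. (\<forall>a\<in>set w. a \<ge> 1) \<and> foldl act f w = g"
begin

definition ext_measure :: "('s \<times> real) measure" where
  "ext_measure = count_space F \<Otimes>\<^sub>M gauss_measure"

definition ext_map :: "'s \<times> real \<Rightarrow> 's \<times> real" where
  "ext_map = (\<lambda>(f, x). (act f (d_alpha 1 x), T_alpha 1 x))"

lemma space_ext_measure: "space ext_measure = F \<times> UNIV"
  by (simp add: ext_measure_def space_pair_measure)

lemma act_in: "f \<in> F \<Longrightarrow> act f a \<in> F"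
  using act_bij[of a] by (auto simp: bij_betw_def)

lemma foldl_act_in: "f \<in> F \<Longrightarrow> foldl act f w \<in> F"
  by (induction w arbitrary: f) (auto intro: act_in)

sublocale gauss: finite_measure gauss_measure by (rule finite_gauss_measure)

lemma nn_integral_ext_measure:
  assumes "h \<in> borel_measurable ext_measure"
  shows "(\<integral>\<^sup>+z. h z \<partial>ext_measure) = (\<Sum>f\<in>F. \<integral>\<^sup>+x. h (f, x) \<partial>gauss_measure)"
proof -
  have "(\<integral>\<^sup>+z. h z \<partial>ext_measure) = (\<integral>\<^sup>+f. \<integral>\<^sup>+x. h (f, x) \<partial>gauss_measure \<partial>count_space F)"
    using assms unfolding ext_measure_def by (intro gauss.nn_integral_fst[symmetric])
  thus ?thesis using finite_F by (simp add: nn_integral_count_space_finite)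
qed

lemma measurable_ext_measure_iff:
  "h \<in> measurable ext_measure N \<longleftrightarrow> (\<forall>f\<in>F. (\<lambda>x. h (f, x)) \<in> measurable borel N)"
proof
  assume h: "h \<in> measurable ext_measure N"
  show "\<forall>f\<in>F. (\<lambda>x. h (f, x)) \<in> measurable borel N"
  proof
    fix f assume "f \<in> F"
    hence "(\<lambda>x. (f, x)) \<in> measurable borel ext_measure"
      unfolding ext_measure_def by (intro measurable_Pair) auto
    from measurable_compose[OF this h] show "(\<lambda>x. h (f, x)) \<in> measurable borel N" .
  qed
next
  assume "\<forall>f\<in>F. (\<lambda>x. h (f, x)) \<in> measurable borel N"
  thus "h \<in> measurable ext_measure N"
    unfolding ext_measure_def using finite_F
    by (intro measurable_pair_measure_countable1) (auto simp: countable_finite cong: measurable_cong_sets)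
qed

lemma ext_map_measurable: "ext_map \<in> measurable ext_measure ext_measure"
  unfolding measurable_ext_measure_iff
proof
  fix f assume f: "f \<in> F"
  have "(\<lambda>x. act f (d_alpha 1 x)) \<in> measurable borel (count_space F)"
    using f by (intro measurable_compose[OF d_alpha_measurable]) (auto intro: act_in)
  thus "(\<lambda>x. ext_map (f, x)) \<in> measurable borel ext_measure"
    unfolding ext_map_def ext_measure_def by simp
qed

text \<open>The fixed-point equation of the Gauss density: with \<open>s = n + 1 + t\<close> the
  \<open>n\<close>-th term is \<open>1 / s - 1 / (s + 1)\<close>, and the series telescopes.\<close>

lemma gauss_density_sum:
  assumes "0 < t" "t < 1"
  shows "(\<Sum>n. ennreal (1 / (1 + 1 / (real (Suc n) + t))) * ennreal (1 / (real (Suc n) + t)\<^sup>2)) = ennreal (1 / (1 + t))"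
proof -
  have e: "ennreal (1 / (1 + 1 / (real (Suc n) + t))) * ennreal (1 / (real (Suc n) + t)\<^sup>2) =
      ennreal (1 / (real n + 1 + t) - 1 / (real (Suc n) + 1 + t))" for n
  proof -
    have "1 / (1 + 1 / (real (Suc n) + t)) * (1 / (real (Suc n) + t)\<^sup>2) =
        1 / (real n + 1 + t) - 1 / (real (Suc n) + 1 + t)"
    proof -
      define s where "s = real n + 1 + t"
      have s: "s > 0" using assms by (simp add: s_def)
      have "1 / (1 + 1 / s) * (1 / s\<^sup>2) = 1 / s - 1 / (s + 1)"
        using s by (simp add: divide_simps power2_eq_square)
      thus ?thesis by (simp add: s_def algebra_simps)
    qed
    thus ?thesis using assms by (simp add: ennreal_mult' flip: ennreal_mult')
  qed
  have "(\<lambda>n. 1 / (real n + 1 + t)) \<longlonglongrightarrow> 0" by real_asymp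
  from telescope_sums'[OF this]
  have s: "(\<lambda>n. 1 / (real n + 1 + t) - 1 / (real (Suc n) + 1 + t)) sums (1 / (1 + t))" by simp
  have nn: "0 \<le> 1 / (real n + 1 + t) - 1 / (real (Suc n) + 1 + t)" for n
    using assms by (simp add: field_simps)
  show ?thesis unfolding e
    by (rule sums_unique[symmetric]) (use s nn assms in \<open>simp add: sums_ennreal\<close>)
qed

lemma sum_act: "(\<Sum>f\<in>F. g (act f a)) = (\<Sum>f\<in>F. g f)"
  using sum.reindex_bij_betw[OF act_bij[of a], of g] .

text \<open>On one branch the digit is constant, so its action merely permutes the sum over the
  fibre; after that the branches recombine by \<open>gauss_density_sum\<close> in each fibre
  separately.\<close>

lemma distr_ext_map: "distr ext_measure ext_measure ext_map = ext_measure"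
proof (rule measure_eqI)
  let ?w = "\<lambda>n t. ennreal (1 / (1 + 1 / (real (Suc n) + t))) * ennreal (1 / (real (Suc n) + t)\<^sup>2)"
  fix E assume "E \<in> sets (distr ext_measure ext_measure ext_map)"
  hence E [measurable]: "E \<in> sets ext_measure" by simp
  have Ef: "(\<lambda>x. indicator E (f, x) :: ennreal) \<in> borel_measurable borel" if "f \<in> F" for f
    using borel_measurable_indicator[OF E] that unfolding measurable_ext_measure_iff by blast
  have "emeasure (distr ext_measure ext_measure ext_map) E = (\<integral>\<^sup>+z. indicator E z \<partial>distr ext_measure ext_measure ext_map)"
    by simp
  also have "\<dots> = (\<integral>\<^sup>+z. indicator E (ext_map z) \<partial>ext_measure)"
    by (intro nn_integral_distr ext_map_measurable) simp
  also have "\<dots> = (\<Sum>f\<in>F. \<integral>\<^sup>+x. indicator E (ext_map (f, x)) \<partial>gauss_measure)"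
    using ext_map_measurable by (intro nn_integral_ext_measure) measurable
  also have "\<dots> = (\<Sum>f\<in>F. \<Sum>n. \<integral>\<^sup>+t. indicator E (act f (int (Suc n)), t) *
      ?w n t * indicator {0<..<1} t \<partial>lborel)"
  proof (intro sum.cong refl)
    fix f assume f: "f \<in> F"
    have "(\<lambda>z. indicator E (ext_map z) :: ennreal) \<in> borel_measurable ext_measure"
      using ext_map_measurable by measurable
    hence m [measurable]: "(\<lambda>x. indicator E (ext_map (f, x)) :: ennreal) \<in> borel_measurable borel"
      using f unfolding measurable_ext_measure_iff by blast
    have "(\<integral>\<^sup>+x. indicator E (ext_map (f, x)) \<partial>gauss_measure) =
       (\<integral>\<^sup>+x. (indicator E (ext_map (f, x)) * ennreal (1 / (1 + x))) * indicator {0<..<1} x \<partial>lborel)"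
      by (rule nn_integral_gauss_measure) simp
    also have "\<dots> = (\<Sum>n. \<integral>\<^sup>+t. (indicator E (ext_map (f, 1 / (real (Suc n) + t))) * ennreal (1 / (1 + 1 / (real (Suc n) + t))))
         * ennreal (1 / (real (Suc n) + t)\<^sup>2) * indicator {0<..<1} t \<partial>lborel)"
      by (rule nn_integral_gauss_branches) simp
    also have "\<dots> = (\<Sum>n. \<integral>\<^sup>+t. indicator E (act f (int (Suc n)), t) *
      ?w n t * indicator {0<..<1} t \<partial>lborel)"
    proof (intro suminf_cong nn_integral_cong)
      fix n and t :: real
      show "(indicator E (ext_map (f, 1 / (real (Suc n) + t))) * ennreal (1 / (1 + 1 / (real (Suc n) + t))))
         * ennreal (1 / (real (Suc n) + t)\<^sup>2) * indicator {0<..<1} t =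
         indicator E (act f (int (Suc n)), t) *
      ?w n t * indicator {0<..<1} t"
      proof (cases "t \<in> {0<..<1}")
        case True
        hence "ext_map (f, 1 / (real (Suc n) + t)) = (act f (int (Suc n)), t)"
          using gauss_branch[of t "int (Suc n)"] by (simp add: ext_map_def)
        thus ?thesis by (simp only: mult.assoc)
      qed simp
    qed
    finally show "(\<integral>\<^sup>+x. indicator E (ext_map (f, x)) \<partial>gauss_measure) = \<dots>" .
  qed
  also have "\<dots> = (\<Sum>n. \<Sum>f\<in>F. \<integral>\<^sup>+t. indicator E (act f (int (Suc n)), t) *
      ?w n t * indicator {0<..<1} t \<partial>lborel)"
    by (rule suminf_sum[symmetric]) simp
  also have "\<dots> = (\<Sum>n. \<Sum>f\<in>F. \<integral>\<^sup>+t. indicator E (f, t) *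
      ?w n t * indicator {0<..<1} t \<partial>lborel)"
    by (intro suminf_cong sum_act)
  also have "\<dots> = (\<Sum>f\<in>F. \<Sum>n. \<integral>\<^sup>+t. indicator E (f, t) *
      ?w n t * indicator {0<..<1} t \<partial>lborel)"
    by (rule suminf_sum) simp
  also have "\<dots> = (\<Sum>f\<in>F. \<integral>\<^sup>+x. indicator E (f, x) \<partial>gauss_measure)"
  proof (intro sum.cong refl)
    fix f assume f: "f \<in> F"
    note [measurable] = Ef[OF f]
    have "(\<Sum>n. \<integral>\<^sup>+t. indicator E (f, t) *
      ?w n t * indicator {0<..<1} t \<partial>lborel)
      = (\<integral>\<^sup>+t. (\<Sum>n. indicator E (f, t) *
      ?w n t * indicator {0<..<1} t) \<partial>lborel)"
      by (rule nn_integral_suminf[symmetric]) simp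
    also have "\<dots> = (\<integral>\<^sup>+t. indicator E (f, t) * ennreal (1 / (1 + t)) * indicator {0<..<1} t \<partial>lborel)"
    proof (intro nn_integral_cong)
      fix t :: real
      show "(\<Sum>n. indicator E (f, t) * ?w n t * indicator {0<..<1} t)
        = indicator E (f, t) * ennreal (1 / (1 + t)) * indicator {0<..<1} t"
      proof (cases "t \<in> {0<..<1}")
        case True
        thus ?thesis using gauss_density_sum[of t] by (simp add: ennreal_suminf_cmult)
      qed simp
    qed
    also have "\<dots> = (\<integral>\<^sup>+x. indicator E (f, x) \<partial>gauss_measure)"
      by (rule nn_integral_gauss_measure[symmetric]) simp
    finally show "(\<Sum>n. \<integral>\<^sup>+t. indicator E (f, t) *
      ?w n t * indicator {0<..<1} t \<partial>lborel) = \<dots>" .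
  qed
  also have "\<dots> = (\<integral>\<^sup>+z. indicator E z \<partial>ext_measure)"
    by (rule nn_integral_ext_measure[symmetric]) simp
  also have "\<dots> = emeasure ext_measure E" by simp
  finally show "emeasure (distr ext_measure ext_measure ext_map) E = emeasure ext_measure E" .
qed simp

lemma slice_measurable:
  assumes "E \<in> sets ext_measure" "f \<in> F"
  shows "{x. (f, x) \<in> E} \<in> sets borel"
proof -
  have "(\<lambda>z. indicator E z :: real) \<in> borel_measurable ext_measure"
    using assms by simp
  hence "(\<lambda>x. indicator E (f, x) :: real) \<in> borel_measurable borel"
    using assms(2) unfolding measurable_ext_measure_iff by blast
  moreover have "(\<lambda>x. indicator E (f, x) :: real) = indicator {x. (f, x) \<in> E}"
    by (auto simp: indicator_def)
  ultimately show ?thesis by (simp add: borel_measurable_indicator_iff)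
qed

lemma null_sets_ext_measure:
  assumes E: "E \<in> sets ext_measure"
    and null: "\<And>f. f \<in> F \<Longrightarrow> emeasure lborel ({x. (f, x) \<in> E} \<inter> {0<..<1}) = 0"
  shows "E \<in> null_sets ext_measure"
proof -
  have "emeasure ext_measure E = (\<integral>\<^sup>+z. indicator E z \<partial>ext_measure)" using E by simp
  also have "\<dots> = (\<Sum>f\<in>F. \<integral>\<^sup>+x. indicator E (f, x) \<partial>gauss_measure)"
    using E by (intro nn_integral_ext_measure) simp
  also have "\<dots> = 0"
  proof (rule sum.neutral, rule ballI)
    fix f assume f: "f \<in> F"
    have "{x. (f, x) \<in> E} \<inter> {0<..<1} \<in> null_sets lborel"
      using slice_measurable[OF E f] null[OF f] by (intro null_setsI) auto
    from AE_not_in[OF this] have "AE x in gauss_measure. (f, x) \<notin> E"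
      unfolding AE_gauss_measure by eventually_elim auto
    hence "(\<integral>\<^sup>+x. indicator E (f, x) \<partial>gauss_measure) = (\<integral>\<^sup>+x. 0 \<partial>gauss_measure)"
      by (intro nn_integral_cong_AE) (auto elim!: eventually_mono)
    thus "(\<integral>\<^sup>+x. indicator E (f, x) \<partial>gauss_measure) = 0" by simp
  qed
  finally show ?thesis using E by (intro null_setsI)
qed

lemma cf_eval_in: "\<forall>a\<in>set w. a \<ge> 1 \<Longrightarrow> 0 < t \<Longrightarrow> t < 1 \<Longrightarrow> 0 < cf_eval w t \<and> cf_eval w t < 1"
proof (induction w)
  case (Cons a w)
  hence "cf_eval w t > 0" "real_of_int a \<ge> 1" by auto
  thus ?case by simp
qed simp

text \<open>After \<open>length w\<close> steps the point \<open>(f, cf_eval w t)\<close> has become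
  \<open>(foldl act f w, t)\<close>.\<close>

lemma invariant_word:
  assumes inv: "ext_map -` A \<inter> space ext_measure = A"
    and w: "\<forall>a\<in>set w. a \<ge> 1" and t: "0 < t" "t < 1" and f: "f \<in> F"
  shows "(f, cf_eval w t) \<in> A \<longleftrightarrow> (foldl act f w, t) \<in> A"
  using w f
proof (induction w arbitrary: f)
  case (Cons a w)
  have "0 < cf_eval w t" "cf_eval w t < 1" using cf_eval_in[of w t] Cons.prems t by auto
  hence "ext_map (f, cf_eval (a # w) t) = (act f a, cf_eval w t)"
    using gauss_branch[of "cf_eval w t" a] Cons.prems by (simp add: ext_map_def)
  moreover have "(f, cf_eval (a # w) t) \<in> A \<longleftrightarrow> ext_map (f, cf_eval (a # w) t) \<in> A"
    using Cons.prems(2) by (subst inv[symmetric]) (simp add: space_ext_measure)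
  ultimately show ?case using Cons.IH[of "act f a"] Cons.prems act_in by simp
qed simp

text \<open>Bounded distortion: \<open>1 / (Q + Q' t)\<^sup>2\<close> varies at most by a factor of 4 over \<open>0 < t < 1\<close>.\<close>

lemma invariant_cylinder:
  assumes A: "A \<in> sets ext_measure" and inv: "ext_map -` A \<inter> space ext_measure = A"
    and w: "\<forall>a\<in>set w. a \<ge> 1" and f: "f \<in> F"
  obtains Q :: real where "Q > 0" "emeasure lborel (cyl w) \<le> ennreal (1 / Q\<^sup>2)"
    "emeasure lborel ({x. (f, x) \<in> A} \<inter> cyl w) \<ge>
      ennreal (1 / (4 * Q\<^sup>2)) * emeasure lborel ({x. (foldl act f w, x) \<in> A} \<inter> {0<..<1})"
proof -
  obtain P P' Q Q' :: real where m: "0 \<le> P" "0 \<le> P'" "0 \<le> Q'" "1 \<le> Q" "Q' \<le> Q"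
    and int: "\<And>h. h \<in> borel_measurable borel \<Longrightarrow> (\<integral>\<^sup>+x. h x * indicator (cyl w) x \<partial>lborel) =
      (\<integral>\<^sup>+t. h (cf_eval w t) * ennreal (1 / (Q + Q' * t)\<^sup>2) * indicator {0<..<1} t \<partial>lborel)"
    by (rule cylinder_matrix[OF w]) (rule that; assumption | blast)
  let ?g = "foldl act f w"
  note [measurable] = slice_measurable[OF A f] slice_measurable[OF A foldl_act_in[OF f]]
  have b: "1 / (4 * Q\<^sup>2) \<le> 1 / (Q + Q' * t)\<^sup>2" "1 / (Q + Q' * t)\<^sup>2 \<le> 1 / Q\<^sup>2" if "0 < t" "t < 1" for t
  proof -
    have "Q' * t \<le> Q * 1" using m that by (intro mult_mono) auto
    hence "Q + Q' * t \<le> 2 * Q" "Q \<le> Q + Q' * t" using m that by auto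
    hence "(Q + Q' * t)\<^sup>2 \<le> (2 * Q)\<^sup>2" "Q\<^sup>2 \<le> (Q + Q' * t)\<^sup>2" using m by (intro power_mono; simp)+
    thus "1 / (4 * Q\<^sup>2) \<le> 1 / (Q + Q' * t)\<^sup>2" "1 / (Q + Q' * t)\<^sup>2 \<le> 1 / Q\<^sup>2"
      using m \<open>Q \<le> Q + Q' * t\<close> by (auto intro!: frac_le simp: power_mult_distrib)
  qed
  show ?thesis
  proof (rule that)
    show "Q > 0" using m by simp
    have "emeasure lborel (cyl w) = (\<integral>\<^sup>+x. 1 * indicator (cyl w) x \<partial>lborel)" by simp
    also have "\<dots> = (\<integral>\<^sup>+t. 1 * ennreal (1 / (Q + Q' * t)\<^sup>2) * indicator {0<..<1} t \<partial>lborel)"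
      by (rule int) simp
    also have "\<dots> \<le> (\<integral>\<^sup>+t. ennreal (1 / Q\<^sup>2) * indicator {0<..<1::real} t \<partial>lborel)"
    proof (rule nn_integral_mono)
      fix t :: real
      show "1 * ennreal (1 / (Q + Q' * t)\<^sup>2) * indicator {0<..<1} t \<le> ennreal (1 / Q\<^sup>2) * indicator {0<..<1} t"
        using b[of t] by (auto simp: indicator_def intro: ennreal_leI)
    qed
    also have "\<dots> = ennreal (1 / Q\<^sup>2)" by (simp add: nn_integral_cmult_indicator)
    finally show "emeasure lborel (cyl w) \<le> ennreal (1 / Q\<^sup>2)" .
    have "ennreal (1 / (4 * Q\<^sup>2)) * emeasure lborel ({x. (?g, x) \<in> A} \<inter> {0<..<1})
      = (\<integral>\<^sup>+t. ennreal (1 / (4 * Q\<^sup>2)) * indicator ({x. (?g, x) \<in> A} \<inter> {0<..<1}) t \<partial>lborel)"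
      by (simp add: nn_integral_cmult_indicator)
    also have "\<dots> \<le> (\<integral>\<^sup>+t. indicator {x. (f, x) \<in> A} (cf_eval w t) * ennreal (1 / (Q + Q' * t)\<^sup>2) * indicator {0<..<1} t \<partial>lborel)"
    proof (rule nn_integral_mono)
      fix t :: real
      show "ennreal (1 / (4 * Q\<^sup>2)) * indicator ({x. (?g, x) \<in> A} \<inter> {0<..<1}) t \<le>
        indicator {x. (f, x) \<in> A} (cf_eval w t) * ennreal (1 / (Q + Q' * t)\<^sup>2) * indicator {0<..<1} t"
        using b(1)[of t] invariant_word[OF inv w _ _ f, of t] by (auto simp: indicator_def intro: ennreal_leI)
    qed
    also have "\<dots> = (\<integral>\<^sup>+x. indicator {x. (f, x) \<in> A} x * indicator (cyl w) x \<partial>lborel)"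
      by (rule int[symmetric]) simp
    also have "\<dots> = (\<integral>\<^sup>+x. indicator ({x. (f, x) \<in> A} \<inter> cyl w) x \<partial>lborel)"
      by (intro nn_integral_cong) (auto simp: indicator_def)
    also have "\<dots> = emeasure lborel ({x. (f, x) \<in> A} \<inter> cyl w)" by simp
    finally show "emeasure lborel ({x. (f, x) \<in> A} \<inter> cyl w) \<ge>
      ennreal (1 / (4 * Q\<^sup>2)) * emeasure lborel ({x. (?g, x) \<in> A} \<inter> {0<..<1})" .
  qed
qed

text \<open>If one slice has positive measure, transitivity carries this to every slice. Let
  \<open>c\<close> be the least slice measure. Bounded distortion gives every slice of
  \<open>A\<close> at least the share \<open>c / 4\<close> of every cylinder, so
  \<open>conull_if_dense_in_cylinders\<close> makes every slice conull.\<close>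

lemma ext_ergodic:
  assumes A: "A \<in> sets ext_measure" and inv: "ext_map -` A \<inter> space ext_measure = A"
  shows "A \<in> null_sets ext_measure \<or> space ext_measure - A \<in> null_sets ext_measure"
proof (cases "\<forall>f\<in>F. emeasure lborel ({x. (f, x) \<in> A} \<inter> {0<..<1}) = 0")
  case True
  thus ?thesis using null_sets_ext_measure[OF A] by blast
next
  case False
  define b where "b f = emeasure lborel ({x. (f, x) \<in> A} \<inter> {0<..<1})" for f
  from False obtain g where g: "g \<in> F" "b g \<noteq> 0" by (auto simp: b_def)
  have fin: "b f \<noteq> \<infinity>" for f
  proof -
    have "b f \<le> emeasure lborel {0<..<1::real}" unfolding b_def by (intro emeasure_mono) auto
    thus ?thesis by (auto simp: top_unique)
  qed
  have pos: "b f > 0" if f: "f \<in> F" for f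
  proof -
    obtain w where w: "\<forall>a\<in>set w. a \<ge> 1" "foldl act f w = g" using act_transitive[OF f g(1)] by blast
    obtain Q :: real where Q: "Q > 0" "emeasure lborel ({x. (f, x) \<in> A} \<inter> cyl w) \<ge>
      ennreal (1 / (4 * Q\<^sup>2)) * emeasure lborel ({x. (foldl act f w, x) \<in> A} \<inter> {0<..<1})"
      using invariant_cylinder[OF A inv w(1) f] by metis
    have "0 < ennreal (1 / (4 * Q\<^sup>2)) * b g"
      using g Q(1) by (simp add: ennreal_zero_less_mult_iff zero_less_iff_neq_zero)
    also have "\<dots> \<le> emeasure lborel ({x. (f, x) \<in> A} \<inter> cyl w)" using Q w by (simp add: b_def)
    also have "\<dots> \<le> b f" unfolding b_def using cyl_subset[OF w(1)] slice_measurable[OF A f]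
      by (intro emeasure_mono) auto
    finally show ?thesis .
  qed
  define c where "c = Min ((\<lambda>f. enn2real (b f)) ` F)"
  have c: "c > 0" unfolding c_def using finite_F F_nonempty pos fin
    by (subst Min_gr_iff) (auto simp: enn2real_positive_iff top.not_eq_extremum)
  have cb: "ennreal c \<le> b f" if "f \<in> F" for f
  proof -
    have "c \<le> enn2real (b f)" unfolding c_def using that finite_F by (intro Min_le) auto
    hence "ennreal c \<le> ennreal (enn2real (b f))" by (rule ennreal_leI)
    thus ?thesis using fin[of f] by (simp add: ennreal_enn2real_if)
  qed
  have co: "emeasure lborel ({0<..<1} - {x. (f, x) \<in> A}) = 0" if f: "f \<in> F" for f
  proof (rule conull_if_dense_in_cylinders)
    show "{x. (f, x) \<in> A} \<in> sets borel" by (rule slice_measurable[OF A f])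
    show "c / 4 > 0" using c by simp
    fix w :: "int list" assume w: "\<forall>a\<in>set w. a \<ge> 1"
    obtain Q :: real where Q: "Q > 0" "emeasure lborel (cyl w) \<le> ennreal (1 / Q\<^sup>2)"
      "emeasure lborel ({x. (f, x) \<in> A} \<inter> cyl w) \<ge>
      ennreal (1 / (4 * Q\<^sup>2)) * emeasure lborel ({x. (foldl act f w, x) \<in> A} \<inter> {0<..<1})"
      using invariant_cylinder[OF A inv w f] by metis
    have "ennreal (c / 4) * emeasure lborel (cyl w) \<le> ennreal (c / 4) * ennreal (1 / Q\<^sup>2)"
      using Q by (intro mult_left_mono) auto
    also have "\<dots> = ennreal (1 / (4 * Q\<^sup>2)) * ennreal c"
      using c Q by (simp flip: ennreal_mult add: mult.commute)
    also have "\<dots> \<le> ennreal (1 / (4 * Q\<^sup>2)) * b (foldl act f w)"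
      using cb[OF foldl_act_in[OF f]] by (intro mult_left_mono) auto
    also have "\<dots> \<le> emeasure lborel ({x. (f, x) \<in> A} \<inter> cyl w)" using Q by (simp add: b_def)
    finally show "ennreal (c / 4) * emeasure lborel (cyl w) \<le> emeasure lborel ({x. (f, x) \<in> A} \<inter> cyl w)" .
  qed
  have "space ext_measure - A \<in> null_sets ext_measure"
  proof (rule null_sets_ext_measure)
    fix f assume f: "f \<in> F"
    have "{x. (f, x) \<in> space ext_measure - A} \<inter> {0<..<1} = {0<..<1} - {x. (f, x) \<in> A}"
      using f by (auto simp: space_ext_measure)
    thus "emeasure lborel ({x. (f, x) \<in> space ext_measure - A} \<inter> {0<..<1}) = 0" using co[OF f] by simp
  qed (use A in auto)
  thus ?thesis ..
qed

lemma emeasure_ext_measure_finite: "emeasure ext_measure (space ext_measure) \<noteq> \<infinity>"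
proof -
  have "emeasure ext_measure (space ext_measure) = (\<integral>\<^sup>+z. 1 \<partial>ext_measure)" by simp
  also have "\<dots> = (\<Sum>f\<in>F. \<integral>\<^sup>+x. 1 \<partial>gauss_measure)" by (rule nn_integral_ext_measure) simp
  also have "\<dots> = of_nat (card F) * emeasure gauss_measure UNIV" by simp
  also have "\<dots> \<le> of_nat (card F) * 1" by (intro mult_left_mono emeasure_gauss_measure_UNIV) simp
  finally show ?thesis by (auto simp: top_unique)
qed

sublocale ext: ergodic_map ext_measure ext_map
  by (intro ergodic_map.intro ergodic_map_axioms.intro finite_measureI emeasure_ext_measure_finite
      ext_map_measurable distr_ext_map ext_ergodic)

end

subsection \<open>Approximation by Nakada continued fractions\<close>

definition mat2 :: "int \<Rightarrow> int \<Rightarrow> int \<Rightarrow> int \<Rightarrow> int^2^2" where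
  "mat2 a b c d = vector [vector [a, b], vector [c, d]]"

lemma mat2_nth [simp]:
  "mat2 a b c d $ 1 $ 1 = a" "mat2 a b c d $ 1 $ 2 = b"
  "mat2 a b c d $ 2 $ 1 = c" "mat2 a b c d $ 2 $ 2 = d"
  by (simp_all add: mat2_def)

lemma matrix2_eq_iff:
  fixes A B :: "int^2^2"
  shows "A = B \<longleftrightarrow> A$1$1 = B$1$1 \<and> A$1$2 = B$1$2 \<and> A$2$1 = B$2$1 \<and> A$2$2 = B$2$2"
  by (auto simp: vec_eq_iff forall_2)

lemma matrix2_mult_nth:
  fixes A B :: "int^2^2"
  shows "(A ** B) $ i $ j = A$i$1 * B$1$j + A$i$2 * B$2$j"
  by (simp add: matrix_matrix_mult_def sum_2)

lemma mat1_nth [simp]: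
  "(mat 1 :: int^2^2) $ 1 $ 1 = 1" "(mat 1 :: int^2^2) $ 1 $ 2 = 0"
  "(mat 1 :: int^2^2) $ 2 $ 1 = 0" "(mat 1 :: int^2^2) $ 2 $ 2 = 1"
  by (simp_all add: mat_def)

text \<open>The columns of the \<open>n\<close>-th matrix are \<open>(p\<^sub>n\<^sub>-\<^sub>1, q\<^sub>n\<^sub>-\<^sub>1)\<close> and \<open>(p\<^sub>n, q\<^sub>n)\<close>.\<close>

primrec cf_matrix :: "real \<Rightarrow> real \<Rightarrow> nat \<Rightarrow> int^2^2" where
  "cf_matrix \<alpha> x 0 = mat 1"
| "cf_matrix \<alpha> x (Suc n) =
    cf_matrix \<alpha> x n ** mat2 0 (eps ((T_alpha \<alpha> ^^ n) x)) 1 (d_alpha \<alpha> ((T_alpha \<alpha> ^^ n) x))"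

lemma cf_matrix_add:
  "cf_matrix \<alpha> x (n + m) = cf_matrix \<alpha> x n ** cf_matrix \<alpha> ((T_alpha \<alpha> ^^ n) x) m"
proof (induction m)
  case (Suc m)
  have "(T_alpha \<alpha> ^^ m) ((T_alpha \<alpha> ^^ n) x) = (T_alpha \<alpha> ^^ (n + m)) x"
    by (simp add: funpow_add add.commute[of n])
  thus ?case using Suc by (simp add: matrix_mul_assoc cf_matrix.simps(2))
qed simp

declare cf_matrix.simps(2) [simp del]

lemma cf_matrix_Suc_nth:
  "cf_matrix \<alpha> x (Suc n) $ 1 $ 1 = cf_matrix \<alpha> x n $ 1 $ 2"
  "cf_matrix \<alpha> x (Suc n) $ 2 $ 1 = cf_matrix \<alpha> x n $ 2 $ 2"
  "cf_matrix \<alpha> x (Suc n) $ 1 $ 2 = eps ((T_alpha \<alpha> ^^ n) x) * cf_matrix \<alpha> x n $ 1 $ 1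
    + d_alpha \<alpha> ((T_alpha \<alpha> ^^ n) x) * cf_matrix \<alpha> x n $ 1 $ 2"
  "cf_matrix \<alpha> x (Suc n) $ 2 $ 2 = eps ((T_alpha \<alpha> ^^ n) x) * cf_matrix \<alpha> x n $ 2 $ 1
    + d_alpha \<alpha> ((T_alpha \<alpha> ^^ n) x) * cf_matrix \<alpha> x n $ 2 $ 2"
  by (simp_all add: cf_matrix.simps(2) matrix2_mult_nth mult.commute)

lemma cf_matrix_p_q:
  "cf_matrix \<alpha> x n $ 1 $ 2 = p_n \<alpha> x n \<and> cf_matrix \<alpha> x n $ 2 $ 2 = q_n \<alpha> x n \<and>
   cf_matrix \<alpha> x (Suc n) $ 1 $ 2 = p_n \<alpha> x (Suc n) \<and> cf_matrix \<alpha> x (Suc n) $ 2 $ 2 = q_n \<alpha> x (Suc n)"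
proof (induction n)
  case 0
  show ?case by (simp add: cf_matrix_Suc_nth d_n_def eps_n_def)
next
  case (Suc n)
  have "cf_matrix \<alpha> x (Suc (Suc n)) $ 1 $ 2 = p_n \<alpha> x (Suc (Suc n))"
    "cf_matrix \<alpha> x (Suc (Suc n)) $ 2 $ 2 = q_n \<alpha> x (Suc (Suc n))"
    using Suc.IH unfolding cf_matrix_Suc_nth(1,2)[of \<alpha> x n] cf_matrix_Suc_nth(3,4)[of \<alpha> x "Suc n"]
    by (simp_all add: d_n_def eps_n_def)
  thus ?case using Suc.IH by blast
qed

lemma det_mat2: "det (mat2 a b c d) = a * d - b * c"
  by (simp add: det_2)

section \<open>Denominators, errors and Legendre's theorem for a fixed
  \<open>\<alpha>\<close>\<close>

locale alpha_cf =
  fixes \<alpha> :: real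
  assumes alpha_pos: "0 < \<alpha>" and alpha_le: "\<alpha> \<le> 1"
begin

abbreviation T :: "real \<Rightarrow> real" where "T \<equiv> T_alpha \<alpha>"

abbreviation M :: "real \<Rightarrow> nat \<Rightarrow> int^2^2" where "M \<equiv> cf_matrix \<alpha>"

lemma T_step:
  assumes "t \<notin> \<rat>" "t \<in> I_alpha \<alpha>"
  shows "of_int (eps t) = t * (of_int (d_alpha \<alpha> t) + T t)" "d_alpha \<alpha> t \<ge> 1"
    "eps t = 1 \<or> eps t = -1 \<and> d_alpha \<alpha> t \<ge> 2" "\<alpha> - 1 \<le> t" "t < \<alpha>" "\<bar>t\<bar> < 1"
proof -
  have t0: "t \<noteq> 0" using assms by auto
  show "of_int (eps t) = t * (of_int (d_alpha \<alpha> t) + T t)"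
    using t0 by (simp add: eps_def d_alpha_def T_alpha_def abs_if)
  show "d_alpha \<alpha> t \<ge> 1" "eps t = 1 \<or> eps t = -1 \<and> d_alpha \<alpha> t \<ge> 2"
    using d_alpha_ge[OF alpha_pos alpha_le assms] by (auto simp: eps_def)
  show "\<alpha> - 1 \<le> t" "t < \<alpha>" using assms by (auto simp: I_alpha_def)
  thus "\<bar>t\<bar> < 1" using alpha_pos alpha_le by linarith
qed

text \<open>The monotonicity \<open>q_{n-1} \<le> q_n\<close> survives a negative sign because the
  digit is then at least 2. The last clause says, free of division, that the matrix maps the
  remainder to \<open>x\<close>.\<close>

lemma matrix_invariants:
  fixes x :: real
  assumes "x \<notin> \<rat>" "x \<in> I_alpha \<alpha>"
  shows "0 \<le> M x n $ 2 $ 1 \<and> M x n $ 2 $ 1 \<le> M x n $ 2 $ 2 \<and> 1 \<le> M x n $ 2 $ 2 \<and>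
    \<bar>det (M x n)\<bar> = 1 \<and>
    x * (M x n $ 2 $ 1 * (T ^^ n) x + M x n $ 2 $ 2) = M x n $ 1 $ 1 * (T ^^ n) x + M x n $ 1 $ 2"
proof (induction n)
  case (Suc n)
  define t d e A where "t = (T ^^ n) x" and "d = d_alpha \<alpha> t" and "e = eps t" and "A = M x n"
  have it: "t \<notin> \<rat>" "t \<in> I_alpha \<alpha>" unfolding t_def using iterate_T_alpha[OF assms] by auto
  note st = T_step[OF it, folded d_def e_def]
  have IH: "0 \<le> A$2$1" "A$2$1 \<le> A$2$2" "1 \<le> A$2$2" "\<bar>det A\<bar> = 1"
    and IHx: "x * (A$2$1 * t + A$2$2) = A$1$1 * t + A$1$2"
    using Suc by (auto simp: A_def t_def)
  have N: "M x (Suc n) = A ** mat2 0 e 1 d" by (simp add: A_def e_def d_def t_def cf_matrix.simps(2))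
  have nth: "M x (Suc n) $ 1 $ 1 = A$1$2" "M x (Suc n) $ 2 $ 1 = A$2$2"
    "M x (Suc n) $ 1 $ 2 = e * A$1$1 + d * A$1$2" "M x (Suc n) $ 2 $ 2 = e * A$2$1 + d * A$2$2"
    by (simp_all add: N matrix2_mult_nth mult.commute)
  have q: "A$2$2 \<le> e * A$2$1 + d * A$2$2"
  proof -
    have "e = 1 \<or> e = -1 \<and> d \<ge> 2" "d \<ge> 1" using st by auto
    thus ?thesis
    proof (elim disjE conjE)
      assume e: "e = 1"
      have "1 * A$2$2 \<le> d * A$2$2" using \<open>d \<ge> 1\<close> IH by (intro mult_right_mono) auto
      thus ?thesis unfolding e using IH(1) by linarith
    next
      assume e: "e = -1" "d \<ge> 2"
      have "2 * A$2$2 \<le> d * A$2$2" using e IH by (intro mult_right_mono) auto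
      thus ?thesis unfolding e(1) using IH(2) by linarith
    qed
  qed
  have "\<bar>det (M x (Suc n))\<bar> = \<bar>det A\<bar> * \<bar>e\<bar>"
    unfolding N by (simp add: det_mul det_mat2 abs_mult)
  moreover have "\<bar>e\<bar> = 1" using st(3) by auto
  moreover have "x * (A$2$2 * T t + (e * A$2$1 + d * A$2$2)) = A$1$2 * T t + (e * A$1$1 + d * A$1$2)"
  proof -
    have "x * (A$2$2 * T t + (real_of_int e * A$2$1 + d * A$2$2)) = (of_int d + T t) * (x * (A$2$1 * t + A$2$2))"
      unfolding st(1) by (simp add: algebra_simps)
    also have "\<dots> = A$1$2 * T t + (real_of_int e * A$1$1 + d * A$1$2)"
      unfolding IHx st(1) by (simp add: algebra_simps)
    finally show ?thesis by simp
  qed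
  ultimately show ?case
    using IH q unfolding nth by (simp flip: t_def)
qed simp

definition err :: "real \<Rightarrow> nat \<Rightarrow> real" where
  "err x n = \<bar>real_of_int (M x n $ 2 $ 2) * x - real_of_int (M x n $ 1 $ 2)\<bar>"

text \<open>The relation between \<open>x\<close> and its remainder turns the error into a product:
  \<open>err x n\<close> is the product of the moduli of the remainders with indices 0 to
  \<open>n\<close>.\<close>

lemma err_step:
  fixes x :: real
  assumes "x \<notin> \<rat>" "x \<in> I_alpha \<alpha>"
  shows "err x (Suc n) = \<bar>(T ^^ Suc n) x\<bar> * err x n"
proof -
  define t A where "t = (T ^^ Suc n) x" and "A = M x (Suc n)"
  have "x * (A$2$1 * t + A$2$2) = A$1$1 * t + A$1$2"
    using matrix_invariants[OF assms, of "Suc n"] unfolding A_def t_def by blast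
  hence "A$2$2 * x - A$1$2 = - t * (A$2$1 * x - A$1$1)" by (simp add: algebra_simps)
  moreover have "A$2$1 = M x n $ 2 $ 2" "A$1$1 = M x n $ 1 $ 2"
    by (simp_all add: A_def cf_matrix_Suc_nth)
  ultimately show ?thesis unfolding err_def t_def[symmetric] A_def[symmetric] by (simp add: abs_mult)
qed

text \<open>Inserting the relation for \<open>x\<close> into the product leaves only the
  determinant. The first column is the previous approximant, so for \<open>n > 0\<close> the first
  factor is \<open>err x (n - 1)\<close>.\<close>

lemma denominator_err:
  fixes x :: real
  assumes "x \<notin> \<rat>" "x \<in> I_alpha \<alpha>"
  shows "\<bar>real_of_int (M x n $ 2 $ 1) * x - real_of_int (M x n $ 1 $ 1)\<bar> * (M x n $ 2 $ 1 * (T ^^ n) x + M x n $ 2 $ 2) = 1"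
    and "M x n $ 2 $ 1 * (T ^^ n) x + M x n $ 2 $ 2 > 0"
    and "M x n $ 2 $ 1 * (T ^^ n) x + M x n $ 2 $ 2 \<le> 2 * M x n $ 2 $ 2"
proof -
  define t A where "t = (T ^^ n) x" and "A = M x n"
  have A: "0 \<le> A$2$1" "A$2$1 \<le> A$2$2" "1 \<le> A$2$2" "\<bar>det A\<bar> = 1"
    and x: "x * (A$2$1 * t + A$2$2) = A$1$1 * t + A$1$2"
    using matrix_invariants[OF assms, of n] by (auto simp: A_def t_def)
  have t: "\<bar>t\<bar> < 1" using T_step(6) iterate_T_alpha[OF assms, of n] by (auto simp: t_def)
  have "\<bar>A$2$1 * t\<bar> \<le> real_of_int (A$2$1) * 1" using t A by (simp add: abs_mult mult_left_le)
  moreover have "real_of_int (A$2$1) * \<bar>t\<bar> < A$2$2"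
  proof (cases "A$2$1 = 0")
    case False
    hence "real_of_int (A$2$1) * \<bar>t\<bar> < real_of_int (A$2$1) * 1" using t A by (intro mult_strict_left_mono) auto
    thus ?thesis using A by linarith
  qed (use A in auto)
  moreover have "\<bar>A$2$1 * t\<bar> = real_of_int (A$2$1) * \<bar>t\<bar>" using A by (simp add: abs_mult)
  ultimately have pos: "A$2$1 * t + A$2$2 > 0" and le: "A$2$1 * t + A$2$2 \<le> 2 * A$2$2"
    using A by linarith+
  have "(A$2$1 * x - A$1$1) * (A$2$1 * t + A$2$2) = A$2$1 * (x * (A$2$1 * t + A$2$2)) - A$1$1 * (A$2$1 * t + A$2$2)"
    by (simp add: algebra_simps)
  also have "\<dots> = - of_int (det A)" unfolding x by (simp add: det_2 algebra_simps)
  finally have "\<bar>(A$2$1 * x - A$1$1) * (A$2$1 * t + A$2$2)\<bar> = \<bar>real_of_int (det A)\<bar>" by simp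
  also have "\<dots> = 1" using A by (metis of_int_1 of_int_abs)
  finally show "\<bar>real_of_int (M x n $ 2 $ 1) * x - real_of_int (M x n $ 1 $ 1)\<bar> * (M x n $ 2 $ 1 * (T ^^ n) x + M x n $ 2 $ 2) = 1"
    using pos by (simp add: abs_mult A_def t_def)
  show "M x n $ 2 $ 1 * (T ^^ n) x + M x n $ 2 $ 2 > 0" using pos by (simp add: A_def t_def)
  show "M x n $ 2 $ 1 * (T ^^ n) x + M x n $ 2 $ 2 \<le> 2 * M x n $ 2 $ 2" using le by (simp add: A_def t_def)
qed

lemma err_lower:
  fixes x :: real
  assumes "x \<notin> \<rat>" "x \<in> I_alpha \<alpha>"
  shows "1 \<le> err x n * (2 * M x (Suc n) $ 2 $ 2)"
proof -
  have e: "err x n = \<bar>real_of_int (M x (Suc n) $ 2 $ 1) * x - real_of_int (M x (Suc n) $ 1 $ 1)\<bar>"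
    by (simp add: err_def cf_matrix_Suc_nth)
  have "1 = err x n * (M x (Suc n) $ 2 $ 1 * (T ^^ Suc n) x + M x (Suc n) $ 2 $ 2)"
    using denominator_err(1)[OF assms, of "Suc n"] unfolding e by simp
  also have "\<dots> \<le> err x n * (2 * M x (Suc n) $ 2 $ 2)"
    using denominator_err(3)[OF assms, of "Suc n"] by (intro mult_left_mono) (auto simp: err_def)
  finally show ?thesis .
qed

definition rate :: real where "rate = max (1 / 2) (1 - \<alpha>)"

lemma rate: "0 < rate" "rate < 1"
  using alpha_pos by (auto simp: rate_def)

text \<open>A single step does not contract uniformly when \<open>\<alpha> = 1\<close>. A negative
  remainder is at most \<open>1 - \<alpha>\<close> in modulus, and a remainder
  \<open>t > 1 / 2\<close> satisfies \<open>t * T t = 1 - t d\<close> with a digit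
  \<open>d \<ge> 1\<close>, which is below \<open>1 / 2\<close>.\<close>

lemma two_steps_contract:
  assumes t: "t \<notin> \<rat>" "t \<in> I_alpha \<alpha>"
  shows "\<bar>T t\<bar> * \<bar>t\<bar> \<le> rate"
proof -
  have Tt: "T t \<notin> \<rat>" "T t \<in> I_alpha \<alpha>" using iterate_T_alpha[OF t, of 1] by auto
  note st = T_step[OF t] and sT = T_step[OF Tt]
  have small: ?thesis if "\<bar>t\<bar> \<le> rate \<or> \<bar>T t\<bar> \<le> rate"
    using that mult_mono[of "\<bar>T t\<bar>" 1 "\<bar>t\<bar>" rate] mult_mono[of "\<bar>T t\<bar>" rate "\<bar>t\<bar>" 1] st(6) sT(6) rate by auto
  show ?thesis
  proof (cases "\<bar>t\<bar> \<le> rate \<or> \<bar>T t\<bar> \<le> rate")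
    case False
    hence t12: "t > 1 / 2" and T0: "T t > 0"
      using st(4,5) sT(4,5) by (auto simp: rate_def)
    hence e: "eps t = 1" by (simp add: eps_def)
    have "t * T t = 1 - t * of_int (d_alpha \<alpha> t)" using st(1) e by (simp add: algebra_simps)
    also have "\<dots> \<le> 1 - t * 1" using t12 st(2) by (intro diff_left_mono mult_left_mono) auto
    finally show ?thesis using t12 T0 by (simp add: rate_def mult.commute max_def)
  qed (rule small)
qed

lemma err_upper:
  fixes x :: real
  assumes "x \<notin> \<rat>" "x \<in> I_alpha \<alpha>"
  shows "err x n \<le> \<bar>x\<bar> * rate ^ (n div 2)"
proof (induction n rule: nat_less_induct)
  case (1 n)
  have e0: "err x 0 = \<bar>x\<bar>" by (simp add: err_def)
  have it: "(T ^^ k) x \<notin> \<rat>" "(T ^^ k) x \<in> I_alpha \<alpha>" for k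
    using iterate_T_alpha[OF assms] by auto
  consider "n = 0" | "n = 1" | m where "n = Suc (Suc m)" by (metis One_nat_def not0_implies_Suc)
  thus ?case
  proof cases
    case 2
    have "err x 1 = \<bar>T x\<bar> * \<bar>x\<bar>" using err_step[OF assms, of 0] e0 by simp
    also have "\<dots> \<le> 1 * \<bar>x\<bar>" using T_step(6)[OF it[of 1]] by (intro mult_right_mono) auto
    finally show ?thesis using 2 by simp
  next
    case (3 m)
    have "err x n = \<bar>T ((T ^^ Suc m) x)\<bar> * \<bar>(T ^^ Suc m) x\<bar> * err x m"
      using err_step[OF assms] 3 by simp
    also have "\<dots> \<le> rate * err x m"
      by (intro mult_right_mono two_steps_contract it) (simp add: err_def)
    also have "\<dots> \<le> rate * (\<bar>x\<bar> * rate ^ (m div 2))"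
      using 1 3 rate by (intro mult_left_mono) auto
    finally show ?thesis using 3 by (simp add: mult_ac)
  qed (use e0 in simp)
qed

text \<open>Bounded denominators would keep the errors away from 0 by \<open>err_lower\<close>,
  whereas they decay geometrically by \<open>err_upper\<close>.\<close>

lemma denominator_unbounded:
  fixes x :: real
  assumes "x \<notin> \<rat>" "x \<in> I_alpha \<alpha>"
  shows "\<exists>n. B < M x n $ 2 $ 2"
proof (rule ccontr)
  assume "\<not> ?thesis"
  hence B: "M x n $ 2 $ 2 \<le> B" for n by (simp add: not_less)
  have B1: "1 \<le> B" using B[of 0] by simp
  have "1 / (2 * real_of_int B) \<le> rate ^ m" for m
  proof -
    have "1 \<le> err x (2 * m) * (2 * M x (Suc (2 * m)) $ 2 $ 2)" by (rule err_lower[OF assms])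
    also have "\<dots> \<le> err x (2 * m) * (2 * real_of_int B)"
      using B by (intro mult_left_mono) (auto simp: err_def)
    also have "\<dots> \<le> rate ^ m * (2 * real_of_int B)"
    proof (rule mult_right_mono)
      have "err x (2 * m) \<le> \<bar>x\<bar> * rate ^ m" using err_upper[OF assms, of "2 * m"] by simp
      also have "\<dots> \<le> 1 * rate ^ m" using T_step(6)[OF assms] rate by (intro mult_right_mono) auto
      finally show "err x (2 * m) \<le> rate ^ m" by simp
    qed (use B1 in simp)
    finally show ?thesis using B1 by (simp add: field_simps)
  qed
  moreover have "(\<lambda>m. rate ^ m) \<longlonglongrightarrow> 0" using rate by (intro LIMSEQ_power_zero) auto
  ultimately have "1 / (2 * real_of_int B) \<le> 0" by (intro LIMSEQ_le_const) auto
  thus False using B1 by (simp add: field_simps)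
qed

text \<open>
  A Legendre theorem. Write \<open>(P, Q) = a (p\<^sub>k, q\<^sub>k) + b (p\<^sub>k\<^sub>+\<^sub>1, q\<^sub>k\<^sub>+\<^sub>1)\<close> where \<open>q\<^sub>k \<le> Q < q\<^sub>k\<^sub>+\<^sub>1\<close>; if
  \<open>b \<noteq> 0\<close>, then \<open>a\<close> and \<open>b\<close> have opposite signs and \<open>\<bar>a\<bar> \<ge> \<bar>b\<bar>\<close>, so \<open>\<bar>a - b t\<bar> \<ge> \<alpha> \<bar>a\<bar>\<close> for \<open>t \<ge> \<alpha> - 1\<close>.
\<close>

lemma legendre:
  fixes x :: real and P Q :: int
  assumes x: "x \<notin> \<rat>" "x \<in> I_alpha \<alpha>" and Q: "1 \<le> Q" and co: "coprime P Q"
    and close: "real_of_int Q * \<bar>real_of_int Q * x - real_of_int P\<bar> < \<alpha> / 4"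
  shows "\<exists>k. M x k $ 1 $ 2 = P \<and> M x k $ 2 $ 2 = Q"
proof -
  define m where "m = (LEAST m. Q < M x m $ 2 $ 2)"
  have m: "Q < M x m $ 2 $ 2" unfolding m_def using denominator_unbounded[OF x] by (rule LeastI_ex)
  have "m \<noteq> 0" using m Q by (intro notI) simp
  then obtain k where k: "m = Suc k" using not0_implies_Suc by blast
  have qk: "M x k $ 2 $ 2 \<le> Q" using not_less_Least[of k "\<lambda>m. Q < M x m $ 2 $ 2"] k m_def by fastforce
  define p q p' q' t where "p = M x k $ 1 $ 2" and "q = M x k $ 2 $ 2"
    and "p' = M x (Suc k) $ 1 $ 2" and "q' = M x (Suc k) $ 2 $ 2" and "t = (T ^^ Suc k) x"
  have A: "M x (Suc k) $ 1 $ 1 = p" "M x (Suc k) $ 2 $ 1 = q"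
    by (simp_all add: cf_matrix_Suc_nth p_def q_def)
  have inv: "0 \<le> q" "q \<le> q'" "1 \<le> q'" "\<bar>p * q' - p' * q\<bar> = 1"
    and eq: "x * (q * t + q') = p * t + p'"
    using matrix_invariants[OF x, of "Suc k"] unfolding A det_2 by (auto simp: p'_def q'_def t_def)
  have q1: "1 \<le> q" using matrix_invariants[OF x, of k] by (simp add: q_def)
  have t: "\<alpha> - 1 \<le> t" using T_step(4) iterate_T_alpha[OF x, of "Suc k"] by (auto simp: t_def)
  define D where "D = p * q' - p' * q"
  have DD: "D * D = 1" using inv(4) unfolding D_def by (metis abs_mult_self_eq mult_1)
  define a b where "a = D * (P * q' - Q * p')" and "b = D * (p * Q - q * P)"
  have Qab: "Q = a * q + b * q'"
  proof -
    have "a * q + b * q' = D * D * Q" unfolding a_def b_def D_def by (simp add: algebra_simps)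
    thus ?thesis using DD by simp
  qed
  have Pab: "P = a * p + b * p'"
  proof -
    have "a * p + b * p' = D * D * P" unfolding a_def b_def D_def by (simp add: algebra_simps)
    thus ?thesis using DD by simp
  qed
  have qQ: "q \<le> Q" "Q < q'" using qk m k by (auto simp: q_def q'_def)
  have "b = 0"
  proof (rule ccontr)
    assume b: "b \<noteq> 0"
    \<comment> \<open>The factor \<open>1 / 2\<close> is lost for \<open>b > 0\<close>, where only
      \<open>q' \<le> 2 c Q\<close> is available. Together with the factor 2 in
      \<open>err_lower\<close> it produces the constant \<open>\<alpha> / 4\<close>.\<close>
    have key: "(\<alpha> / 2) * q' \<le> Q * \<bar>a - b * t\<bar>"
    proof (cases "b > 0")
      case True
      define c where "c = - a"
      have c: "c * q + Q = b * q'" using Qab by (simp add: c_def)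
      have cb: "c \<ge> b"
      proof (rule ccontr)
        assume "\<not> c \<ge> b"
        hence "c \<le> b - 1" by simp
        have "c * q \<le> (b - 1) * q" using \<open>c \<le> b - 1\<close> q1 by (intro mult_right_mono) auto
        also have "\<dots> \<le> (b - 1) * q'" using True inv by (intro mult_left_mono) auto
        finally show False using c qQ by (simp add: algebra_simps)
      qed
      have c1: "c \<ge> 1" using cb True by simp
      have "q' \<le> b * q'" using True inv mult_right_mono[of 1 b q'] by simp
      moreover have "c * q \<le> c * Q" using c1 qQ by (intro mult_left_mono) auto
      moreover have "Q \<le> c * Q" using c1 Q mult_right_mono[of 1 c Q] by simp
      ultimately have "q' \<le> 2 * (c * Q)" using c by linarith
      hence h: "real_of_int q' \<le> 2 * (real_of_int c * Q)" by (metis of_int_le_iff of_int_mult of_int_numeral)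
      have "of_int b * t \<ge> of_int b * (\<alpha> - 1)" using True t by (intro mult_left_mono) auto
      moreover have "of_int b * (1 - \<alpha>) \<le> of_int c * (1 - \<alpha>)" using cb alpha_le by (intro mult_right_mono) auto
      ultimately have "of_int c + of_int b * t \<ge> of_int c * \<alpha>" by (simp add: algebra_simps)
      moreover have "\<bar>a - b * t\<bar> \<ge> of_int c + of_int b * t" by (simp add: c_def)
      ultimately have "\<bar>a - b * t\<bar> \<ge> of_int c * \<alpha>" by linarith
      hence "Q * \<bar>a - b * t\<bar> \<ge> Q * (of_int c * \<alpha>)" using Q by (intro mult_left_mono) auto
      moreover have "(\<alpha> / 2) * q' \<le> (\<alpha> / 2) * (2 * (real_of_int c * Q))"
        using h alpha_pos by (intro mult_left_mono) auto
      ultimately show ?thesis by (simp add: mult_ac)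
    next
      case False
      define c where "c = - b"
      have c: "c \<ge> 1" using False b by (simp add: c_def)
      have aq: "a * q = Q + c * q'" using Qab by (simp add: c_def)
      have "c * q \<le> c * q'" using c inv by (intro mult_left_mono) auto
      hence "c * q < a * q" using aq Q by linarith
      hence ac: "c \<le> a" using q1 by (simp add: mult_less_cancel_right)
      have "q' \<le> c * q'" using c inv mult_right_mono[of 1 c q'] by simp
      moreover have "a * q \<le> a * Q" using ac c qQ by (intro mult_left_mono) auto
      ultimately have "q' \<le> a * Q" using aq Q by linarith
      hence h: "real_of_int q' \<le> real_of_int a * Q" by (metis of_int_le_iff of_int_mult)
      have "of_int c * t \<ge> of_int c * (\<alpha> - 1)" using c t by (intro mult_left_mono) auto
      moreover have "of_int c * (1 - \<alpha>) \<le> of_int a * (1 - \<alpha>)" using ac alpha_le by (intro mult_right_mono) auto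
      ultimately have "of_int a + of_int c * t \<ge> of_int a * \<alpha>" by (simp add: algebra_simps)
      moreover have "\<bar>a - b * t\<bar> \<ge> of_int a + of_int c * t" by (simp add: c_def)
      ultimately have "\<bar>a - b * t\<bar> \<ge> of_int a * \<alpha>" by linarith
      hence "Q * \<bar>a - b * t\<bar> \<ge> Q * (of_int a * \<alpha>)" using Q by (intro mult_left_mono) auto
      moreover have "\<alpha> * real_of_int q' \<le> \<alpha> * (real_of_int a * Q)"
        using h alpha_pos by (intro mult_left_mono) auto
      moreover have "(\<alpha> / 2) * real_of_int q' \<le> \<alpha> * real_of_int q'"
        using alpha_pos inv by (intro mult_right_mono) auto
      ultimately show ?thesis by (simp add: mult_ac)
    qed
    have e1: "q' * x - p' = - t * (q * x - p)" using eq by (simp add: algebra_simps)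
    have "Q * x - P = a * (q * x - p) + b * (q' * x - p')"
      unfolding Qab Pab by (simp add: algebra_simps)
    also have "\<dots> = (a - b * t) * (q * x - p)" unfolding e1 by (simp add: algebra_simps)
    finally have "Q * x - P = (a - b * t) * (q * x - p)" .
    hence err: "\<bar>Q * x - P\<bar> = \<bar>a - b * t\<bar> * err x k"
      by (simp add: abs_mult err_def p_def q_def)
    have "\<alpha> / 4 \<le> (\<alpha> / 4) * (err x k * (2 * q'))"
      using err_lower[OF x, of k] alpha_pos mult_left_mono[of 1 _ "\<alpha> / 4"] by (simp add: q'_def)
    also have "\<dots> = ((\<alpha> / 2) * q') * err x k" by simp
    also have "\<dots> \<le> (Q * \<bar>a - b * t\<bar>) * err x k"
      using key by (rule mult_right_mono) (simp add: err_def)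
    also have "\<dots> = Q * \<bar>Q * x - P\<bar>" unfolding err by simp
    finally show False using close by simp
  qed
  hence PQ: "P = a * p" "Q = a * q" using Pab Qab by auto
  hence "a dvd 1" using co by (metis coprime_common_divisor dvd_triv_left)
  moreover have "a > 0" using PQ(2) Q q1 by (metis linorder_not_le mult_nonpos_nonneg not_one_le_zero order_trans zero_le_one)
  ultimately have "a = 1" by simp
  thus ?thesis using PQ p_def q_def by auto
qed

text \<open>
  The first column matters only up to sign and up to multiples of the second one, and this
  changes neither \<open>1 / \<bar>t\<bar>\<close> modulo 1 nor the next column: an approximant determines all later ones.
\<close>

lemma resynchronise_1:
  fixes x y :: real
  assumes x: "x \<notin> \<rat>" "x \<in> I_alpha \<alpha>" and y: "0 < y"
    and det: "\<bar>det B\<bar> = 1" and pos: "0 < B$2$1 * y + B$2$2"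
    and xy: "x * (B$2$1 * y + B$2$2) = B$1$1 * y + B$1$2"
    and col: "M x k $ 1 $ 2 = B$1$2" "M x k $ 2 $ 2 = B$2$2"
  shows "M x (Suc k) = B ** M y 1" "(T ^^ Suc k) x = T y"
proof -
  define A t where "A = M x k" and "t = (T ^^ k) x"
  have detA: "\<bar>det A\<bar> = 1" and eqA: "x * (A$2$1 * t + A$2$2) = A$1$1 * t + A$1$2"
    using matrix_invariants[OF x, of k] by (auto simp: A_def t_def)
  have w: "A$2$1 * t + A$2$2 > 0" using denominator_err(2)[OF x, of k] by (simp add: A_def t_def)
  have t0: "t \<noteq> 0" using iterate_T_alpha[OF x, of k] by (auto simp: t_def)
  \<comment> \<open>Since \<open>A\<close> and \<open>B\<close> share their second column,
    \<open>A\<close> is \<open>B\<close> times the lower triangular matrix with rows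
    \<open>(\<delta>, 0)\<close> and \<open>(j, 1)\<close>. On the remainders this reads
    \<open>1 / y = 1 / (\<delta> t) + \<delta> j\<close>, an integer shift of
    \<open>1 / \<bar>t\<bar>\<close>.\<close>
  define \<delta> j where "\<delta> = det A * det B" and "j = det B * (B$1$1 * A$2$1 - B$2$1 * A$1$1)"
  have BB: "det B * det B = 1" using det by (metis abs_mult_self_eq mult_1)
  have AA: "det A * det A = 1" using detA by (metis abs_mult_self_eq mult_1)
  have \<delta>: "\<delta> * \<delta> = 1" unfolding \<delta>_def using AA BB by (metis mult.assoc mult.left_commute mult_1)
  have c2: "A$1$2 = B$1$2" "A$2$2 = B$2$2" using col by (auto simp: A_def)
  have A11: "A$1$1 = \<delta> * B$1$1 + j * B$1$2"
  proof -
    have "\<delta> * B$1$1 + j * B$1$2 = det B * det B * A$1$1"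
      unfolding \<delta>_def j_def det_2[of A] c2 by (simp add: det_2 algebra_simps)
    thus ?thesis using BB by simp
  qed
  have A21: "A$2$1 = \<delta> * B$2$1 + j * B$2$2"
  proof -
    have "\<delta> * B$2$1 + j * B$2$2 = det B * det B * A$2$1"
      unfolding \<delta>_def j_def det_2[of A] c2 by (simp add: det_2 algebra_simps)
    thus ?thesis using BB by simp
  qed
  define u v where "u = B$2$1 * y + B$2$2" and "v = A$2$1 * t + A$2$2"
  have v: "v = B$2$1 * (\<delta> * t) + B$2$2 * (j * t + 1)"
    unfolding v_def A21 c2 by (simp add: algebra_simps)
  have xv: "x * v = B$1$1 * (\<delta> * t) + B$1$2 * (j * t + 1)"
  proof -
    have "x * v = A$1$1 * t + A$1$2" using eqA unfolding v_def .
    also have "\<dots> = B$1$1 * (\<delta> * t) + B$1$2 * (j * t + 1)"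
      unfolding A11 c2 by (simp add: algebra_simps)
    finally show ?thesis .
  qed
  have xu: "x * u = B$1$1 * y + B$1$2" using xy by (simp add: u_def)
  have dB: "real_of_int (det B) = B$1$1 * B$2$2 - B$1$2 * B$2$1" by (simp add: det_2)
  have dB0: "real_of_int (det B) \<noteq> 0" using det by auto
  have l1: "of_int (det B) * (\<delta> * t) = B$2$2 * (x * v) - B$1$2 * v"
    unfolding xv unfolding v dB by (simp add: algebra_simps)
  have l2: "of_int (det B) * y = B$2$2 * (x * u) - B$1$2 * u"
    unfolding xu unfolding u_def dB by (simp add: algebra_simps)
  have "of_int (det B) * (\<delta> * t * u) = of_int (det B) * (\<delta> * t) * u" by simp
  also have "\<dots> = of_int (det B) * y * v" unfolding l1 l2 by (simp add: algebra_simps)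
  finally have "of_int (det B) * (\<delta> * t * u) = of_int (det B) * (y * v)" by (simp only: mult.assoc)
  hence e1: "\<delta> * t * u = y * v" using mult_left_cancel[OF dB0] by blast
  have l3: "of_int (det B) * (j * t + 1) = B$1$1 * v - B$2$1 * (x * v)"
    unfolding xv unfolding v dB by (simp add: algebra_simps)
  have l4: "real_of_int (det B) = B$1$1 * u - B$2$1 * (x * u)"
    unfolding xu unfolding u_def dB by (simp add: algebra_simps)
  have "of_int (det B) * ((j * t + 1) * u) = of_int (det B) * (j * t + 1) * u" by simp
  also have "\<dots> = of_int (det B) * v" unfolding l3 by (subst l4) (simp add: algebra_simps)
  finally have "of_int (det B) * ((j * t + 1) * u) = of_int (det B) * v" .
  hence e2: "(j * t + 1) * u = v" using dB0 by simp
  have uv: "u > 0" "v > 0" using pos w by (auto simp: u_def v_def)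
  have "\<delta> * t * u > 0" unfolding e1 using y uv by simp
  hence dt: "\<delta> * t > 0" using uv by (simp add: zero_less_mult_iff)
  have \<delta>1: "\<delta> = 1 \<or> \<delta> = -1" using \<delta> by (auto simp: zmult_eq_1_iff)
  hence e: "eps t = \<delta>" and at: "\<bar>1 / t\<bar> = 1 / (\<delta> * t)"
    using dt by (auto simp: eps_def)
  have "\<delta> * t * u = y * (j * t + 1) * u" using e1 e2 by simp
  hence "\<delta> * t = y * (j * t + 1)" using uv by simp
  hence "1 / y = (j * t + 1) / (\<delta> * t)" using y dt by (simp add: field_simps)
  also have "\<dots> = 1 / (\<delta> * t) + \<delta> * j" using \<delta>1 t0 by (auto simp: field_simps)
  finally have iy: "1 / y = 1 / (\<delta> * t) + \<delta> * j" .
  have "\<bar>1 / y\<bar> = 1 / y" using y by simp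
  hence inv: "\<bar>1 / t\<bar> = \<bar>1 / y\<bar> - of_int (\<delta> * j)" using at iy by simp
  have "\<lfloor>\<bar>1 / t\<bar> + 1 - \<alpha>\<rfloor> = \<lfloor>\<bar>1 / y\<bar> + 1 - \<alpha> - of_int (\<delta> * j)\<rfloor>" unfolding inv by (simp add: algebra_simps)
  also have "\<dots> = \<lfloor>\<bar>1 / y\<bar> + 1 - \<alpha>\<rfloor> - \<delta> * j" by (rule floor_diff_of_int)
  finally have d: "d_alpha \<alpha> t = d_alpha \<alpha> y - \<delta> * j" by (simp add: d_alpha_def)
  have "T t = \<bar>1 / t\<bar> - of_int (d_alpha \<alpha> t)" "T y = \<bar>1 / y\<bar> - of_int (d_alpha \<alpha> y)"
    using t0 y by (simp_all add: T_alpha_def d_alpha_def)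
  hence "T t = T y" unfolding d inv by simp
  thus "(T ^^ Suc k) x = T y" by (simp add: t_def)
  have ey: "eps y = 1" using y by (simp add: eps_def)
  have "M x (Suc k) = A ** mat2 0 \<delta> 1 (d_alpha \<alpha> y - \<delta> * j)" using e d by (simp add: A_def t_def cf_matrix.simps(2))
  also have "\<dots> = B ** M y 1"
    unfolding matrix2_eq_iff using \<delta>
    by (auto simp: matrix2_mult_nth cf_matrix_Suc_nth ey c2 A11 A21 algebra_simps simp flip: mult.assoc)
  finally show "M x (Suc k) = B ** M y 1" .
qed

text \<open>From the first step on the full matrices agree; at \<open>i = 0\<close> only their
  second columns do.\<close>

lemma resynchronise:
  fixes x y :: real
  assumes "x \<notin> \<rat>" "x \<in> I_alpha \<alpha>" "0 < y" "\<bar>det B\<bar> = 1" "0 < B$2$1 * y + B$2$2"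
    "x * (B$2$1 * y + B$2$2) = B$1$1 * y + B$1$2"
    "M x k $ 1 $ 2 = B$1$2" "M x k $ 2 $ 2 = B$2$2" "i \<noteq> 0"
  shows "M x (k + i) = B ** M y i"
proof -
  obtain j where j: "i = Suc j" using assms(9) not0_implies_Suc by blast
  have "M x (Suc k + j) = B ** M y 1 ** M (T y) j"
    unfolding cf_matrix_add[of \<alpha> x "Suc k" j] resynchronise_1[OF assms(1-8)] ..
  also have "\<dots> = B ** M y (1 + j)" unfolding cf_matrix_add[of \<alpha> y 1 j] by (simp add: matrix_mul_assoc)
  finally show ?thesis by (simp add: j)
qed

end

subsection \<open>Synchronisation with the regular continued fraction\<close>

text \<open>The part of a matrix that carries the approximant, and all that two expansions share at
  a synchronisation time.\<close>

definition col2 :: "int^2^2 \<Rightarrow> int \<times> int" where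
  "col2 A = (A$1$2, A$2$2)"

lemma col2_mult: "col2 A = col2 B \<Longrightarrow> col2 (C ** A) = col2 (C ** B)"
  by (simp add: col2_def matrix2_mult_nth)

interpretation rcf: alpha_cf 1
  by unfold_locales simp_all

lemma gauss_iterate:
  assumes "z \<notin> \<rat>" "0 < z" "z < 1"
  shows "(T_alpha 1 ^^ n) z \<notin> \<rat>" "0 < (T_alpha 1 ^^ n) z" "(T_alpha 1 ^^ n) z < 1"
proof -
  have "z \<in> I_alpha 1" using assms by (simp add: I_alpha_def)
  from iterate_T_alpha[OF assms(1) this, of n]
  have *: "(T_alpha 1 ^^ n) z \<notin> \<rat>" "0 \<le> (T_alpha 1 ^^ n) z" "(T_alpha 1 ^^ n) z < 1"
    by (auto simp: I_alpha_def)
  moreover have "(T_alpha 1 ^^ n) z \<noteq> 0" using *(1) by auto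
  ultimately show "(T_alpha 1 ^^ n) z \<notin> \<rat>" "0 < (T_alpha 1 ^^ n) z" "(T_alpha 1 ^^ n) z < 1" by auto
qed

lemma det_1_coprime_col:
  fixes A :: "int^2^2"
  assumes "\<bar>det A\<bar> = 1"
  shows "coprime (A$1$2) (A$2$2)"
proof (rule coprimeI)
  fix c assume "c dvd A$1$2" "c dvd A$2$2"
  hence "c dvd A$1$1 * A$2$2 - A$1$2 * A$2$1" by (meson dvd_diff dvd_mult dvd_mult2)
  hence "c dvd \<bar>det A\<bar>" by (simp add: det_2)
  thus "is_unit c" using assms by simp
qed

lemma gauss_denominator_err:
  assumes z: "z \<notin> \<rat>" "0 < z" "z < 1"
  shows "\<bar>real_of_int (cf_matrix 1 z n $ 2 $ 1) * z - real_of_int (cf_matrix 1 z n $ 1 $ 1)\<bar> * cf_matrix 1 z n $ 2 $ 2 \<le> 1"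
proof -
  have zI: "z \<in> I_alpha 1" using z by (simp add: I_alpha_def)
  let ?A = "cf_matrix 1 z n"
  have "0 \<le> ?A $ 2 $ 1" using rcf.matrix_invariants[OF z(1) zI, of n] by blast
  hence "real_of_int (?A $ 2 $ 1) * (T_alpha 1 ^^ n) z \<ge> 0"
    using gauss_iterate[OF z, of n] by (intro mult_nonneg_nonneg) auto
  hence "\<bar>real_of_int (?A $ 2 $ 1) * z - real_of_int (?A $ 1 $ 1)\<bar> * ?A $ 2 $ 2 \<le>
    \<bar>real_of_int (?A $ 2 $ 1) * z - real_of_int (?A $ 1 $ 1)\<bar> * (?A $ 2 $ 1 * (T_alpha 1 ^^ n) z + ?A $ 2 $ 2)"
    by (intro mult_left_mono) auto
  also have "\<dots> = 1" by (rule rcf.denominator_err(1)[OF z(1) zI])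
  finally show ?thesis .
qed

text \<open>This separates later regular denominators from the initial value 1, so that no excursion
  can end at index 0. The first digit is at least 2 because \<open>z < 1 / 2\<close>.\<close>

lemma gauss_denominator_ge_2:
  assumes z: "z \<notin> \<rat>" "0 < z" "z < 1 / 2" and n: "n \<noteq> 0"
  shows "cf_matrix 1 z n $ 2 $ 2 \<ge> 2"
proof -
  have zI: "z \<in> I_alpha 1" using z by (simp add: I_alpha_def)
  have "cf_matrix 1 z (Suc m) $ 2 $ 2 \<ge> 2" for m
  proof (induction m)
    case 0
    have "2 \<le> 1 / z" using z by (simp add: field_simps)
    hence "d_alpha 1 z \<ge> 2" using z by (simp add: d_alpha_def le_floor_iff)
    thus ?case by (simp add: cf_matrix_Suc_nth)
  next
    case (Suc m)
    have "cf_matrix 1 z (Suc (Suc m)) $ 2 $ 1 \<le> cf_matrix 1 z (Suc (Suc m)) $ 2 $ 2"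
      using rcf.matrix_invariants[OF z(1) zI, of "Suc (Suc m)"] by blast
    thus ?case using Suc by (simp add: cf_matrix_Suc_nth(2))
  qed
  thus ?thesis using n not0_implies_Suc by blast
qed

context alpha_cf
begin

text \<open>A regular approximant with remainder \<open>y\<close> satisfies
  \<open>q * \<bar>q z - p\<bar> \<le> y\<close>, so the bound on \<open>y\<close> is the constant
  of \<open>legendre\<close>.\<close>

definition sync :: "real \<Rightarrow> bool" where
  "sync y \<longleftrightarrow> 0 < y \<and> y < \<alpha> / 4"

text \<open>
  By \<open>legendre\<close>, a regular approximant that is followed by a large digit is also an
  \<open>\<alpha>\<close>-approximant.
\<close>

lemma sync_matrix:
  assumes x: "x \<notin> \<rat>" "x \<in> I_alpha \<alpha>" and z: "z \<notin> \<rat>" "0 < z" "z < 1"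
    and xz: "x = z + of_int c" and B: "B = mat2 1 c 0 1 ** cf_matrix 1 z n"
  shows "\<bar>det B\<bar> = 1" "0 < B$2$1 * (T_alpha 1 ^^ n) z + B$2$2"
    "x * (B$2$1 * (T_alpha 1 ^^ n) z + B$2$2) = B$1$1 * (T_alpha 1 ^^ n) z + B$1$2"
    "sync ((T_alpha 1 ^^ n) z) \<Longrightarrow> \<exists>k. col2 (M x k) = col2 B"
proof -
  have zI: "z \<in> I_alpha 1" using z by (simp add: I_alpha_def)
  define A y where "A = cf_matrix 1 z n" and "y = (T_alpha 1 ^^ n) z"
  have A: "0 \<le> A$2$1" "1 \<le> A$2$2" "\<bar>det A\<bar> = 1" and eq: "z * (A$2$1 * y + A$2$2) = A$1$1 * y + A$1$2"
    using rcf.matrix_invariants[OF z(1) zI, of n] by (auto simp: A_def y_def)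
  have nth: "B$1$1 = A$1$1 + c * A$2$1" "B$1$2 = A$1$2 + c * A$2$2" "B$2$1 = A$2$1" "B$2$2 = A$2$2"
    unfolding B A_def by (simp_all add: matrix2_mult_nth)
  show dB: "\<bar>det B\<bar> = 1" using A(3) unfolding B A_def by (simp add: det_mul det_mat2)
  show "0 < B$2$1 * (T_alpha 1 ^^ n) z + B$2$2"
    using rcf.denominator_err(2)[OF z(1) zI, of n] nth by (simp add: A_def)
  have "x * (A$2$1 * y + A$2$2) = z * (A$2$1 * y + A$2$2) + c * (A$2$1 * y + A$2$2)"
    unfolding xz by (simp add: algebra_simps)
  also have "\<dots> = A$1$1 * y + A$1$2 + c * (A$2$1 * y + A$2$2)" unfolding eq ..
  finally show "x * (B$2$1 * (T_alpha 1 ^^ n) z + B$2$2) = B$1$1 * (T_alpha 1 ^^ n) z + B$1$2"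
    unfolding nth y_def[symmetric] by (simp add: algebra_simps)
  assume s: "sync ((T_alpha 1 ^^ n) z)"
  have "real_of_int (A$2$2) * z - real_of_int (A$1$2) = - y * (real_of_int (A$2$1) * z - real_of_int (A$1$1))"
    using eq by (simp add: algebra_simps)
  hence "\<bar>real_of_int (A$2$2) * z - real_of_int (A$1$2)\<bar> = y * \<bar>real_of_int (A$2$1) * z - real_of_int (A$1$1)\<bar>"
    using s by (simp add: abs_mult sync_def y_def)
  hence "real_of_int (A$2$2) * \<bar>real_of_int (A$2$2) * z - real_of_int (A$1$2)\<bar> =
      y * (\<bar>real_of_int (A$2$1) * z - real_of_int (A$1$1)\<bar> * A$2$2)" by simp
  also have "\<dots> \<le> y * 1"
    using gauss_denominator_err[OF z, of n] s by (intro mult_left_mono) (auto simp: A_def y_def sync_def)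
  also have "\<dots> < \<alpha> / 4" using s by (simp add: sync_def y_def)
  finally have close: "real_of_int (B$2$2) * \<bar>real_of_int (B$2$2) * x - real_of_int (B$1$2)\<bar> < \<alpha> / 4"
    unfolding nth xz by (simp add: algebra_simps)
  from legendre[OF x _ det_1_coprime_col[OF dB] close] show "\<exists>k. col2 (M x k) = col2 B"
    using A nth by (simp add: col2_def)
qed

lemma sync_bounds:
  assumes "sync y"
  shows "0 < y" "y < 1 / 2" "y < 1" "y \<in> I_alpha \<alpha>"
  using assms alpha_pos alpha_le by (auto simp: sync_def I_alpha_def)

section \<open>Excursions between synchronisation times\<close>

definition returns :: "real \<Rightarrow> nat \<Rightarrow> bool" where
  "returns y n \<longleftrightarrow> n \<noteq> 0 \<and> sync ((T_alpha 1 ^^ n) y) \<and> (\<forall>j\<in>{1..<n}. \<not> sync ((T_alpha 1 ^^ j) y))"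

definition excursion_end :: "real \<Rightarrow> nat \<Rightarrow> bool" where
  "excursion_end y i \<longleftrightarrow> i \<noteq> 0 \<and> (\<exists>n. returns y n \<and> col2 (M y i) = col2 (cf_matrix 1 y n))"

text \<open>The value 1 is used only on the null set of points that never return.\<close>

definition excursion_length :: "real \<Rightarrow> nat" where
  "excursion_length y = (if \<exists>i. excursion_end y i then LEAST i. excursion_end y i else 1)"

lemma returns_unique: "returns y m \<Longrightarrow> returns y n \<Longrightarrow> m = n"
proof (induction m n rule: linorder_wlog)
  case (le a b)
  thus ?case by (cases "a = b") (auto simp: returns_def)
qed auto

lemma excursion_length_pos: "excursion_length y \<noteq> 0"
proof (cases "\<exists>i. excursion_end y i")
  case True
  hence "excursion_end y (LEAST i. excursion_end y i)" by (rule LeastI_ex)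
  thus ?thesis using True unfolding excursion_length_def excursion_end_def by presburger
qed (simp add: excursion_length_def)

text \<open>Legendre supplies an index with the right column, and index 0 is excluded by its
  denominator 1. The return time is unique, so the least excursion end belongs to \<open>n\<close>
  as well.\<close>

lemma excursion_length:
  assumes y: "y \<notin> \<rat>" "sync y" and r: "returns y n"
  shows "col2 (M y (excursion_length y)) = col2 (cf_matrix 1 y n)"
proof -
  note b = sync_bounds[OF y(2)]
  have "mat2 1 0 0 1 = (mat 1 :: int^2^2)" by (simp add: matrix2_eq_iff)
  hence "cf_matrix 1 y n = mat2 1 0 0 1 ** cf_matrix 1 y n" by simp
  moreover have "sync ((T_alpha 1 ^^ n) y)" "n \<noteq> 0" using r by (auto simp: returns_def)
  ultimately obtain k where k: "col2 (M y k) = col2 (cf_matrix 1 y n)"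
    using sync_matrix(4)[OF y(1) b(4) y(1) b(1,3), of 0 "cf_matrix 1 y n" n] by auto
  have "k \<noteq> 0"
  proof
    assume "k = 0"
    hence "cf_matrix 1 y n $ 2 $ 2 = 1" using k by (simp add: col2_def)
    thus False using gauss_denominator_ge_2[OF y(1) b(1,2) \<open>n \<noteq> 0\<close>] by simp
  qed
  hence ex: "\<exists>i. excursion_end y i" using k r unfolding excursion_end_def by blast
  hence "excursion_end y (excursion_length y)"
    unfolding excursion_length_def by (simp add: LeastI_ex)
  thus ?thesis using returns_unique[OF r] unfolding excursion_end_def by metis
qed

text \<open>That many pairs of \<open>\<alpha>\<close>-steps shrink the error by
  \<open>\<alpha> / 8\<close>: the factor \<open>\<alpha> / 4\<close> that one regular step may cost
  before the return, and a spare \<open>1 / 2\<close> against the 2 in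
  \<open>err_lower\<close>.\<close>

definition excursion_rate :: nat where
  "excursion_rate = (SOME C. rate ^ C \<le> \<alpha> / 8)"

lemma excursion_rate: "rate ^ excursion_rate \<le> \<alpha> / 8"
proof -
  have "\<exists>C. rate ^ C < \<alpha> / 8" using rate alpha_pos real_arch_pow_inv[of "\<alpha> / 8" rate] by simp
  hence "\<exists>C. rate ^ C \<le> \<alpha> / 8" by (meson less_imp_le)
  thus ?thesis unfolding excursion_rate_def by (rule someI_ex)
qed

lemma gauss_err_lower:
  assumes y: "y \<notin> \<rat>" "0 < y" "y < 1" and no: "\<And>j. j \<in> {1..m} \<Longrightarrow> \<not> sync ((T_alpha 1 ^^ j) y)"
  shows "y * (\<alpha> / 4) ^ m \<le> rcf.err y m"
  using no
proof (induction m)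
  case 0
  show ?case using y by (simp add: rcf.err_def)
next
  case (Suc m)
  have yI: "y \<in> I_alpha 1" using y by (simp add: I_alpha_def)
  have t: "(T_alpha 1 ^^ Suc m) y \<ge> \<alpha> / 4"
    using Suc.prems[of "Suc m"] gauss_iterate[OF y, of "Suc m"] by (auto simp: sync_def)
  have "y * (\<alpha> / 4) ^ Suc m = (\<alpha> / 4) * (y * (\<alpha> / 4) ^ m)" by simp
  also have "\<dots> \<le> \<bar>(T_alpha 1 ^^ Suc m) y\<bar> * rcf.err y m"
    using Suc t alpha_pos y by (intro mult_mono) auto
  finally show ?case unfolding rcf.err_step[OF y(1) yI] .
qed

text \<open>Both expansions end the excursion with the same denominator \<open>Q\<close>. No
  intermediate regular remainder is below \<open>\<alpha> / 4\<close>, so \<open>Q\<close> is at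
  most \<open>1 / (y (\<alpha> / 4) ^ (n - 1))\<close>. On the \<open>\<alpha>\<close>-side
  \<open>1 \<le> 2 Q y rate ^ (l div 2)\<close>, since errors decay geometrically. The two bounds
  force \<open>l\<close> to be at most linear in \<open>n\<close>.\<close>

lemma excursion_length_le:
  assumes y: "y \<notin> \<rat>" "sync y" and r: "returns y n"
  shows "excursion_length y \<le> 2 * excursion_rate * n"
proof -
  note b = sync_bounds[OF y(2)]
  define l Q where "l = excursion_length y - 1" and "Q = cf_matrix 1 y n $ 2 $ 2"
  have l: "excursion_length y = Suc l" using excursion_length_pos[of y] by (simp add: l_def)
  from r obtain m where n: "n = Suc m" unfolding returns_def using not0_implies_Suc by blast
  have MQ: "M y (Suc l) $ 2 $ 2 = Q" using excursion_length[OF y r] by (simp add: col2_def l Q_def)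
  have Q1: "Q \<ge> 1"
    using rcf.matrix_invariants[of y n] y(1) b by (simp add: Q_def I_alpha_def)
  have "y * (\<alpha> / 4) ^ m \<le> rcf.err y m"
    using r n by (intro gauss_err_lower y b) (auto simp: returns_def)
  hence "y * (\<alpha> / 4) ^ m * Q \<le> rcf.err y m * Q" using Q1 by (intro mult_right_mono) auto
  also have "\<dots> \<le> 1"
    using gauss_denominator_err[OF y(1) b(1,3), of n] by (simp add: n Q_def rcf.err_def cf_matrix_Suc_nth)
  finally have 1: "y * (\<alpha> / 4) ^ m * Q \<le> 1" .
  have "1 \<le> err y l * (2 * Q)" using err_lower[OF y(1) b(4), of l] MQ by simp
  also have "\<dots> \<le> (\<bar>y\<bar> * rate ^ (l div 2)) * (2 * Q)"
    using err_upper[OF y(1) b(4), of l] Q1 by (intro mult_right_mono) auto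
  finally have 2: "1 \<le> y * rate ^ (l div 2) * (2 * Q)" using b by simp
  have "l div 2 < excursion_rate * n"
  proof (rule ccontr)
    assume "\<not> ?thesis"
    hence "rate ^ (l div 2) \<le> rate ^ (excursion_rate * n)"
      using rate by (intro power_decreasing) auto
    also have "\<dots> \<le> (\<alpha> / 8) ^ n" unfolding power_mult using excursion_rate rate by (intro power_mono) auto
    also have "\<dots> = (\<alpha> / 8) * (\<alpha> / 8) ^ m" by (simp add: n)
    also have "\<dots> \<le> (\<alpha> / 8) * (\<alpha> / 4) ^ m"
      using alpha_pos by (intro mult_left_mono power_mono) auto
    finally have 3: "rate ^ (l div 2) \<le> (\<alpha> / 8) * (\<alpha> / 4) ^ m" .
    have "1 \<le> y * (2 * Q) * rate ^ (l div 2)" using 2 by (simp add: mult_ac)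
    also have "\<dots> \<le> y * (2 * Q) * ((\<alpha> / 8) * (\<alpha> / 4) ^ m)"
      using 3 b Q1 by (intro mult_left_mono) auto
    also have "\<dots> = (\<alpha> / 4) * (y * (\<alpha> / 4) ^ m * Q)" by simp
    also have "\<dots> \<le> (\<alpha> / 4) * 1" using 1 alpha_pos by (intro mult_left_mono) auto
    finally show False using alpha_le by simp
  qed
  thus ?thesis unfolding l by simp
qed

text \<open>The \<open>\<alpha>\<close>-time that belongs to regular time \<open>m\<close>. An
  excursion is booked in full at its start, so the value is the index of the
  \<open>\<alpha>\<close>-approximant at the next synchronisation, not at \<open>m\<close>
  itself.\<close>

definition elapsed :: "real \<Rightarrow> nat \<Rightarrow> nat" where
  "elapsed y m = (\<Sum>j<m. if sync ((T_alpha 1 ^^ j) y) then excursion_length ((T_alpha 1 ^^ j) y) else 0)"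

text \<open>The first clause keeps the two clocks aligned and carries the induction for the second.
  At the start of an excursion only second columns agree, so \<open>g\<close> may depend on nothing
  else.\<close>

lemma excursion_decomposition:
  fixes g :: "int^2^2 \<Rightarrow> real"
  assumes y: "y \<notin> \<rat>" "sync y" and g: "\<And>A B. col2 A = col2 B \<Longrightarrow> g A = g B"
  shows "(\<forall>n\<ge>m. sync ((T_alpha 1 ^^ n) y) \<longrightarrow> (\<forall>j\<in>{m..<n}. \<not> sync ((T_alpha 1 ^^ j) y)) \<longrightarrow>
      col2 (M y (elapsed y m)) = col2 (cf_matrix 1 y n)) \<and>
    (\<Sum>j<m. if sync ((T_alpha 1 ^^ j) y) then
      \<Sum>i<excursion_length ((T_alpha 1 ^^ j) y). g (cf_matrix 1 y j ** M ((T_alpha 1 ^^ j) y) i) else 0)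
    = (\<Sum>i<elapsed y m. g (M y i))"
proof (induction m)
  case 0
  show ?case
  proof (intro conjI allI impI)
    fix n :: nat assume no: "\<forall>j\<in>{0..<n}. \<not> sync ((T_alpha 1 ^^ j) y)"
    have "n = 0"
    proof (rule ccontr)
      assume "n \<noteq> 0"
      hence "\<not> sync ((T_alpha 1 ^^ 0) y)" using no by (intro bspec[OF no]) simp
      thus False using y(2) by simp
    qed
    thus "col2 (M y (elapsed y 0)) = col2 (cf_matrix 1 y n)" by (simp add: elapsed_def)
  qed (simp add: elapsed_def)
next
  case (Suc m)
  note b = sync_bounds[OF y(2)]
  define w L where "w = (T_alpha 1 ^^ m) y" and "L = elapsed y m"
  have wi: "w \<notin> \<rat>" "0 < w" "w < 1" unfolding w_def using gauss_iterate[OF y(1) b(1,3)] by auto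
  show ?case
  proof (cases "sync w")
    case False
    hence "elapsed y (Suc m) = elapsed y m" by (simp add: elapsed_def w_def)
    moreover have "{m..<n} = insert m {Suc m..<n}" if "n \<ge> Suc m" for n using that by auto
    ultimately show ?thesis using Suc False by (auto simp: w_def)
  next
    case True
    define B where "B = cf_matrix 1 y m"
    have "mat2 1 0 0 1 = (mat 1 :: int^2^2)" by (simp add: matrix2_eq_iff)
    hence B: "B = mat2 1 0 0 1 ** cf_matrix 1 y m" by (simp add: B_def)
    have y0: "y = y + of_int 0" by simp
    note sm = sync_matrix[OF y(1) b(4) y(1) b(1,3) y0 B, folded w_def]
    have c: "col2 (M y L) = col2 B" using Suc True by (auto simp: L_def B_def w_def)
    have res: "M y (L + i) = B ** M w i" if "i \<noteq> 0" for i
      using c that by (intro resynchronise[OF y(1) b(4) wi(2) sm(1-3)]) (auto simp: col2_def)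
    have res2: "col2 (M y (L + i)) = col2 (B ** M w i)" for i
      using res[of i] c by (cases "i = 0") auto
    have el: "elapsed y (Suc m) = L + excursion_length w" using True by (simp add: elapsed_def w_def L_def)
    have split: "(\<Sum>i<L + k. g (M y i)) = (\<Sum>i<L. g (M y i)) + (\<Sum>i<k. g (M y (L + i)))" for k
      by (induction k) (auto simp: add.assoc)
    have "(\<Sum>i<elapsed y (Suc m). g (M y i)) = (\<Sum>i<L. g (M y i)) + (\<Sum>i<excursion_length w. g (M y (L + i)))"
      unfolding el by (rule split)
    also have "(\<Sum>i<excursion_length w. g (M y (L + i))) = (\<Sum>i<excursion_length w. g (B ** M w i))"
      by (intro sum.cong refl g res2)
    finally have s: "(\<Sum>i<elapsed y (Suc m). g (M y i)) = (\<Sum>i<L. g (M y i)) + (\<Sum>i<excursion_length w. g (B ** M w i))" .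
    show ?thesis
    proof (intro conjI allI impI)
      fix n assume n: "Suc m \<le> n" "sync ((T_alpha 1 ^^ n) y)" "\<forall>j\<in>{Suc m..<n}. \<not> sync ((T_alpha 1 ^^ j) y)"
      have it: "(T_alpha 1 ^^ j) w = (T_alpha 1 ^^ (m + j)) y" for j
        by (simp add: w_def funpow_add add.commute[of m])
      have "returns w (n - m)" using n unfolding returns_def it by auto
      from excursion_length[OF wi(1) True this]
      have "col2 (M y (elapsed y (Suc m))) = col2 (B ** cf_matrix 1 w (n - m))"
        unfolding el res2 by (rule col2_mult)
      also have "B ** cf_matrix 1 w (n - m) = cf_matrix 1 y n"
        using cf_matrix_add[of 1 y m "n - m"] n(1) by (simp add: B_def w_def)
      finally show "col2 (M y (elapsed y (Suc m))) = col2 (cf_matrix 1 y n)" .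
    next
      show "(\<Sum>j<Suc m. if sync ((T_alpha 1 ^^ j) y) then
        \<Sum>i<excursion_length ((T_alpha 1 ^^ j) y). g (cf_matrix 1 y j ** M ((T_alpha 1 ^^ j) y) i) else 0)
        = (\<Sum>i<elapsed y (Suc m). g (M y i))"
        unfolding s using Suc True by (simp add: B_def w_def L_def)
    qed
  qed
qed

end

subsection \<open>Cosets, cusps and widths\<close>

lemma matrix2_mult:
  "mat2 a b c d ** mat2 a' b' c' d' = mat2 (a * a' + b * c') (a * b' + b * d') (c * a' + d * c') (c * b' + d * d')"
  by (simp add: matrix2_eq_iff matrix2_mult_nth)

text \<open>Euclid's algorithm on the second row: a shear by a multiple followed by a swap replaces
  the lower left entry by a remainder, until the matrix is triangular.\<close>

lemma GL2Z_generators: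
  assumes det: "\<bar>det X\<bar> = 1" and one: "P (mat 1)" and neg: "\<And>X. P (- X) \<longleftrightarrow> P X"
    and shear: "\<And>X. P (X ** mat2 1 1 0 1) \<longleftrightarrow> P X" and swap: "\<And>X. P (X ** mat2 0 1 1 0) \<longleftrightarrow> P X"
  shows "P X"
proof -
  have shear_nat: "P (X ** mat2 1 (int n) 0 1) \<longleftrightarrow> P X" for X n
  proof (induction n)
    case 0
    have "mat2 1 0 0 1 = mat 1" by (simp add: matrix2_eq_iff)
    thus ?case by simp
  next
    case (Suc n)
    have "X ** mat2 1 (int (Suc n)) 0 1 = X ** mat2 1 (int n) 0 1 ** mat2 1 1 0 1"
      by (simp add: matrix2_mult add.commute flip: matrix_mul_assoc)
    thus ?case using Suc shear by simp
  qed
  have shears: "P (X ** mat2 1 k 0 1) \<longleftrightarrow> P X" for X k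
  proof (cases "k \<ge> 0")
    case True
    thus ?thesis using shear_nat[of X "nat k"] by simp
  next
    case False
    have "mat2 1 0 0 1 = mat 1" by (simp add: matrix2_eq_iff)
    hence "X ** mat2 1 k 0 1 ** mat2 1 (int (nat (- k))) 0 1 = X"
      using False by (simp add: matrix2_mult flip: matrix_mul_assoc)
    thus ?thesis using shear_nat[of "X ** mat2 1 k 0 1" "nat (- k)"] by simp
  qed
  show ?thesis using det
  proof (induction "nat \<bar>X$2$1\<bar>" arbitrary: X rule: less_induct)
    case less
    show ?case
    proof (cases "X$2$1 = 0")
      case True
      define a b d where "a = X$1$1" and "b = X$1$2" and "d = X$2$2"
      have X: "X = mat2 a b 0 d" using True by (simp add: matrix2_eq_iff a_def b_def d_def)
      have "\<bar>a * d\<bar> = 1" using less.prems unfolding X det_mat2 by simp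
      hence "a * d = 1 \<or> a * (- d) = 1" by auto
      hence ad: "a = 1 \<or> a = -1" "d = 1 \<or> d = -1" unfolding zmult_eq_1_iff by auto
      have "X ** mat2 1 (- a * b) 0 1 = mat2 a 0 0 d" using ad(1) by (auto simp: X matrix2_mult)
      hence PX: "P X \<longleftrightarrow> P (mat2 a 0 0 d)" using shears by metis
      have pp: "P (mat2 1 0 0 1)" using one by (metis mat1_nth mat2_nth matrix2_eq_iff)
      \<comment> \<open>Up to the sign covered by \<open>neg\<close>, only
        \<open>diag (1, 1)\<close> and \<open>diag (1, -1)\<close> are left; the latter is this word
        in shears, inverse shears and swaps.\<close>
      have "mat2 1 0 0 1 ** mat2 1 1 0 1 ** mat2 0 1 1 0 ** mat2 1 (-1) 0 1 ** mat2 0 1 1 0 ** mat2 1 1 0 1 ** mat2 0 1 1 0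
        = mat2 1 0 0 (-1)" by (simp add: matrix2_mult)
      hence pm: "P (mat2 1 0 0 (-1))" using pp shears swap by metis
      have neg': "P (mat2 (- a) 0 0 (- d)) \<longleftrightarrow> P (mat2 a 0 0 d)" for a d
      proof -
        have "- mat2 a 0 0 d = mat2 (- a) 0 0 (- d)" by (simp add: matrix2_eq_iff)
        thus ?thesis using neg by metis
      qed
      show ?thesis using ad pp pm neg'[of 1 1] neg'[of 1 "-1"] unfolding PX by auto
    next
      case False
      define k where "k = - (X$2$2 div X$2$1)"
      define Y where "Y = X ** mat2 1 k 0 1 ** mat2 0 1 1 0"
      have "Y$2$1 = X$2$2 mod X$2$1"
        by (simp add: Y_def k_def matrix2_mult_nth minus_mult_div_eq_mod[symmetric] algebra_simps)
      hence "nat \<bar>Y$2$1\<bar> < nat \<bar>X$2$1\<bar>"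
        using False abs_mod_less[of "X$2$1" "X$2$2"] by simp
      moreover have "\<bar>det Y\<bar> = 1" using less.prems by (simp add: Y_def det_mul det_mat2)
      ultimately have "P Y" by (rule less.hyps)
      thus ?thesis by (simp add: Y_def swap shears)
    qed
  qed
qed

text \<open>The adjugate times the determinant; a determinant \<plusminus>1 is its own
  inverse.\<close>

definition inv2 :: "int^2^2 \<Rightarrow> int^2^2" where
  "inv2 B = mat2 (det B * B$2$2) (- det B * B$1$2) (- det B * B$2$1) (det B * B$1$1)"

lemma inv2:
  assumes "\<bar>det B\<bar> = 1"
  shows "B ** inv2 B = mat 1" "inv2 B ** B = mat 1" "\<bar>det (inv2 B)\<bar> = 1"
proof -
  have BB: "det B * det B = 1" using assms by (metis abs_mult_self_eq mult_1)
  have e: "det B * (B$1$1 * B$2$2) - det B * (B$1$2 * B$2$1) = 1"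
    using BB by (subst (asm) (2) det_2) (simp add: right_diff_distrib)
  show 1: "B ** inv2 B = mat 1" "inv2 B ** B = mat 1"
    using e by (auto simp: matrix2_eq_iff matrix2_mult_nth inv2_def algebra_simps)
  have "\<bar>det B\<bar> * \<bar>det (inv2 B)\<bar> = 1" using arg_cong[OF 1(1), of det] by (simp add: det_mul flip: abs_mult)
  thus "\<bar>det (inv2 B)\<bar> = 1" using assms by simp
qed

section \<open>Elements of \<open>PSL2Z\<close> as matrices up to sign\<close>

definition pm :: "int^2^2 \<Rightarrow> (int^2^2) set" where
  "pm A = {A, - A}"

lemma carrier_PSL2Z: "carrier PSL2Z = pm ` {A. det A = 1}"
  by (auto simp: PSL2Z_def FactGroup_def RCOSETS_def rcos_eq pm_def) (auto simp: SL2Z_def)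

lemma pm_mult: "det A = 1 \<Longrightarrow> det B = 1 \<Longrightarrow> pm A \<otimes>\<^bsub>PSL2Z\<^esub> pm B = pm (A ** B)"
  using normal.rcos_sum[OF center_normal, of A B]
  by (simp add: PSL2Z_def FactGroup_def SL2Z_def rcos_eq[unfolded SL2Z_def] pm_def)

lemma pm_one: "\<one>\<^bsub>PSL2Z\<^esub> = pm (mat 1)"
  by (simp add: PSL2Z_def FactGroup_def pm_def)

lemma psl_act_pm: "psl_act (pm A) x = moebius A x"
  using psl_act_rcos[of A x] by (simp add: rcos_eq pm_def)

lemma pm_eq_iff: "pm A = pm B \<longleftrightarrow> A = B \<or> A = - B"
  by (auto simp: pm_def doubleton_eq_iff)

definition point :: "int^2^2 \<Rightarrow> rat option" where
  "point A = rat_point (of_int (A$1$2)) (of_int (A$2$2))"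

lemma point_moebius: "point A = moebius A (Some 0)"
  using moebius_rat_point[of 0 1 A] by (simp add: point_def rat_point_def)

lemma point_mult:
  assumes "\<bar>det A\<bar> = 1"
  shows "point (B ** A) = moebius B (point A)"
proof -
  have "A$1$2 \<noteq> 0 \<or> A$2$2 \<noteq> 0" using assms by (auto simp: det_2)
  thus ?thesis unfolding point_def
    by (subst moebius_rat_point) (auto simp: matrix2_mult_nth)
qed

lemma card_image_eq:
  assumes "\<And>s t. s \<in> K \<Longrightarrow> t \<in> K \<Longrightarrow> f s = f t \<longleftrightarrow> g s = g t"
  shows "card (f ` K) = card (g ` K)"
proof -
  define h where "h = g \<circ> inv_into K f"
  have h: "h (f s) = g s" if "s \<in> K" for s
    using assms[of "inv_into K f (f s)" s] that by (simp add: h_def f_inv_into_f inv_into_into)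
  have "inj_on h (f ` K)" using h assms by (auto simp: inj_on_def)
  moreover have "h ` f ` K = g ` K" using h by (force simp: image_image)
  ultimately show ?thesis by (metis card_image)
qed

section \<open>Right cosets as states of the extension\<close>

locale psl_subgroup =
  fixes H :: "(int^2^2) set set"
  assumes H: "subgroup H PSL2Z" and finite_index: "finite (rcosets\<^bsub>PSL2Z\<^esub> H)"
begin

sublocale G: group PSL2Z by (rule PSL2Z_group)

sublocale act: group_action PSL2Z UNIV psl_act by (rule psl_act_action)

lemma pm_in_H:
  assumes "h \<in> H"
  obtains A where "det A = 1" "h = pm A"
  using subgroup.mem_carrier[OF H assms] carrier_PSL2Z by auto

lemma mem_Union_H: "A \<in> \<Union>H \<longleftrightarrow> det A = 1 \<and> pm A \<in> H"
proof
  assume "A \<in> \<Union>H"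
  then obtain h where h: "h \<in> H" "A \<in> h" by auto
  from h(1) obtain B where B: "det B = 1" "h = pm B" by (rule pm_in_H)
  hence "A = B \<or> A = - B" using h by (auto simp: pm_def)
  moreover have "det (- B) = det B" by (simp add: det_2)
  moreover have "pm (- B) = pm B" by (auto simp: pm_def)
  ultimately show "det A = 1 \<and> pm A \<in> H" using B h by auto
qed (auto simp: pm_def)

text \<open>
  The matrices of the expansions have determinant \<open>1\<close> or \<open>-1\<close>. We therefore use as states the
  right cosets, in the matrices of determinant \<open>\<plusminus>1\<close>, of the preimage \<open>\<Union>H\<close> of \<open>H\<close> in \<open>SL2Z\<close>; there are
  twice as many of them as right cosets of \<open>H\<close>.
\<close>

definition matrix_coset :: "int^2^2 \<Rightarrow> (int^2^2) set" where
  "matrix_coset A = (\<lambda>X. X ** A) ` (\<Union>H)"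

definition translate :: "(int^2^2) set \<Rightarrow> int^2^2 \<Rightarrow> (int^2^2) set" where
  "translate f B = (\<lambda>X. X ** B) ` f"

definition states :: "(int^2^2) set set" where
  "states = matrix_coset ` {A. \<bar>det A\<bar> = 1}"

lemma translate_coset: "translate (matrix_coset A) B = matrix_coset (A ** B)"
  by (auto simp: translate_def matrix_coset_def image_image matrix_mul_assoc)

lemma translate_translate: "translate (translate f A) B = translate f (A ** B)"
  by (auto simp: translate_def image_image matrix_mul_assoc)

lemma translate_one: "translate f (mat 1) = f"
  by (simp add: translate_def)

lemma translate_in: "f \<in> states \<Longrightarrow> \<bar>det B\<bar> = 1 \<Longrightarrow> translate f B \<in> states"
  by (auto simp: states_def translate_coset det_mul abs_mult)

lemma translate_bij:
  assumes "\<bar>det B\<bar> = 1"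
  shows "bij_betw (\<lambda>f. translate f B) states states"
  using inv2[OF assms] assms
  by (intro bij_betw_byWitness[where f' = "\<lambda>f. translate f (inv2 B)"])
     (auto simp: translate_translate translate_one translate_in)

lemma pm_one_in: "pm (mat 1) \<in> H"
  using subgroup.one_closed[OF H] by (simp add: pm_one)

lemma mem_matrix_coset: "A \<in> matrix_coset A"
proof -
  have "mat 1 \<in> \<Union>H" using pm_one_in unfolding mem_Union_H by simp
  thus ?thesis unfolding matrix_coset_def by (intro image_eqI[of _ _ "mat 1"]) auto
qed

text \<open>The preimage of \<open>H\<close> contains minus the identity, which is central. This
  supplies the sign hypothesis of \<open>GL2Z_generators\<close>.\<close>

lemma translate_neg:
  assumes "f \<in> states"
  shows "translate f (- B) = translate f B"
proof -
  obtain A where f: "f = matrix_coset A" using assms by (auto simp: states_def)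
  have "(\<Union>H) = uminus ` (\<Union>H)"
  proof -
    have neg: "- X \<in> \<Union>H" if "X \<in> \<Union>H" for X
      using that unfolding mem_Union_H by (simp add: det_2 pm_def insert_commute)
    show ?thesis
    proof (intro equalityI subsetI)
      fix X assume "X \<in> \<Union>H"
      from neg[OF this] have "- (- X) \<in> uminus ` (\<Union>H)" by (rule imageI)
      thus "X \<in> uminus ` (\<Union>H)" by simp
    qed (use neg in blast)
  qed
  hence "matrix_coset (A ** B) = (\<lambda>X. X ** (A ** B)) ` (uminus ` (\<Union>H))" unfolding matrix_coset_def by simp
  also have "\<dots> = matrix_coset (A ** (- B))"
    unfolding matrix_coset_def image_image
    by (intro image_cong refl) (simp add: matrix2_eq_iff matrix2_mult_nth algebra_simps)
  finally show ?thesis by (simp add: f translate_coset)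
qed

lemma Union_rcoset:
  assumes "det A = 1"
  shows "\<Union>(H #>\<^bsub>PSL2Z\<^esub> pm A) = matrix_coset A"
proof (intro equalityI subsetI)
  fix Y assume "Y \<in> \<Union>(H #>\<^bsub>PSL2Z\<^esub> pm A)"
  then obtain h where h: "h \<in> H" "Y \<in> h \<otimes>\<^bsub>PSL2Z\<^esub> pm A" by (auto simp: r_coset_def)
  from h(1) obtain B where B: "det B = 1" "h = pm B" by (rule pm_in_H)
  have BH: "B \<in> \<Union>H" "- B \<in> \<Union>H" using B h by (auto simp: pm_def)
  have "Y = B ** A \<or> Y = (- B) ** A"
    using h(2) B assms by (simp add: pm_mult) (auto simp: pm_def matrix2_eq_iff matrix2_mult_nth)
  thus "Y \<in> matrix_coset A" using BH by (auto simp: matrix_coset_def)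
next
  fix Y assume "Y \<in> matrix_coset A"
  then obtain B where B: "B \<in> \<Union>H" "Y = B ** A" by (auto simp: matrix_coset_def)
  hence "Y \<in> pm B \<otimes>\<^bsub>PSL2Z\<^esub> pm A" "pm B \<in> H"
    using assms unfolding mem_Union_H by (simp_all add: pm_mult) (simp add: pm_def)
  thus "Y \<in> \<Union>(H #>\<^bsub>PSL2Z\<^esub> pm A)" by (auto simp: r_coset_def)
qed

definition even_states :: "(int^2^2) set set" where
  "even_states = matrix_coset ` {A. det A = 1}"

text \<open>Any matrix of determinant -1 exchanges the two halves of the states; this one negates
  the first column and so leaves \<open>point\<close> unchanged.\<close>

definition flip :: "int^2^2" where
  "flip = mat2 (-1) 0 0 1"

lemma det_flip: "det flip = - 1"
  by (simp add: flip_def det_mat2)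

lemma states_eq: "states = even_states \<union> (\<lambda>f. translate f flip) ` even_states"
proof (intro equalityI subsetI)
  fix f assume "f \<in> states"
  then obtain A where A: "\<bar>det A\<bar> = 1" "f = matrix_coset A" by (auto simp: states_def)
  show "f \<in> even_states \<union> (\<lambda>f. translate f flip) ` even_states"
  proof (cases "det A = 1")
    case False
    hence "det (A ** flip) = 1" using A by (auto simp: det_mul det_flip)
    moreover have "flip ** flip = mat 1" by (simp add: flip_def matrix2_mult matrix2_eq_iff)
    hence "f = translate (matrix_coset (A ** flip)) flip"
      using A by (simp add: translate_coset flip: matrix_mul_assoc)
    ultimately show ?thesis unfolding even_states_def by blast
  qed (use A in \<open>auto simp: even_states_def\<close>)
qed (auto simp: states_def even_states_def translate_coset det_mul det_flip)

lemma even_states_det: "f \<in> even_states \<Longrightarrow> X \<in> f \<Longrightarrow> det X = 1"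
proof -
  assume "f \<in> even_states" "X \<in> f"
  then obtain A B where "det A = 1" "B \<in> \<Union>H" "X = B ** A"
    unfolding even_states_def matrix_coset_def by blast
  thus "det X = 1" unfolding mem_Union_H by (simp add: det_mul)
qed

lemma odd_states_det: "f \<in> even_states \<Longrightarrow> X \<in> translate f flip \<Longrightarrow> det X = - 1"
  using even_states_det by (auto simp: translate_def det_mul det_flip)

lemma even_states_nonempty: "f \<in> even_states \<Longrightarrow> f \<noteq> {}"
  using mem_matrix_coset by (auto simp: even_states_def)

lemma even_states_Union: "bij_betw Union (rcosets\<^bsub>PSL2Z\<^esub> H) even_states"
proof -
  have R: "rcosets\<^bsub>PSL2Z\<^esub> H = (\<lambda>A. H #>\<^bsub>PSL2Z\<^esub> pm A) ` {A. det A = 1}"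
    by (auto simp: RCOSETS_def carrier_PSL2Z)
  have "Union ` (rcosets\<^bsub>PSL2Z\<^esub> H) = even_states"
    unfolding R even_states_def image_image by (intro image_cong refl) (simp add: Union_rcoset)
  moreover have "inj_on Union (rcosets\<^bsub>PSL2Z\<^esub> H)"
  proof (rule inj_on_inverseI)
    fix C assume C: "C \<in> rcosets\<^bsub>PSL2Z\<^esub> H"
    have "C \<subseteq> carrier PSL2Z" using subgroup.rcosets_carrier[OF H G.group_axioms C] .
    have e: "pm X = g" if X: "X \<in> g" and g: "g \<in> C" for X g
    proof -
      obtain A where "g = pm A" using g \<open>C \<subseteq> carrier PSL2Z\<close> carrier_PSL2Z by auto
      hence "X = A \<or> X = - A" using X by (auto simp: pm_def)
      thus ?thesis using \<open>g = pm A\<close> by (auto simp: pm_eq_iff)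
    qed
    show "pm ` (\<Union>C) = C"
    proof (intro equalityI subsetI)
      fix g assume g: "g \<in> C"
      then obtain A where "g = pm A" using \<open>C \<subseteq> carrier PSL2Z\<close> carrier_PSL2Z by auto
      thus "g \<in> pm ` (\<Union>C)" using g by (auto simp: pm_def)
    qed (use e in auto)
  qed
  ultimately show ?thesis by (simp add: bij_betw_def)
qed

lemma finite_even_states: "finite even_states"
  using even_states_Union finite_index bij_betw_finite by blast

lemma finite_states: "finite states"
  by (simp add: states_eq finite_even_states)

lemma card_states_filter:
  assumes "\<And>f. f \<in> even_states \<Longrightarrow> P (translate f flip) \<longleftrightarrow> P f"
  shows "card {f\<in>states. P f} = 2 * card {C\<in>rcosets\<^bsub>PSL2Z\<^esub> H. P (\<Union>C)}"
proof -
  let ?E = "{f\<in>even_states. P f}"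
  have inj: "inj_on (\<lambda>f. translate f flip) even_states"
  proof (rule inj_on_subset)
    show "inj_on (\<lambda>f. translate f flip) states"
      using translate_bij[of flip] by (simp add: bij_betw_def det_flip)
  qed (auto simp: states_eq)
  have "{f\<in>states. P f} = ?E \<union> (\<lambda>f. translate f flip) ` ?E"
    unfolding states_eq using assms by auto
  moreover have "?E \<inter> (\<lambda>f. translate f flip) ` ?E = {}"
  proof (rule equals0I)
    fix f assume "f \<in> ?E \<inter> (\<lambda>f. translate f flip) ` ?E"
    then obtain g where g: "f \<in> even_states" "g \<in> even_states" "f = translate g flip" by auto
    obtain X where "X \<in> f" using even_states_nonempty[OF g(1)] by auto
    thus False using even_states_det[OF g(1)] odd_states_det[OF g(2)] g(3) by force
  qed
  ultimately have "card {f\<in>states. P f} = card ?E + card ((\<lambda>f. translate f flip) ` ?E)"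
    using finite_even_states by (simp add: card_Un_disjoint)
  also have "card ((\<lambda>f. translate f flip) ` ?E) = card ?E"
    using inj by (intro card_image inj_on_subset[OF inj]) auto
  also have "card ?E = card {C\<in>rcosets\<^bsub>PSL2Z\<^esub> H. P (\<Union>C)}"
  proof -
    have "Union ` {C\<in>rcosets\<^bsub>PSL2Z\<^esub> H. P (\<Union>C)} = ?E"
    proof -
      have e: "Union ` (rcosets\<^bsub>PSL2Z\<^esub> H) = even_states" using even_states_Union by (simp add: bij_betw_def)
      show ?thesis unfolding e[symmetric] by blast
    qed
    moreover have "inj_on Union {C\<in>rcosets\<^bsub>PSL2Z\<^esub> H. P (\<Union>C)}"
      using even_states_Union by (auto simp: bij_betw_def intro: inj_on_subset)
    ultimately show ?thesis using card_image by fastforce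
  qed
  finally show ?thesis by simp
qed

section \<open>States over a cusp and the cusp width\<close>

definition in_cusp :: "rat option set \<Rightarrow> (int^2^2) set \<Rightarrow> bool" where
  "in_cusp \<kappa> f \<longleftrightarrow> (\<exists>A\<in>f. point A \<in> \<kappa>)"

lemma cusp_invariant:
  assumes "\<kappa> \<in> cusps H" "h \<in> H"
  shows "psl_act h x \<in> \<kappa> \<longleftrightarrow> x \<in> \<kappa>"
proof -
  obtain z where z: "\<kappa> = {psl_act g z | g. g \<in> H}"
    using assms(1) by (auto simp: cusps_def orbits_def orbit_def)
  have c: "g \<in> H \<Longrightarrow> g \<in> carrier PSL2Z" for g by (rule subgroup.mem_carrier[OF H])
  have fwd: "psl_act g y \<in> \<kappa>" if y: "y \<in> \<kappa>" and g: "g \<in> H" for y g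
  proof -
    obtain g' where g': "g' \<in> H" "y = psl_act g' z" using y z by auto
    hence "psl_act g y = psl_act (g \<otimes>\<^bsub>PSL2Z\<^esub> g') z"
      using act.composition_rule[of z g g'] c g by simp
    moreover have "g \<otimes>\<^bsub>PSL2Z\<^esub> g' \<in> H" using g' g subgroup.m_closed[OF H] by blast
    ultimately show ?thesis using z by blast
  qed
  have "psl_act (inv\<^bsub>PSL2Z\<^esub> h) (psl_act h x) = x"
    using act.orbit_sym_aux[of h x "psl_act h x"] c assms by simp
  thus ?thesis
    using fwd[of x h] fwd[of "psl_act h x" "inv\<^bsub>PSL2Z\<^esub> h"] assms(2) subgroup.m_inv_closed[OF H assms(2)] by auto
qed

text \<open>Elements of a coset differ by left factors from \<open>H\<close>, which preserve the
  cusp, so one representative decides.\<close>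

lemma in_cusp_coset:
  assumes "\<kappa> \<in> cusps H" "\<bar>det A\<bar> = 1"
  shows "in_cusp \<kappa> (matrix_coset A) \<longleftrightarrow> point A \<in> \<kappa>"
proof -
  have "point (B ** A) \<in> \<kappa> \<longleftrightarrow> point A \<in> \<kappa>" if "B \<in> \<Union>H" for B
    using cusp_invariant[OF assms(1), of "pm B" "point A"] that
    unfolding mem_Union_H point_mult[OF assms(2)] psl_act_pm by blast
  thus ?thesis using mem_matrix_coset[of A] unfolding in_cusp_def matrix_coset_def by blast
qed

lemma exists_matrix_to: "\<exists>A. det A = 1 \<and> point A = x"
proof (cases x)
  case None
  thus ?thesis by (intro exI[of _ "mat2 0 1 (-1) 0"]) (simp add: det_mat2 point_def rat_point_def)
next
  case (Some r)
  obtain u v where r: "r = of_int u / of_int v" "v > 0" "coprime u v"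
    using quotient_of_div[of r] quotient_of_denom_pos[of r] quotient_of_coprime[of r]
    by (metis prod.collapse)
  obtain s t where "s * u + t * v = 1" using bezout_int[of u v] r(3) by (metis coprime_imp_gcd_eq_1)
  thus ?thesis using Some r
    by (intro exI[of _ "mat2 t u (- s) v"]) (simp add: det_mat2 point_def rat_point_def algebra_simps)
qed

lemma rcoset_eq_iff:
  assumes "subgroup K PSL2Z" "a \<in> carrier PSL2Z" "b \<in> carrier PSL2Z"
  shows "K #>\<^bsub>PSL2Z\<^esub> a = K #>\<^bsub>PSL2Z\<^esub> b \<longleftrightarrow> a \<otimes>\<^bsub>PSL2Z\<^esub> inv\<^bsub>PSL2Z\<^esub> b \<in> K"
proof
  assume "K #>\<^bsub>PSL2Z\<^esub> a = K #>\<^bsub>PSL2Z\<^esub> b"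
  hence "a \<in> K #>\<^bsub>PSL2Z\<^esub> b" using G.rcos_self[OF assms(2,1)] by simp
  then obtain k where k: "k \<in> K" "a = k \<otimes>\<^bsub>PSL2Z\<^esub> b" by (auto simp: r_coset_def)
  thus "a \<otimes>\<^bsub>PSL2Z\<^esub> inv\<^bsub>PSL2Z\<^esub> b \<in> K"
    using assms subgroup.mem_carrier[OF assms(1) k(1)] by (simp add: G.m_assoc)
next
  assume k: "a \<otimes>\<^bsub>PSL2Z\<^esub> inv\<^bsub>PSL2Z\<^esub> b \<in> K"
  have "a = (a \<otimes>\<^bsub>PSL2Z\<^esub> inv\<^bsub>PSL2Z\<^esub> b) \<otimes>\<^bsub>PSL2Z\<^esub> b" using assms by (simp add: G.m_assoc)
  hence "a \<in> K #>\<^bsub>PSL2Z\<^esub> b" using k unfolding r_coset_def by blast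
  thus "K #>\<^bsub>PSL2Z\<^esub> a = K #>\<^bsub>PSL2Z\<^esub> b" using G.repr_independence[OF _ assms(3,1)] by metis
qed

text \<open>Let \<open>g\<close> map 0 to \<open>x\<close> in the cusp, and let \<open>K\<close> be
  the stabilizer of \<open>x\<close>. If \<open>a\<close> maps 0 into the cusp, some
  \<open>h\<close> in \<open>H\<close> brings the image to \<open>x\<close>, so \<open>h a\<close>
  is \<open>s g\<close> with \<open>s\<close> in \<open>K\<close>. Hence the cosets in question are
  the \<open>H s g\<close>, and two of them coincide iff \<open>s\<close> and \<open>t\<close> agree
  modulo the intersection of \<open>H\<close> and \<open>K\<close>: their number is the index that
  defines the width.\<close>

lemma card_cosets_in_cusp:
  assumes \<kappa>: "\<kappa> \<in> cusps H"
  shows "card {C\<in>rcosets\<^bsub>PSL2Z\<^esub> H. in_cusp \<kappa> (\<Union>C)} = cusp_width H \<kappa>"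
proof -
  obtain x where x: "x \<in> \<kappa>"
  proof -
    obtain z where "\<kappa> = {psl_act g z | g. g \<in> H}" using \<kappa> by (auto simp: cusps_def orbits_def orbit_def)
    thus ?thesis using that pm_one_in by blast
  qed
  obtain A where A: "det A = 1" "point A = x" using exists_matrix_to by blast
  define g where "g = pm A"
  have gc: "g \<in> carrier PSL2Z" using A by (auto simp: g_def carrier_PSL2Z)
  have g0: "psl_act g (Some 0) = x" using A by (simp add: g_def psl_act_pm point_moebius)
  define K L where "K = stabilizer PSL2Z psl_act x" and "L = stabilizer (PSL2Z\<lparr>carrier := H\<rparr>) psl_act x"
  have K: "subgroup K PSL2Z" unfolding K_def by (rule act.stabilizer_subgroup) simp
  have HC: "H \<subseteq> carrier PSL2Z" using H by (rule subgroup.subset)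
  have KC: "K \<subseteq> carrier PSL2Z" using K by (rule subgroup.subset)
  have L: "L = H \<inter> K" using HC by (auto simp: L_def K_def stabilizer_def)
  have Ls: "subgroup L PSL2Z" unfolding L by (rule G.subgroups_Inter_pair[OF H K])
  have comp: "psl_act (a \<otimes>\<^bsub>PSL2Z\<^esub> b) y = psl_act a (psl_act b y)" if "a \<in> carrier PSL2Z" "b \<in> carrier PSL2Z" for a b y
    using act.composition_rule[of y a b] that by simp
  have in_cusp: "in_cusp \<kappa> (\<Union>(H #>\<^bsub>PSL2Z\<^esub> a)) \<longleftrightarrow> psl_act a (Some 0) \<in> \<kappa>" if ac: "a \<in> carrier PSL2Z" for a
  proof -
    obtain B where B: "det B = 1" "a = pm B" using ac carrier_PSL2Z by auto
    show ?thesis using B in_cusp_coset[OF \<kappa>, of B] by (simp add: Union_rcoset psl_act_pm point_moebius)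
  qed
  have "cusp_width H \<kappa> = card ((\<lambda>s. L #>\<^bsub>PSL2Z\<^esub> s) ` K)"
  proof -
    have "rcosets\<^bsub>PSL2Z\<lparr>carrier := K\<rparr>\<^esub> L = (\<lambda>s. L #>\<^bsub>PSL2Z\<^esub> s) ` K"
      by (auto simp: RCOSETS_def r_coset_def)
    thus ?thesis using cusp_width_eq[OF H \<kappa> x]
      by (simp add: point_width_def group_index_def flip: K_def L_def)
  qed
  also have "\<dots> = card ((\<lambda>s. H #>\<^bsub>PSL2Z\<^esub> (s \<otimes>\<^bsub>PSL2Z\<^esub> g)) ` K)"
  proof (rule card_image_eq)
    fix s t assume st: "s \<in> K" "t \<in> K"
    hence c: "s \<in> carrier PSL2Z" "t \<in> carrier PSL2Z" using KC by auto
    have "g \<otimes>\<^bsub>PSL2Z\<^esub> (inv\<^bsub>PSL2Z\<^esub> g \<otimes>\<^bsub>PSL2Z\<^esub> y) = y" if "y \<in> carrier PSL2Z" for y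
      using gc that by (simp add: G.m_assoc[symmetric])
    hence e: "(s \<otimes>\<^bsub>PSL2Z\<^esub> g) \<otimes>\<^bsub>PSL2Z\<^esub> inv\<^bsub>PSL2Z\<^esub> (t \<otimes>\<^bsub>PSL2Z\<^esub> g) = s \<otimes>\<^bsub>PSL2Z\<^esub> inv\<^bsub>PSL2Z\<^esub> t"
      using c gc by (simp add: G.inv_mult_group G.m_assoc)
    have "s \<otimes>\<^bsub>PSL2Z\<^esub> inv\<^bsub>PSL2Z\<^esub> t \<in> K" using st K by (meson subgroup.m_closed subgroup.m_inv_closed)
    thus "L #>\<^bsub>PSL2Z\<^esub> s = L #>\<^bsub>PSL2Z\<^esub> t \<longleftrightarrow> H #>\<^bsub>PSL2Z\<^esub> (s \<otimes>\<^bsub>PSL2Z\<^esub> g) = H #>\<^bsub>PSL2Z\<^esub> (t \<otimes>\<^bsub>PSL2Z\<^esub> g)"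
      using c gc by (simp add: rcoset_eq_iff[OF Ls] rcoset_eq_iff[OF H] e) (simp add: L)
  qed
  also have "(\<lambda>s. H #>\<^bsub>PSL2Z\<^esub> (s \<otimes>\<^bsub>PSL2Z\<^esub> g)) ` K = {C\<in>rcosets\<^bsub>PSL2Z\<^esub> H. in_cusp \<kappa> (\<Union>C)}"
  proof (intro equalityI subsetI)
    fix C assume "C \<in> (\<lambda>s. H #>\<^bsub>PSL2Z\<^esub> (s \<otimes>\<^bsub>PSL2Z\<^esub> g)) ` K"
    then obtain s where s: "s \<in> K" "C = H #>\<^bsub>PSL2Z\<^esub> (s \<otimes>\<^bsub>PSL2Z\<^esub> g)" by auto
    have sc: "s \<in> carrier PSL2Z" "s \<otimes>\<^bsub>PSL2Z\<^esub> g \<in> carrier PSL2Z" using s KC gc by auto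
    have "psl_act (s \<otimes>\<^bsub>PSL2Z\<^esub> g) (Some 0) = x"
      using s comp[OF sc(1) gc] g0 by (simp add: K_def stabilizer_def)
    thus "C \<in> {C\<in>rcosets\<^bsub>PSL2Z\<^esub> H. in_cusp \<kappa> (\<Union>C)}"
      using in_cusp[OF sc(2)] x sc s by (auto simp: RCOSETS_def)
  next
    fix C assume "C \<in> {C\<in>rcosets\<^bsub>PSL2Z\<^esub> H. in_cusp \<kappa> (\<Union>C)}"
    then obtain a where a: "a \<in> carrier PSL2Z" "C = H #>\<^bsub>PSL2Z\<^esub> a" "psl_act a (Some 0) \<in> \<kappa>"
      using in_cusp by (auto simp: RCOSETS_def)
    obtain z where z: "\<kappa> = {psl_act h z | h. h \<in> H}" using \<kappa> by (auto simp: cusps_def orbits_def orbit_def)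
    obtain h1 h2 where h: "h1 \<in> H" "h2 \<in> H" "x = psl_act h1 z" "psl_act a (Some 0) = psl_act h2 z"
      using x a z by auto
    have hc: "h1 \<in> carrier PSL2Z" "h2 \<in> carrier PSL2Z" using h HC by auto
    define h where "h = h1 \<otimes>\<^bsub>PSL2Z\<^esub> inv\<^bsub>PSL2Z\<^esub> h2"
    have hH: "h \<in> H" unfolding h_def using h H by (meson subgroup.m_closed subgroup.m_inv_closed)
    have hca: "h \<in> carrier PSL2Z" using hH HC by auto
    have hx: "psl_act h (psl_act a (Some 0)) = x"
      using comp[of h1 "inv\<^bsub>PSL2Z\<^esub> h2"] hc h act.orbit_sym_aux[of h2 z "psl_act h2 z"] by (simp add: h_def)
    define s where "s = h \<otimes>\<^bsub>PSL2Z\<^esub> a \<otimes>\<^bsub>PSL2Z\<^esub> inv\<^bsub>PSL2Z\<^esub> g"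
    have sc: "s \<in> carrier PSL2Z" using hca a gc by (simp add: s_def)
    have ginv: "psl_act (inv\<^bsub>PSL2Z\<^esub> g) x = Some 0"
      using act.orbit_sym_aux[of g "Some 0" x] gc g0 by simp
    have "psl_act s x = x"
      unfolding s_def using hca a gc by (simp add: comp ginv hx)
    hence sK: "s \<in> K" using sc by (simp add: K_def stabilizer_def)
    have sg: "s \<otimes>\<^bsub>PSL2Z\<^esub> g = h \<otimes>\<^bsub>PSL2Z\<^esub> a" using hca a gc by (simp add: s_def G.m_assoc)
    have "H #>\<^bsub>PSL2Z\<^esub> (h \<otimes>\<^bsub>PSL2Z\<^esub> a) = H #>\<^bsub>PSL2Z\<^esub> a"
      using hca a hH by (subst rcoset_eq_iff[OF H]) (auto simp: G.m_assoc)
    thus "C \<in> (\<lambda>s. H #>\<^bsub>PSL2Z\<^esub> (s \<otimes>\<^bsub>PSL2Z\<^esub> g)) ` K" using sK sg a(2) by (metis image_eqI)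
  qed
  finally show ?thesis ..
qed

lemma translate_flip_in_cusp: "in_cusp \<kappa> (translate f flip) \<longleftrightarrow> in_cusp \<kappa> f"
  by (simp add: in_cusp_def translate_def point_def flip_def matrix2_mult_nth)

lemma card_states_in_cusp:
  assumes "\<kappa> \<in> cusps H"
  shows "real (card {f\<in>states. in_cusp \<kappa> f}) / real (card states) =
    real (cusp_width H \<kappa>) / real (group_index PSL2Z H)"
proof -
  have "card {f\<in>states. in_cusp \<kappa> f} = 2 * cusp_width H \<kappa>"
    using card_states_filter[of "in_cusp \<kappa>"] card_cosets_in_cusp[OF assms] translate_flip_in_cusp by simp
  moreover have "card states = 2 * group_index PSL2Z H"
    using card_states_filter[of "\<lambda>_. True"] by (simp add: group_index_def)
  ultimately show ?thesis by simp
qed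

section \<open>Transitivity of the digit action\<close>

definition digit_act :: "(int^2^2) set \<Rightarrow> int \<Rightarrow> (int^2^2) set" where
  "digit_act f a = translate f (mat2 0 1 1 a)"

lemma digit_act_bij: "bij_betw (\<lambda>f. digit_act f a) states states"
  unfolding digit_act_def by (rule translate_bij) (simp add: det_mat2)

text \<open>Positive digits form only a semigroup. But each of them maps the finite reachable set
  injectively into itself, hence onto itself, so reachability can be traced backwards too. Undoing
  digit 1 and applying digit 2 is a shear, a swap followed by a shear is digit 1, and shears and
  swaps suffice by \<open>GL2Z_generators\<close>.\<close>

lemma digit_act_transitive:
  assumes f: "f \<in> states" and g: "g \<in> states"
  shows "\<exists>w. (\<forall>a\<in>set w. a \<ge> 1) \<and> foldl digit_act f w = g"
proof -
  define reach where "reach = {foldl digit_act f w | w. \<forall>a\<in>set w. a \<ge> 1}"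
  have act_in: "digit_act h a \<in> states" if "h \<in> states" for h a
    using digit_act_bij[of a] that by (auto simp: bij_betw_def)
  have sub: "reach \<subseteq> states"
  proof -
    have "foldl digit_act h w \<in> states" if "h \<in> states" for w h
      using that by (induction w arbitrary: h) (auto intro: act_in)
    thus ?thesis using f by (auto simp: reach_def)
  qed
  have "f \<in> reach" unfolding reach_def by (intro CollectI exI[of _ "[]"]) simp
  have fwd: "digit_act h a \<in> reach" if h: "h \<in> reach" and a: "a \<ge> 1" for h a
  proof -
    obtain w where "\<forall>a\<in>set w. a \<ge> 1" "h = foldl digit_act f w" using h by (auto simp: reach_def)
    thus ?thesis using a unfolding reach_def by (intro CollectI exI[of _ "w @ [a]"]) auto
  qed
  have step: "digit_act h a \<in> reach \<longleftrightarrow> h \<in> reach" if h: "h \<in> states" and a: "a \<ge> 1" for h a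
  proof
    assume r: "digit_act h a \<in> reach"
    have inj: "inj_on (\<lambda>h. digit_act h a) states" using digit_act_bij by (simp add: bij_betw_def)
    have "(\<lambda>h. digit_act h a) ` reach = reach"
      using fwd[OF _ a] finite_subset[OF sub finite_states] inj_on_subset[OF inj sub]
      by (intro endo_inj_surj) auto
    then obtain h' where "h' \<in> reach" "digit_act h' a = digit_act h a" using r by (metis imageE)
    thus "h \<in> reach" using inj h sub by (metis inj_onD subsetD)
  qed (use fwd a in auto)
  define P where "P X \<longleftrightarrow> (\<bar>det X\<bar> = 1 \<longrightarrow> translate f X \<in> reach)" for X
  have digit: "P (X ** mat2 0 1 1 a) \<longleftrightarrow> P X" if "a \<ge> 1" for X a
  proof (cases "\<bar>det X\<bar> = 1")
    case True
    thus ?thesis using step[OF translate_in[OF f True] that] unfolding P_def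
      by (simp add: digit_act_def translate_translate det_mul det_mat2)
  next
    case False
    thus ?thesis unfolding P_def by (simp add: det_mul det_mat2)
  qed
  have i1: "X ** mat2 (-1) 1 1 0 ** mat2 0 1 1 1 = X" for X
  proof -
    have "mat2 (-1) 1 1 0 ** mat2 0 1 1 1 = mat 1" by (simp add: matrix2_mult matrix2_eq_iff)
    thus ?thesis by (simp flip: matrix_mul_assoc)
  qed
  have shear: "P (X ** mat2 1 1 0 1) \<longleftrightarrow> P X" for X
  proof -
    have "X ** mat2 (-1) 1 1 0 ** mat2 0 1 1 2 = X ** mat2 1 1 0 1"
      by (simp add: matrix2_mult flip: matrix_mul_assoc)
    thus ?thesis using digit[of 2 "X ** mat2 (-1) 1 1 0"] digit[of 1 "X ** mat2 (-1) 1 1 0"] i1[of X] by simp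
  qed
  have swap: "P (X ** mat2 0 1 1 0) \<longleftrightarrow> P X" for X
  proof -
    have "X ** mat2 0 1 1 0 ** mat2 1 1 0 1 = X ** mat2 0 1 1 1"
      by (simp add: matrix2_mult flip: matrix_mul_assoc)
    thus ?thesis using shear[of "X ** mat2 0 1 1 0"] digit[of 1 X] by simp
  qed
  obtain A B where AB: "\<bar>det A\<bar> = 1" "f = matrix_coset A" "\<bar>det B\<bar> = 1" "g = matrix_coset B"
    using f g by (auto simp: states_def)
  define X where "X = inv2 A ** B"
  have dX: "\<bar>det X\<bar> = 1" using inv2[OF AB(1)] AB by (simp add: X_def det_mul abs_mult)
  have "P X"
  proof (rule GL2Z_generators[OF dX _ _ shear swap])
    show "P (mat 1)" using \<open>f \<in> reach\<close> by (simp add: P_def translate_one)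
    show "P (- X) \<longleftrightarrow> P X" for X
      unfolding P_def translate_neg[OF f] by (simp add: det_2)
  qed
  hence "translate f X \<in> reach" using dX by (simp add: P_def)
  moreover have "translate f X = g"
    using inv2[OF AB(1)] by (simp add: AB(2,4) X_def translate_coset matrix_mul_assoc)
  ultimately show ?thesis by (auto simp: reach_def)
qed

end

subsection \<open>Equidistribution\<close>

lemma eps_measurable [measurable]: "eps \<in> measurable borel (count_space UNIV)"
  unfolding eps_def by measurable

lemma T_alpha_iterate_measurable [measurable]: "(T_alpha \<alpha> ^^ n) \<in> borel_measurable borel"
  by (intro measurable_compose_n T_alpha_measurable)

lemma cf_matrix_measurable [measurable]: "(\<lambda>x. cf_matrix \<alpha> x n) \<in> measurable borel (count_space UNIV)"
proof (induction n)
  case (Suc n)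
  note [measurable] = Suc.IH
  have 1: "(\<lambda>x. A ** mat2 0 e 1 (d_alpha \<alpha> ((T_alpha \<alpha> ^^ n) x))) \<in> measurable borel (count_space UNIV)" for A e
    by (rule measurable_compose[OF _ measurable_count_space]) measurable
  have 2: "(\<lambda>x. A ** mat2 0 (eps ((T_alpha \<alpha> ^^ n) x)) 1 (d_alpha \<alpha> ((T_alpha \<alpha> ^^ n) x))) \<in> measurable borel (count_space UNIV)" for A
    by (rule measurable_compose_countable[OF 1]) measurable
  show ?case unfolding cf_matrix.simps(2) by (rule measurable_compose_countable[OF 2]) measurable
qed simp

context alpha_cf
begin

lemma sync_measurable [measurable]: "Measurable.pred borel sync"
  unfolding sync_def by measurable

lemma excursion_end_measurable [measurable]: "Measurable.pred borel (\<lambda>y. excursion_end y i)"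
proof -
  have c [measurable]: "(\<lambda>y. col2 (cf_matrix a y n)) \<in> measurable borel (count_space UNIV)" for a n
    by (rule measurable_compose[OF cf_matrix_measurable measurable_count_space])
  have [measurable]: "Measurable.pred borel (\<lambda>y. col2 (M y i) = col2 (cf_matrix 1 y n))" for n
    by (rule measurable_compose_countable[where f = "\<lambda>c y. c = col2 (cf_matrix 1 y n)"]) measurable
  show ?thesis unfolding excursion_end_def returns_def by measurable
qed

lemma excursion_length_measurable [measurable]: "excursion_length \<in> measurable borel (count_space UNIV)"
  unfolding excursion_length_def by measurable

text \<open>Shaped for \<open>return_time_bound\<close>: \<open>n\<close> counts times
  \<open>m\<close> up to which no return has occurred. Without any return,
  \<open>n = excursion_length y\<close> will do, and the \<open>+ 1\<close> in the factor serves
  this case.\<close>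

lemma excursion_length_le_elapsed_time:
  assumes y: "y \<notin> \<rat>" "sync y"
  shows "\<exists>n. (\<forall>m<n. \<forall>j\<in>{1..m}. \<not> sync ((T_alpha 1 ^^ j) y)) \<and>
    excursion_length y \<le> (2 * excursion_rate + 1) * n"
proof (cases "\<exists>n. returns y n")
  case True
  then obtain n where n: "returns y n" by blast
  moreover have "excursion_length y \<le> (2 * excursion_rate + 1) * n"
    using excursion_length_le[OF y n] by simp
  ultimately show ?thesis by (intro exI[of _ n]) (auto simp: returns_def)
next
  case False
  have "\<not> sync ((T_alpha 1 ^^ j) y)" if "j \<noteq> 0" for j
  proof
    assume "sync ((T_alpha 1 ^^ j) y)"
    hence ex: "\<exists>j. j \<noteq> 0 \<and> sync ((T_alpha 1 ^^ j) y)" using that by blast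
    define n where "n = (LEAST j. j \<noteq> 0 \<and> sync ((T_alpha 1 ^^ j) y))"
    have "n \<noteq> 0 \<and> sync ((T_alpha 1 ^^ n) y)" unfolding n_def by (rule LeastI_ex[OF ex])
    moreover have "\<not> sync ((T_alpha 1 ^^ j) y)" if "j \<in> {1..<n}" for j
      using not_less_Least[of j "\<lambda>j. j \<noteq> 0 \<and> sync ((T_alpha 1 ^^ j) y)"] that by (auto simp: n_def)
    ultimately have "returns y n" unfolding returns_def by blast
    thus False using False by blast
  qed
  thus ?thesis by (intro exI[of _ "excursion_length y"]) auto
qed

end

section \<open>The extension by the states and its excursion counts\<close>

locale cusp_distribution = alpha_cf \<alpha> + psl_subgroup H for \<alpha> H
begin

sublocale skew: gauss_extension states digit_act
proof
  show "finite states" by (rule finite_states)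
  have "matrix_coset (mat 1) \<in> states" unfolding states_def by (intro imageI) (simp add: det_2)
  thus "states \<noteq> {}" by blast
qed (use digit_act_bij digit_act_transitive in auto)

definition excursion_count :: "((int^2^2) set \<Rightarrow> bool) \<Rightarrow> (int^2^2) set \<times> real \<Rightarrow> real" where
  "excursion_count P = (\<lambda>(f, y). if sync y then \<Sum>i<excursion_length y. of_bool (P (translate f (M y i))) else 0)"

lemma ext_map_iterate:
  assumes y: "y \<notin> \<rat>" "0 < y" "y < 1"
  shows "(skew.ext_map ^^ n) (f, y) = (translate f (cf_matrix 1 y n), (T_alpha 1 ^^ n) y)"
proof (induction n)
  case 0
  show ?case by (simp add: translate_one)
next
  case (Suc n)
  have "eps ((T_alpha 1 ^^ n) y) = 1" using gauss_iterate[OF y, of n] by (simp add: eps_def)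
  moreover have "skew.ext_map (g, z) = (digit_act g (d_alpha 1 z), T_alpha 1 z)" for g z
    by (simp add: skew.ext_map_def)
  moreover have "digit_act (translate f A) a = translate f (A ** mat2 0 1 1 a)" for A a
    by (simp add: digit_act_def translate_translate)
  ultimately show ?case using Suc by (simp add: cf_matrix.simps(2))
qed

lemma excursion_count_measurable: "excursion_count P \<in> borel_measurable skew.ext_measure"
  unfolding skew.measurable_ext_measure_iff
proof
  fix f
  have 1 [measurable]: "(\<lambda>y. of_bool (P (translate f (M y i))) :: real) \<in> borel_measurable borel" for i
    by (rule measurable_compose[OF cf_matrix_measurable]) simp
  have 2: "(\<lambda>y. \<Sum>i<n. of_bool (P (translate f (M y i))) :: real) \<in> borel_measurable borel" for n
    by measurable
  have [measurable]: "(\<lambda>y. \<Sum>i<excursion_length y. of_bool (P (translate f (M y i))) :: real) \<in> borel_measurable borel"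
    by (rule measurable_compose_countable[OF 2]) measurable
  show "(\<lambda>y. excursion_count P (f, y)) \<in> borel_measurable borel"
    unfolding excursion_count_def by simp
qed

lemma excursion_count_nonneg: "0 \<le> excursion_count P z"
  by (auto simp: excursion_count_def split: prod.split intro!: sum_nonneg)

definition weight :: "real \<Rightarrow> real" where
  "weight y = (if sync y then real (excursion_length y) else 0)"

lemma weight_measurable [measurable]: "weight \<in> borel_measurable borel"
  unfolding weight_def by measurable

lemma excursion_count_True: "excursion_count (\<lambda>_. True) (f, y) = weight y"
  by (simp add: excursion_count_def weight_def)

lemma AE_ext_measure_irrational: "AE z in skew.ext_measure. snd z \<notin> \<rat> \<and> fst z \<in> states"
proof -
  let ?E = "states \<times> (\<rat> :: real set)"
  have "?E \<in> sets skew.ext_measure"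
    unfolding skew.ext_measure_def using null_setsD2[OF countable_imp_null_set_lborel[OF countable_rat]] by (intro pair_measureI) auto
  moreover have "emeasure lborel ({x. (f, x) \<in> ?E} \<inter> {0<..<1}) = 0" for f
    using countable_rat by (intro emeasure_lborel_countable) (auto intro: countable_subset[of _ "\<rat>"])
  ultimately have "?E \<in> null_sets skew.ext_measure" by (rule skew.null_sets_ext_measure)
  from AE_not_in[OF this] AE_space show ?thesis
    by eventually_elim (auto simp: skew.space_ext_measure)
qed

text \<open>The length of an excursion is at most \<open>K\<close> times the number of
  \<open>m\<close> with the starting point in \<open>E m\<close>, and
  \<open>return_time_bound\<close> bounds the integral of this number by the total mass.\<close>

lemma nn_integral_weight_finite:
  "(\<integral>\<^sup>+z. ennreal (excursion_count (\<lambda>_. True) z) \<partial>skew.ext_measure) < \<infinity>"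
proof -
  define A where "A = {z\<in>space skew.ext_measure. sync (snd z)}"
  define E where "E m = {z\<in>A. \<forall>j\<in>{1..m}. (skew.ext_map ^^ j) z \<notin> A}" for m :: nat
  define K where "K = 2 * excursion_rate + 1"
  note [measurable] = skew.ext_map_measurable excursion_count_measurable
  have snd_meas [measurable]: "snd \<in> measurable skew.ext_measure borel"
    unfolding skew.measurable_ext_measure_iff by simp
  have A [measurable]: "A \<in> sets skew.ext_measure" unfolding A_def by measurable
  have As: "A \<subseteq> space skew.ext_measure" by (auto simp: A_def)
  have E: "E m \<in> sets skew.ext_measure" for m
  proof -
    have "E m = {z\<in>space skew.ext_measure. z \<in> A \<and> (\<forall>j\<in>{1..m}. (skew.ext_map ^^ j) z \<notin> A)}"
      using As by (auto simp: E_def)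
    also have "\<dots> \<in> sets skew.ext_measure" by measurable
    finally show ?thesis .
  qed
  have "AE z in skew.ext_measure. ennreal (excursion_count (\<lambda>_. True) z) \<le> of_nat K * (\<Sum>m. indicator (E m) z)"
    using AE_ext_measure_irrational
  proof eventually_elim
    case (elim z)
    obtain f y where z: "z = (f, y)" by (cases z)
    have y: "y \<notin> \<rat>" and f: "f \<in> states" using elim by (auto simp: z)
    show ?case
    proof (cases "sync y")
      case True
      obtain n where n: "\<forall>m<n. \<forall>j\<in>{1..m}. \<not> sync ((T_alpha 1 ^^ j) y)" "excursion_length y \<le> K * n"
        using excursion_length_le_elapsed_time[OF y True] unfolding K_def by blast
      have Em: "z \<in> E m" if "m < n" for m
        using n(1) that True f ext_map_iterate[OF y sync_bounds(1,3)[OF True]]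
        by (auto simp: E_def A_def z skew.space_ext_measure)
      have "of_nat n = (\<Sum>m<n. indicator (E m) z :: ennreal)" using Em by simp
      also have "\<dots> \<le> (\<Sum>m. indicator (E m) z)" by (rule sum_le_suminf) auto
      finally have s: "of_nat n \<le> (\<Sum>m. indicator (E m) z :: ennreal)" .
      have "ennreal (excursion_count (\<lambda>_. True) z) = of_nat (excursion_length y)"
        using True by (simp add: z excursion_count_True weight_def ennreal_of_nat_eq_real_of_nat)
      also have "\<dots> \<le> of_nat (K * n)" using n(2) by (simp only: of_nat_le_iff)
      also have "\<dots> = of_nat K * of_nat n" by simp
      also have "\<dots> \<le> of_nat K * (\<Sum>m. indicator (E m) z)" using s by (intro mult_left_mono) auto
      finally show ?thesis .
    qed (simp add: z excursion_count_True weight_def)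
  qed
  hence "(\<integral>\<^sup>+z. ennreal (excursion_count (\<lambda>_. True) z) \<partial>skew.ext_measure) \<le>
      (\<integral>\<^sup>+z. of_nat K * (\<Sum>m. indicator (E m) z) \<partial>skew.ext_measure)"
    by (rule nn_integral_mono_AE)
  also have "\<dots> = of_nat K * (\<Sum>m. emeasure skew.ext_measure (E m))"
    using E by (simp add: nn_integral_cmult nn_integral_suminf)
  also have "\<dots> \<le> of_nat K * emeasure skew.ext_measure (space skew.ext_measure)"
    unfolding E_def by (intro mult_left_mono skew.ext.return_time_bound A) auto
  also have "\<dots> < \<infinity>"
    using skew.emeasure_ext_measure_finite by (simp add: ennreal_mult_eq_top_iff less_top[symmetric])
  finally show ?thesis .
qed

text \<open>For fixed \<open>y\<close> and \<open>i\<close>, translation by \<open>M y i\<close>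
  permutes the states. Summed over the fibre, each step of the excursion therefore contributes the
  number of states with \<open>P\<close>, whatever \<open>y\<close> and \<open>i\<close>
  are.\<close>

lemma nn_integral_excursion_count:
  "(\<integral>\<^sup>+z. ennreal (excursion_count P z) \<partial>skew.ext_measure) =
    of_nat (card {f\<in>states. P f}) * (\<integral>\<^sup>+y. ennreal (weight y) \<partial>gauss_measure)"
proof -
  have m: "(\<lambda>z. ennreal (excursion_count P z)) \<in> borel_measurable skew.ext_measure"
    using excursion_count_measurable by measurable
  have mf: "(\<lambda>y. ennreal (excursion_count P (f, y))) \<in> borel_measurable gauss_measure" if "f \<in> states" for f
    using m that unfolding skew.measurable_ext_measure_iff by (simp cong: measurable_cong_sets)
  have "(\<integral>\<^sup>+z. ennreal (excursion_count P z) \<partial>skew.ext_measure) =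
      (\<Sum>f\<in>states. \<integral>\<^sup>+y. ennreal (excursion_count P (f, y)) \<partial>gauss_measure)"
    by (rule skew.nn_integral_ext_measure[OF m])
  also have "\<dots> = (\<integral>\<^sup>+y. (\<Sum>f\<in>states. ennreal (excursion_count P (f, y))) \<partial>gauss_measure)"
    by (rule nn_integral_sum[symmetric]) (rule mf)
  also have "\<dots> = (\<integral>\<^sup>+y. of_nat (card {f\<in>states. P f}) * ennreal (weight y) \<partial>gauss_measure)"
  proof (rule nn_integral_cong_AE)
    have "AE y in lborel. y \<notin> (\<rat> :: real set)"
      using countable_rat by (intro AE_not_in countable_imp_null_set_lborel)
    hence "AE y in gauss_measure. y \<notin> \<rat>"
      unfolding AE_gauss_measure by eventually_elim simp
    thus "AE y in gauss_measure. (\<Sum>f\<in>states. ennreal (excursion_count P (f, y))) =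
        of_nat (card {f\<in>states. P f}) * ennreal (weight y)"
    proof eventually_elim
      case (elim y)
      have "(\<Sum>f\<in>states. excursion_count P (f, y)) = card {f\<in>states. P f} * weight y"
      proof (cases "sync y")
        case True
        have "(\<Sum>f\<in>states. excursion_count P (f, y)) =
            (\<Sum>i<excursion_length y. \<Sum>f\<in>states. of_bool (P (translate f (M y i))))"
          using True by (subst sum.swap) (simp add: excursion_count_def)
        also have "\<dots> = (\<Sum>i<excursion_length y. real (card {f\<in>states. P f}))"
        proof (rule sum.cong[OF refl])
          fix i
          have "\<bar>det (M y i)\<bar> = 1" using matrix_invariants[OF elim sync_bounds(4)[OF True], of i] by blast
          hence "(\<Sum>f\<in>states. of_bool (P (translate f (M y i))) :: real) = (\<Sum>f\<in>states. of_bool (P f))"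
            by (intro sum.reindex_bij_betw[where h = "\<lambda>f. translate f (M y i)"] translate_bij)
          also have "\<dots> = real (card {f\<in>states. P f})"
            using finite_states by (simp add: sum.If_cases of_bool_def Int_def)
          finally show "(\<Sum>f\<in>states. of_bool (P (translate f (M y i))) :: real) = real (card {f\<in>states. P f})" .
        qed
        finally show ?thesis using True by (simp add: weight_def)
      qed (simp add: excursion_count_def weight_def)
      moreover have "(\<Sum>f\<in>states. ennreal (excursion_count P (f, y))) = ennreal (\<Sum>f\<in>states. excursion_count P (f, y))"
        by (rule sum_ennreal) (rule excursion_count_nonneg)
      ultimately show ?case
        by (simp add: ennreal_mult' ennreal_of_nat_eq_real_of_nat weight_def)
    qed
  qed
  also have "\<dots> = of_nat (card {f\<in>states. P f}) * (\<integral>\<^sup>+y. ennreal (weight y) \<partial>gauss_measure)"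
    by (rule nn_integral_cmult) (simp cong: measurable_cong_sets)
  finally show ?thesis .
qed

lemma card_states_pos: "card states > 0"
  using finite_states skew.F_nonempty by (simp add: card_gt_0_iff)

text \<open>The integral of the excursion length against the Gauss density; it cancels in
  \<open>mean_count_ratio\<close>.\<close>

definition total_weight :: real where
  "total_weight = enn2real (\<integral>\<^sup>+y. ennreal (weight y) \<partial>gauss_measure)"

lemma nn_integral_weight: "(\<integral>\<^sup>+y. ennreal (weight y) \<partial>gauss_measure) = ennreal total_weight"
proof -
  have "of_nat (card states) * (\<integral>\<^sup>+y. ennreal (weight y) \<partial>gauss_measure) < \<infinity>"
    using nn_integral_weight_finite nn_integral_excursion_count[of "\<lambda>_. True"] by simp
  hence "(\<integral>\<^sup>+y. ennreal (weight y) \<partial>gauss_measure) < \<infinity>"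
    using card_states_pos by (auto simp: ennreal_mult_less_top)
  thus ?thesis by (simp add: total_weight_def)
qed

lemma total_weight_pos: "total_weight > 0"
proof (rule ccontr)
  assume "\<not> ?thesis"
  hence "(\<integral>\<^sup>+y. ennreal (weight y) \<partial>gauss_measure) = 0"
    unfolding nn_integral_weight by (simp add: ennreal_neg)
  hence "AE y in gauss_measure. ennreal (weight y) = 0"
    by (subst (asm) nn_integral_0_iff_AE) (simp_all cong: measurable_cong_sets)
  hence "AE y in lborel. y \<notin> {0<..<\<alpha> / 4}"
    unfolding AE_gauss_measure
  proof eventually_elim
    case (elim y)
    show ?case
    proof
      assume "y \<in> {0<..<\<alpha> / 4}"
      hence "sync y" "0 < y" "y < 1" using alpha_le by (auto simp: sync_def)
      thus False using elim excursion_length_pos[of y] by (simp add: weight_def)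
    qed
  qed
  hence "emeasure lborel {0<..<\<alpha> / 4} = 0"
    using AE_iff_null_sets[of "{0<..<\<alpha> / 4}" lborel] by auto
  thus False using alpha_pos by simp
qed

lemma excursion_count_integral:
  shows "integrable skew.ext_measure (excursion_count P)"
    and "integral\<^sup>L skew.ext_measure (excursion_count P) = card {f\<in>states. P f} * total_weight"
proof -
  have e: "(\<integral>\<^sup>+z. ennreal (excursion_count P z) \<partial>skew.ext_measure) = ennreal (card {f\<in>states. P f} * total_weight)"
    using total_weight_pos unfolding nn_integral_excursion_count nn_integral_weight
    by (simp add: ennreal_mult' ennreal_of_nat_eq_real_of_nat)
  have "integrable skew.ext_measure (excursion_count P) \<and>
      integral\<^sup>L skew.ext_measure (excursion_count P) = card {f\<in>states. P f} * total_weight"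
    using e total_weight_pos excursion_count_measurable excursion_count_nonneg
    by (intro nn_integral_eq_integrable[THEN iffD1]) auto
  thus "integrable skew.ext_measure (excursion_count P)"
    "integral\<^sup>L skew.ext_measure (excursion_count P) = card {f\<in>states. P f} * total_weight" by auto
qed

lemma ext_measure_pos: "measure skew.ext_measure (space skew.ext_measure) > 0"
proof (rule ccontr)
  assume "\<not> ?thesis"
  hence "measure skew.ext_measure (space skew.ext_measure) = 0" using measure_nonneg by (metis order_le_less)
  hence "emeasure skew.ext_measure (space skew.ext_measure) = 0" by (simp add: skew.ext.emeasure_eq_measure)
  hence "space skew.ext_measure \<in> null_sets skew.ext_measure" by (intro null_setsI) auto
  hence "AE z in skew.ext_measure. excursion_count (\<lambda>_. True) z = 0"
    using AE_not_in AE_space by fastforce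
  hence "integral\<^sup>L skew.ext_measure (excursion_count (\<lambda>_. True)) = 0" by (rule integral_eq_zero_AE)
  thus False using excursion_count_integral(2)[of "\<lambda>_. True"] total_weight_pos card_states_pos by simp
qed

definition mean_count :: "((int^2^2) set \<Rightarrow> bool) \<Rightarrow> real" where
  "mean_count P = card {f\<in>states. P f} * total_weight / measure skew.ext_measure (space skew.ext_measure)"

text \<open>The starting state in \<open>frequency\<close> depends on \<open>x\<close>, so one null
  set has to serve all states; as they are finitely many, it can.\<close>

lemma AE_mean_count:
  "AE x in gauss_measure. \<forall>f\<in>states. (\<lambda>n. (\<Sum>i<n. excursion_count P ((skew.ext_map ^^ i) (f, x))) / n) \<longlonglongrightarrow> mean_count P"
proof -
  interpret pair: pair_sigma_finite "count_space states" gauss_measure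
    using finite_states sigma_finite_measure_count_space_countable[of states] skew.gauss.sigma_finite_measure_axioms
    by (simp add: pair_sigma_finite_def countable_finite)
  have "AE z in skew.ext_measure. (\<lambda>n. (\<Sum>i<n. excursion_count P ((skew.ext_map ^^ i) z)) / n) \<longlonglongrightarrow> mean_count P"
    using skew.ext.birkhoff[OF excursion_count_integral(1) ext_measure_pos, of P]
    by (simp add: excursion_count_integral(2) mean_count_def)
  hence "\<forall>f\<in>states. AE x in gauss_measure. (\<lambda>n. (\<Sum>i<n. excursion_count P ((skew.ext_map ^^ i) (f, x))) / n) \<longlonglongrightarrow> mean_count P"
    using pair.AE_pair unfolding skew.ext_measure_def AE_count_space by blast
  thus ?thesis using finite_states by (simp add: AE_ball_countable countable_finite)
qed

section \<open>Frequencies along individual orbits\<close>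

lemma iterate_count:
  assumes y: "y \<notin> \<rat>" "0 < y" "y < 1"
  shows "excursion_count P ((skew.ext_map ^^ j) (f, y)) = (if sync ((T_alpha 1 ^^ j) y) then
    \<Sum>i<excursion_length ((T_alpha 1 ^^ j) y). of_bool (P (translate f (cf_matrix 1 y j ** M ((T_alpha 1 ^^ j) y) i))) else 0)"
  unfolding ext_map_iterate[OF y] by (simp add: excursion_count_def translate_translate)

lemma in_cusp_translate_col2:
  assumes "f \<in> states" "col2 A = col2 B"
  shows "in_cusp \<kappa> (translate f A) \<longleftrightarrow> in_cusp \<kappa> (translate f B)"
proof -
  have "point (X ** A) = point (X ** B)" for X
    using col2_mult[OF assms(2), of X] by (simp add: point_def col2_def)
  thus ?thesis by (simp add: in_cusp_def translate_def)
qed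

lemma mean_count_True_pos: "mean_count (\<lambda>_. True) > 0"
  using total_weight_pos card_states_pos ext_measure_pos by (simp add: mean_count_def)

lemma mean_count_ratio:
  assumes "\<kappa> \<in> cusps H"
  shows "mean_count (in_cusp \<kappa>) / mean_count (\<lambda>_. True) = real (cusp_width H \<kappa>) / real (group_index PSL2Z H)"
proof -
  have "mean_count (in_cusp \<kappa>) / mean_count (\<lambda>_. True) = real (card {f\<in>states. in_cusp \<kappa> f}) / real (card states)"
    using total_weight_pos card_states_pos ext_measure_pos by (simp add: mean_count_def)
  thus ?thesis using card_states_in_cusp[OF assms] by simp
qed

text \<open>Per regular step, \<open>\<lambda>_. True\<close> averages the elapsed
  \<open>\<alpha>\<close>-time and \<open>in_cusp \<kappa>\<close> the visits to the cusp;
  \<open>average_time_change\<close> along \<open>elapsed y\<close> turns the quotient into a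
  frequency per \<open>\<alpha>\<close>-step.\<close>

lemma frequency_from_sync:
  assumes \<kappa>: "\<kappa> \<in> cusps H" and y: "y \<notin> \<rat>" "sync y" and f: "f \<in> states"
    and avg: "\<And>P. P \<in> {in_cusp \<kappa>, \<lambda>_. True} \<Longrightarrow>
      (\<lambda>n. (\<Sum>i<n. excursion_count P ((skew.ext_map ^^ i) (f, y))) / n) \<longlonglongrightarrow> mean_count P"
  shows "(\<lambda>n. (\<Sum>i<n. of_bool (in_cusp \<kappa> (translate f (M y i)))) / real n)
    \<longlonglongrightarrow> real (cusp_width H \<kappa>) / real (group_index PSL2Z H)"
proof -
  note b = sync_bounds[OF y(2)]
  define g :: "int^2^2 \<Rightarrow> real" where "g A = of_bool (in_cusp \<kappa> (translate f A))" for A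
  have gcol: "g A = g B" if "col2 A = col2 B" for A B
    using in_cusp_translate_col2[OF f that] by (simp add: g_def)
  have 1: "(\<Sum>j<m. excursion_count (in_cusp \<kappa>) ((skew.ext_map ^^ j) (f, y))) = (\<Sum>i<elapsed y m. g (M y i))" for m
    using excursion_decomposition[OF y, of g m] gcol unfolding iterate_count[OF y(1) b(1,3)] g_def by blast
  have 2: "(\<Sum>j<m. excursion_count (\<lambda>_. True) ((skew.ext_map ^^ j) (f, y))) = real (elapsed y m)" for m
    unfolding iterate_count[OF y(1) b(1,3)] elapsed_def by (simp add: if_distrib cong: if_cong)
  have "(\<lambda>n. (\<Sum>i<n. g (M y i)) / n) \<longlonglongrightarrow> mean_count (in_cusp \<kappa>) / mean_count (\<lambda>_. True)"
  proof (rule average_time_change)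
    show "mono (elapsed y)" unfolding elapsed_def by (intro monoI sum_mono2) auto
    show "(\<lambda>m. real (elapsed y m) / m) \<longlonglongrightarrow> mean_count (\<lambda>_. True)" using avg[of "\<lambda>_. True"] by (simp add: 2)
    show "(\<lambda>m. (\<Sum>i<elapsed y m. g (M y i)) / m) \<longlonglongrightarrow> mean_count (in_cusp \<kappa>)"
      using avg[of "in_cusp \<kappa>"] by (simp add: 1)
    show "mean_count (\<lambda>_. True) > 0" by (rule mean_count_True_pos)
    show "0 \<le> g (M y i)" for i by (simp add: g_def)
  qed
  thus ?thesis by (simp add: mean_count_ratio[OF \<kappa>] g_def)
qed

lemma approximant_point:
  assumes "x \<notin> \<rat>"
  shows "approximant \<alpha> x n = point (mat2 1 (d_0 \<alpha> x) 0 1 ** M (x - of_int (d_0 \<alpha> x)) n)"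
proof -
  let ?y = "x - of_int (d_0 \<alpha> x)"
  have "?y \<notin> \<rat>"
  proof
    assume "?y \<in> \<rat>"
    hence "?y + of_int (d_0 \<alpha> x) \<in> \<rat>" by (intro Rats_add) auto
    thus False using assms by simp
  qed
  hence q: "q_n \<alpha> ?y n > 0" using alpha_pos alpha_le d_0_in by (intro q_n_pos) auto
  have "of_int (p_n \<alpha> ?y n + d_0 \<alpha> x * q_n \<alpha> ?y n) / of_int (q_n \<alpha> ?y n)
      = (of_int (d_0 \<alpha> x) + of_int (p_n \<alpha> ?y n) / of_int (q_n \<alpha> ?y n) :: rat)"
    using q by (simp add: field_simps)
  thus ?thesis
    using cf_matrix_p_q[of \<alpha> ?y n] q
    by (simp add: approximant_def Let_def point_def matrix2_mult_nth rat_point_def)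
qed

text \<open>Wait for the first synchronisation, use \<open>frequency_from_sync\<close> there, and
  discard the finite beginnings in both time scales by \<open>average_shift\<close>.\<close>

lemma frequency:
  assumes \<kappa>: "\<kappa> \<in> cusps H" and x: "x \<notin> \<rat>"
    and avg: "\<And>P f. P \<in> {in_cusp \<kappa>, \<lambda>_. True} \<Longrightarrow> f \<in> states \<Longrightarrow>
      (\<lambda>n. (\<Sum>i<n. excursion_count P ((skew.ext_map ^^ i) (f, x - of_int \<lfloor>x\<rfloor>))) / n) \<longlonglongrightarrow> mean_count P"
  shows "(\<lambda>N. real (card {n\<in>{1..N}. approximant \<alpha> x n \<in> \<kappa>}) / real N)
    \<longlonglongrightarrow> real (cusp_width H \<kappa>) / real (group_index PSL2Z H)"
proof -
  let ?r = "real (cusp_width H \<kappa>) / real (group_index PSL2Z H)"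
  \<comment> \<open>The regular expansion starts from the fractional part \<open>z\<close>, the
    \<open>\<alpha>\<close>-expansion from \<open>x'\<close>; the integer \<open>c\<close>
    reconciles the two integer parts.\<close>
  define z x' c where "z = x - of_int \<lfloor>x\<rfloor>" and "x' = x - of_int (d_0 \<alpha> x)" and "c = \<lfloor>x\<rfloor> - d_0 \<alpha> x"
  have shift_irr: "x - of_int k \<notin> \<rat>" for k
  proof
    assume "x - of_int k \<in> \<rat>"
    hence "x - of_int k + of_int k \<in> \<rat>" by (intro Rats_add) auto
    thus False using x by simp
  qed
  have zi: "z \<notin> \<rat>" and x'i: "x' \<notin> \<rat>" using shift_irr by (auto simp: z_def x'_def)
  have "z \<noteq> 0" using zi by auto
  moreover have "0 \<le> z" "z < 1" unfolding z_def by linarith+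
  ultimately have z: "0 < z" "z < 1" by auto
  have x'I: "x' \<in> I_alpha \<alpha>" unfolding x'_def by (rule d_0_in)
  have xz: "x' = z + of_int c" by (simp add: x'_def z_def c_def)
  \<comment> \<open>The state that records the translation by \<open>\<lfloor>x\<rfloor>\<close>, so
    that states speak about approximants of \<open>x\<close> and not of \<open>z\<close>.\<close>
  define f where "f = matrix_coset (mat2 1 \<lfloor>x\<rfloor> 0 1)"
  have f: "f \<in> states" unfolding f_def states_def by (intro imageI) (simp add: det_mat2)
  obtain n0 where n0: "sync ((T_alpha 1 ^^ n0) z)"
  \<comment> \<open>Without any synchronisation all excursion lengths along the orbit would be 0,
    although their average tends to a positive mean.\<close>
  proof (rule ccontr)
    assume "\<not> thesis"
    hence no: "\<not> sync ((T_alpha 1 ^^ n) z)" for n using that by blast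
    have "excursion_count (\<lambda>_. True) ((skew.ext_map ^^ j) (f, z)) = 0" for j
      unfolding iterate_count[OF zi z] using no by simp
    hence "(\<lambda>n. 0) \<longlonglongrightarrow> mean_count (\<lambda>_. True)" using avg[of "\<lambda>_. True" f] f by (simp flip: z_def)
    hence "mean_count (\<lambda>_. True) = 0" by (simp add: tendsto_const_iff)
    thus False using mean_count_True_pos by simp
  qed
  define y R where "y = (T_alpha 1 ^^ n0) z" and "R = cf_matrix 1 z n0"
  have y: "y \<notin> \<rat>" "0 < y" "sync y" using gauss_iterate[OF zi z, of n0] n0 by (auto simp: y_def)
  define B where "B = mat2 1 c 0 1 ** R"
  note sm = sync_matrix[OF x'i x'I zi z xz, of B n0, folded y_def R_def, OF B_def]
  obtain k where k: "col2 (M x' k) = col2 B" using sm(4) y by blast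
  have cont: "M x' (k + i) = B ** M y i" if "i \<noteq> 0" for i
    using k that by (intro resynchronise[OF x'i x'I y(2) sm(1-3)]) (auto simp: col2_def)
  have detR: "\<bar>det R\<bar> = 1"
    using rcf.matrix_invariants[of z n0] zi z by (simp add: R_def I_alpha_def)
  have fR: "translate f R \<in> states" using f detR by (rule translate_in)
  have it: "(skew.ext_map ^^ n0) (f, z) = (translate f R, y)"
    unfolding ext_map_iterate[OF zi z] by (simp add: R_def y_def)
  have freq: "(\<lambda>n. (\<Sum>i<n. of_bool (in_cusp \<kappa> (translate (translate f R) (M y i)))) / real n) \<longlonglongrightarrow> ?r"
  proof (rule frequency_from_sync[OF \<kappa> y(1,3) fR])
    fix P assume "P \<in> {in_cusp \<kappa>, \<lambda>_. True}"
    hence "(\<lambda>n. (\<Sum>i<n. excursion_count P ((skew.ext_map ^^ i) (f, z))) / n) \<longlonglongrightarrow> mean_count P"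
      using avg f by (simp add: z_def)
    hence "(\<lambda>n. (\<Sum>i<n. excursion_count P ((skew.ext_map ^^ (i + n0)) (f, z))) / n) \<longlonglongrightarrow> mean_count P"
      by (subst average_shift)
    thus "(\<lambda>n. (\<Sum>i<n. excursion_count P ((skew.ext_map ^^ i) (translate f R, y))) / n) \<longlonglongrightarrow> mean_count P"
      by (simp add: funpow_add it)
  qed
  define h :: "nat \<Rightarrow> real" where "h n = of_bool (approximant \<alpha> x n \<in> \<kappa>)" for n
  \<comment> \<open>\<open>cont\<close> holds from index 1 on, hence the shift by 1 on both
    sides.\<close>
  have hk: "of_bool (in_cusp \<kappa> (translate (translate f R) (M y (i + 1)))) = h (i + (k + 1))" for i
  proof -
    have yI: "y \<in> I_alpha \<alpha>" using sync_bounds[OF y(3)] by simp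
    have dM: "\<bar>det (M y (i + 1))\<bar> = 1" using matrix_invariants[OF y(1) yI] by blast
    have "mat2 1 (d_0 \<alpha> x) 0 1 ** mat2 1 c 0 1 = mat2 1 \<lfloor>x\<rfloor> 0 1"
      by (simp add: matrix2_mult c_def)
    hence "mat2 1 (d_0 \<alpha> x) 0 1 ** M x' (k + (i + 1)) = mat2 1 \<lfloor>x\<rfloor> 0 1 ** R ** M y (i + 1)"
      using cont[of "i + 1"] by (simp add: B_def matrix_mul_assoc)
    hence "approximant \<alpha> x (k + (i + 1)) = point (mat2 1 \<lfloor>x\<rfloor> 0 1 ** R ** M y (i + 1))"
      unfolding approximant_point[OF x] x'_def by simp
    moreover have "in_cusp \<kappa> (translate (translate f R) (M y (i + 1))) \<longleftrightarrow> point (mat2 1 \<lfloor>x\<rfloor> 0 1 ** R ** M y (i + 1)) \<in> \<kappa>"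
      unfolding f_def translate_coset using detR dM
      by (intro in_cusp_coset[OF \<kappa>]) (simp add: det_mul abs_mult det_mat2)
    ultimately show ?thesis by (simp add: h_def ac_simps)
  qed
  have "(\<lambda>n. (\<Sum>i<n. h (i + (k + 1))) / real n) \<longlonglongrightarrow> ?r"
    using freq average_shift[of "\<lambda>i. of_bool (in_cusp \<kappa> (translate (translate f R) (M y i)))" 1]
    unfolding hk by blast
  hence "(\<lambda>n. (\<Sum>i<n. h i) / real n) \<longlonglongrightarrow> ?r" by (subst (asm) average_shift)
  \<comment> \<open>A last shift, because the theorem counts from \<open>n = 1\<close> while
    \<open>h\<close> starts at 0.\<close>
  hence "(\<lambda>n. (\<Sum>i<n. h (i + 1)) / real n) \<longlonglongrightarrow> ?r" by (subst average_shift)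
  moreover have "(\<Sum>i<N. h (i + 1)) = real (card {n\<in>{1..N}. approximant \<alpha> x n \<in> \<kappa>})" for N
  proof -
    have "(\<Sum>i<N. h (i + 1)) = (\<Sum>n=1..N. h n)"
      using sum.atLeast_Suc_atMost_Suc_shift[of h 0 "N - 1"] by (cases N) (auto simp: lessThan_Suc_atMost atLeast0AtMost)
    also have "\<dots> = real (card {n\<in>{1..N}. approximant \<alpha> x n \<in> \<kappa>})"
      by (simp add: h_def of_bool_def sum.If_cases Int_def)
    finally show ?thesis .
  qed
  ultimately show ?thesis by simp
qed

lemma countable_cusps: "countable (cusps H)"
proof -
  have "cusps H = orbit (PSL2Z\<lparr>carrier := H\<rparr>) psl_act ` UNIV"
    by (auto simp: cusps_def orbits_def)
  thus ?thesis by simp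
qed

text \<open>The exceptional points are covered by the integer translates of one null set, and there
  are only countably many of these.\<close>

lemma AE_fractional_part:
  assumes "AE z in lborel. 0 < z \<longrightarrow> z < 1 \<longrightarrow> P z"
  shows "AE x in lborel. x \<notin> \<rat> \<longrightarrow> P (x - of_int \<lfloor>x\<rfloor>)"
proof -
  from assms obtain N where N: "N \<in> null_sets lborel" "{z. \<not> (0 < z \<longrightarrow> z < 1 \<longrightarrow> P z)} \<subseteq> N"
    by (auto simp: eventually_ae_filter)
  have "AE x in lborel. \<forall>c::int. x - of_int c \<notin> N"
    unfolding AE_all_countable
  proof
    fix c :: int
    show "AE x in lborel. x - of_int c \<notin> N"
      using AE_not_in[OF null_sets_translation[OF N(1), of "of_int c"]] by simp
  qed
  thus ?thesis
  proof eventually_elim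
    case (elim x)
    show ?case
    proof
      assume x: "x \<notin> \<rat>"
      have "x \<noteq> of_int \<lfloor>x\<rfloor>" using x by (metis Rats_of_int)
      hence "0 < x - of_int \<lfloor>x\<rfloor>" "x - of_int \<lfloor>x\<rfloor> < 1" by linarith+
      thus "P (x - of_int \<lfloor>x\<rfloor>)" using elim N(2) by blast
    qed
  qed
qed

theorem AE_frequency:
  "AE x in lborel. \<forall>\<kappa>\<in>cusps H.
    (\<lambda>N. real (card {n\<in>{1..N}. approximant \<alpha> x n \<in> \<kappa>}) / real N)
      \<longlonglongrightarrow> real (cusp_width H \<kappa>) / real (group_index PSL2Z H)"
proof -
  have irr: "AE x in lborel. x \<notin> (\<rat> :: real set)"
    using countable_rat by (intro AE_not_in countable_imp_null_set_lborel)
  show ?thesis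
    unfolding AE_ball_countable[OF countable_cusps]
  proof
    fix \<kappa> assume \<kappa>: "\<kappa> \<in> cusps H"
    have "AE z in gauss_measure. \<forall>P\<in>{in_cusp \<kappa>, \<lambda>_. True}. \<forall>f\<in>states.
        (\<lambda>n. (\<Sum>i<n. excursion_count P ((skew.ext_map ^^ i) (f, z))) / n) \<longlonglongrightarrow> mean_count P"
      using AE_mean_count by (subst AE_ball_countable) auto
    from AE_fractional_part[OF this[unfolded AE_gauss_measure]] irr
    show "AE x in lborel. (\<lambda>N. real (card {n\<in>{1..N}. approximant \<alpha> x n \<in> \<kappa>}) / real N)
      \<longlonglongrightarrow> real (cusp_width H \<kappa>) / real (group_index PSL2Z H)"
      by eventually_elim (rule frequency[OF \<kappa>]; blast)
  qed
qed

end

theorem theorem4: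
  fixes H :: "(int^2^2) set set" and \<alpha> :: real
  assumes "subgroup H PSL2Z"
    and "finite (rcosets\<^bsub>PSL2Z\<^esub> H)"
    and "0 < \<alpha>" and "\<alpha> \<le> 1"
  shows "AE x in lebesgue. \<forall>\<kappa>\<in>cusps H.
    (\<lambda>N. real (card {n\<in>{1..N}. approximant \<alpha> x n \<in> \<kappa>}) / real N)
      \<longlonglongrightarrow> real (cusp_width H \<kappa>) / real (group_index PSL2Z H)"
proof -
  interpret cusp_distribution \<alpha> H
    using assms by (intro cusp_distribution.intro alpha_cf.intro psl_subgroup.intro)
  show ?thesis using AE_frequency by (rule AE_completion)
qed

end
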